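(* Let $q\ge 2$ be an integer and let $W$ be a $q$-step graphon. If $W'$ is a graphon such that $t(H,W')=t(H,W)$ for every graph $H$ with at most $4q^2-q$ vertices, then $W$ and $W'$ are weakly isomorphic.
   Context: All graphs are finite and simple. A kernel is a bounded measurable symmetric function $U:[0,1]^2\to\mathbb{R}$; a graphon is a kernel with values in $[0,1]$. For a graph $H$ and a kernel $U$, the homomorphism density is $t(H,U)=\int_{[0,1]^{V(H)}}\prod_{uv\in E(H)}U(x_u,x_v)\,\mathrm{d}x_{V(H)}$. Two kernels $U_1,U_2$ are weakly isomorphic if $t(H,U_1)=t(H,U_2)$ for every graph $H$. A $q$-step kernel is a kernel $U$ for which $[0,1]$ can be partitioned into $q$ measurable sets of positive measure $A_1,\ldots,A_q$ (the parts) such that $U$ is constant on each $A_i\times A_j$, $i,j\in[q]$, but no such partition into $q-1$ parts exists. A $q$-step graphon is a $q$-step kernel that is a graphon. *)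

theory Defs
  imports "HOL-Analysis.Analysis" "HOL-Library.Disjoint_Sets"
begin

(* A finite simple graph with vertex set V; edges are two-element subsets of V.
   Every finite graph is isomorphic to one on natural numbers, and homomorphism
   densities are invariant under isomorphism. *)
definition simple_graph :: "nat set \<Rightarrow> nat set set \<Rightarrow> bool" where
  "simple_graph V E \<longleftrightarrow> finite V \<and> (\<forall>e\<in>E. e \<subseteq> V \<and> card e = 2)"

(* Only the values on the unit square matter; "measurable" means Lebesgue measurable. *)
definition kernel :: "(real \<times> real \<Rightarrow> real) \<Rightarrow> bool" where
  "kernel U \<longleftrightarrow>
     U \<in> borel_measurable (lebesgue_on ({0..1} \<times> {0..1})) \<and>
     bounded (U ` ({0..1} \<times> {0..1})) \<and>
     (\<forall>x\<in>{0..1}. \<forall>y\<in>{0..1}. U (x, y) = U (y, x))"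

definition graphon :: "(real \<times> real \<Rightarrow> real) \<Rightarrow> bool" where
  "graphon W \<longleftrightarrow> kernel W \<and> (\<forall>p \<in> {0..1} \<times> {0..1}. W p \<in> {0..1})"

(* Lebesgue measure on the cube of all x : V -> [0,1].  The completion is needed because for
   a Lebesgue measurable U, the map sending x to U (x u, x v) need not be measurable
   with respect to the product sigma-algebra itself. *)
definition cube_measure :: "nat set \<Rightarrow> (nat \<Rightarrow> real) measure" where
  "cube_measure V = completion (Pi\<^sub>M V (\<lambda>_. restrict_space lborel {0..1}))"

(* An edge e = {u, v} with u < v has u = Min e and v = Max e; by symmetry of kernels
   the choice of orientation is immaterial. *)
definition hom_density :: "nat set \<Rightarrow> nat set set \<Rightarrow> (real \<times> real \<Rightarrow> real) \<Rightarrow> real" where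
  "hom_density V E U = (LINT x | cube_measure V. (\<Prod>e\<in>E. U (x (Min e), x (Max e))))"

definition weakly_isomorphic ::
    "(real \<times> real \<Rightarrow> real) \<Rightarrow> (real \<times> real \<Rightarrow> real) \<Rightarrow> bool" where
  "weakly_isomorphic U\<^sub>1 U\<^sub>2 \<longleftrightarrow>
     (\<forall>V E. simple_graph V E \<longrightarrow> hom_density V E U\<^sub>1 = hom_density V E U\<^sub>2)"

definition step_partition :: "(real \<times> real \<Rightarrow> real) \<Rightarrow> nat \<Rightarrow> real set set \<Rightarrow> bool" where
  "step_partition U q P \<longleftrightarrow>
     partition_on {0..1} P \<and> finite P \<and> card P = q \<and>
     (\<forall>A\<in>P. A \<in> sets lebesgue \<and> emeasure lebesgue A > 0) \<and>
     (\<forall>A\<in>P. \<forall>B\<in>P. U constant_on A \<times> B)"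

definition step_kernel :: "nat \<Rightarrow> (real \<times> real \<Rightarrow> real) \<Rightarrow> bool" where
  "step_kernel q U \<longleftrightarrow>
     kernel U \<and> (\<exists>P. step_partition U q P) \<and> (\<nexists>P. step_partition U (q - 1) P)"

definition step_graphon :: "nat \<Rightarrow> (real \<times> real \<Rightarrow> real) \<Rightarrow> bool" where
  "step_graphon q W \<longleftrightarrow> step_kernel q W \<and> graphon W"

end

theory Submission
  imports Defs
begin

text \<open>
  Linear combinations of homomorphism densities of graphs on a vertex set \<open>V\<close> are exactly the
  integrals of polynomials in the values \<open>W (x\<^sub>u, x\<^sub>v)\<close> that are affine in each of them, so two
  graphons that agree on small graphs agree on such polynomials in few vertices.

  First, let \<open>D x y\<close> be the squared \<open>L\<^sup>2\<close>-distance of the codegree functions of \<open>x\<close> and \<open>y\<close>. By the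
  pigeonhole principle the product of \<open>D\<close> over all pairs among \<open>q + 1\<close> points vanishes for \<open>W\<close>; being
  nonnegative, it vanishes almost everywhere for \<open>W'\<close>. Hence \<open>W'\<close> has at most \<open>q\<close> classes of codegree
  functions. If \<open>T\<close> is the integral operator of \<open>W'\<close> and \<open>f\<close> has mean zero on every class, then
  \<open>T (T f)\<close> is orthogonal to \<open>f\<close>, so \<open>T f = 0\<close>; this makes \<open>W'\<close> a step function with at most \<open>q\<close> steps.

  What remains is a statement on two finite weighted models. A suitable test polynomial vanishes on
  every map of its vertex set to a model unless the map is constant on \<open>q\<close> prescribed blocks and
  identifies the model with the matrix of \<open>W\<close>. Further vertices, tied to the blocks, contribute
  factors \<open>\<alpha>\<^sub>i - v\<close> for arbitrary constants \<open>v\<close>, and interpolation determines the weights.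
\<close>

section \<open>Multi-affine polynomials and homomorphism sums\<close>

text \<open>The obstacle behind all constructions is that graphs are simple: an edge variable may be
  used only once, so a condition that has to be tested several times needs fresh edges or vertices.
  Hence the repeated layers of core vertices and the detour through codegrees. The second obstacle
  is cancellation, since a vanishing signed sum says nothing about its terms. For a general graphon
  this is met by a nonnegative polynomial; for finite models, by a polynomial that takes the same
  nonzero value at all maps where it does not vanish. The step structure of \<open>W'\<close> has to
  come first: the test polynomial excludes every wrong value of both matrices by a factor of its
  own, which is possible only when there are finitely many of them. Its constants may depend on the
  unknown matrix of \<open>W'\<close>, because the densities agree for all small graphs and hence
  for all choices of constants.\<close>

definition multi_affine :: "'e set \<Rightarrow> (('e \<Rightarrow> real) \<Rightarrow> real) \<Rightarrow> bool" where
  "multi_affine E F \<longleftrightarrow>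
     finite E \<and> (\<exists>c. \<forall>t. F t = (\<Sum>S\<in>Pow E. c S * (\<Prod>e\<in>S. t e)))"

lemma multi_affine_finite: "multi_affine E F \<Longrightarrow> finite E"
  by (simp add: multi_affine_def)

lemma multi_affine_mono:
  assumes "multi_affine E F" "E \<subseteq> E'" "finite E'"
  shows "multi_affine E' F"
proof -
  obtain c where c: "\<And>t. F t = (\<Sum>S\<in>Pow E. c S * (\<Prod>e\<in>S. t e))"
    using assms(1) by (auto simp: multi_affine_def)
  have "F t = (\<Sum>S\<in>Pow E'. (if S \<subseteq> E then c S else 0) * (\<Prod>e\<in>S. t e))" for t
    unfolding c using assms(2,3) by (intro sum.mono_neutral_cong_left) auto
  then show ?thesis
    using assms(3) by (auto simp: multi_affine_def intro!: exI)
qed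

lemma multi_affine_const: "multi_affine {} (\<lambda>_. a)"
  by (auto simp: multi_affine_def intro!: exI[of _ "\<lambda>_. a"])

lemma multi_affine_var: "multi_affine {e} (\<lambda>t. t e)"
proof -
  have "Pow {e} = {{}, {e}}" by auto
  then show ?thesis
    unfolding multi_affine_def by (intro conjI exI[of _ "\<lambda>S. if S = {} then 0 else 1"]) auto
qed

lemma multi_affine_diff:
  assumes "multi_affine E F" "multi_affine E G"
  shows "multi_affine E (\<lambda>t. F t - G t)"
proof -
  obtain c d where "\<And>t. F t = (\<Sum>S\<in>Pow E. c S * (\<Prod>e\<in>S. t e))"
      "\<And>t. G t = (\<Sum>S\<in>Pow E. d S * (\<Prod>e\<in>S. t e))"
    using assms by (auto simp: multi_affine_def)
  then have "\<And>t. F t - G t = (\<Sum>S\<in>Pow E. (c S - d S) * (\<Prod>e\<in>S. t e))"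
    by (simp add: sum_subtractf algebra_simps)
  then show ?thesis
    using assms(1) by (auto simp: multi_affine_def intro!: exI)
qed

text \<open>A subset of \<open>E \<union> E'\<close> splits uniquely into its traces on the disjoint
  sets \<open>E\<close> and \<open>E'\<close>, so no variable gets squared. A square would be a
  double edge; therefore all later factors are built on pairwise disjoint edge sets.\<close>

lemma multi_affine_mult:
  assumes "multi_affine E F" "multi_affine E' G" "E \<inter> E' = {}"
  shows "multi_affine (E \<union> E') (\<lambda>t. F t * G t)"
proof -
  obtain c d where c: "\<And>t. F t = (\<Sum>S\<in>Pow E. c S * (\<Prod>e\<in>S. t e))"
      and d: "\<And>t. G t = (\<Sum>S\<in>Pow E'. d S * (\<Prod>e\<in>S. t e))"
    using assms by (auto simp: multi_affine_def)
  have fin: "finite E" "finite E'" using assms multi_affine_finite by auto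
  have "F t * G t = (\<Sum>S\<in>Pow (E \<union> E'). (c (S \<inter> E) * d (S \<inter> E')) * (\<Prod>e\<in>S. t e))" for t
  proof -
    have "F t * G t =
        (\<Sum>(S, S')\<in>Pow E \<times> Pow E'. (c S * d S') * ((\<Prod>e\<in>S. t e) * (\<Prod>e\<in>S'. t e)))"
      unfolding c d sum_product sum.cartesian_product
      by (intro sum.cong) (auto simp: mult_ac)
    also have "\<dots> = (\<Sum>S\<in>Pow (E \<union> E'). (c (S \<inter> E) * d (S \<inter> E')) * (\<Prod>e\<in>S. t e))"
    proof (rule sum.reindex_bij_witness[where i = "\<lambda>S. (S \<inter> E, S \<inter> E')" and j = "\<lambda>(S, S'). S \<union> S'"])
      fix a assume a: "a \<in> Pow E \<times> Pow E'"
      obtain S S' where [simp]: "a = (S, S')" by force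
      have S: "S \<subseteq> E" "S' \<subseteq> E'" using a by auto
      have 1: "(S \<union> S') \<inter> E = S" "(S \<union> S') \<inter> E' = S'" using S assms(3) by auto
      show "((case a of (S, S') \<Rightarrow> S \<union> S') \<inter> E, (case a of (S, S') \<Rightarrow> S \<union> S') \<inter> E') = a"
        using 1 by simp
      show "(case a of (S, S') \<Rightarrow> S \<union> S') \<in> Pow (E \<union> E')" using S by auto
      have "(\<Prod>e\<in>S \<union> S'. t e) = (\<Prod>e\<in>S. t e) * (\<Prod>e\<in>S'. t e)"
        using S fin assms(3) by (intro prod.union_disjoint) (auto intro: finite_subset)
      then show "c ((case a of (S, S') \<Rightarrow> S \<union> S') \<inter> E) * d ((case a of (S, S') \<Rightarrow> S \<union> S') \<inter> E') *
          prod t (case a of (S, S') \<Rightarrow> S \<union> S') =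
          (case a of (S, S') \<Rightarrow> c S * d S' * (prod t S * prod t S'))"
        using 1 by simp
    qed auto
    finally show ?thesis .
  qed
  then show ?thesis
    using fin unfolding multi_affine_def
    by (intro conjI exI[of _ "\<lambda>S. c (S \<inter> E) * d (S \<inter> E')"]) auto
qed

lemma multi_affine_prod:
  assumes "finite I" "\<And>i. i \<in> I \<Longrightarrow> multi_affine (E i) (F i)" "disjoint_family_on E I"
  shows "multi_affine (\<Union>i\<in>I. E i) (\<lambda>t. \<Prod>i\<in>I. F i t)"
  using assms
proof (induction I rule: finite_induct)
  case empty
  then show ?case using multi_affine_const[of 1] by simp
next
  case (insert i I)
  have "E i \<inter> (\<Union>j\<in>I. E j) = {}"
    using insert.prems(2) insert.hyps by (auto simp: disjoint_family_on_def)
  moreover have "disjoint_family_on E I"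
    using insert.prems(2) by (auto simp: disjoint_family_on_def)
  ultimately have "multi_affine (E i \<union> (\<Union>j\<in>I. E j)) (\<lambda>t. F i t * (\<Prod>i\<in>I. F i t))"
    using insert by (intro multi_affine_mult) auto
  then show ?case using insert by simp
qed

lemma multi_affine_var_minus_const: "multi_affine {e} (\<lambda>t. t e - a)"
  using multi_affine_var[of e] multi_affine_mono[OF multi_affine_const[of a], of "{e}"]
  by (intro multi_affine_diff) auto

lemma multi_affine_var_minus_var: "multi_affine {e, e'} (\<lambda>t. t e - t e')"
  using multi_affine_mono[OF multi_affine_var[of e], of "{e, e'}"]
    multi_affine_mono[OF multi_affine_var[of e'], of "{e, e'}"]
  by (intro multi_affine_diff) auto

lemma multi_affine_cong:
  assumes "multi_affine E F" "\<And>e. e \<in> E \<Longrightarrow> t e = t' e"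
  shows "F t = F t'"
proof -
  obtain c where c: "\<And>t. F t = (\<Sum>S\<in>Pow E. c S * (\<Prod>e\<in>S. t e))"
    using assms(1) by (auto simp: multi_affine_def)
  show ?thesis unfolding c using assms(2) by (intro sum.cong refl arg_cong2[of _ _ _ _ "(*)"] prod.cong) auto
qed

text \<open>The weighted homomorphism count into a target on \<open>{..<r}\<close> with node weights
  \<open>\<beta>\<close> and edge weights \<open>B\<close>. By \<open>hom_density_step\<close> it is
  the density in a step function whose parts have measures \<open>\<beta> i\<close>.\<close>

definition hom_sum ::
    "nat \<Rightarrow> (nat \<Rightarrow> real) \<Rightarrow> (nat \<Rightarrow> nat \<Rightarrow> real) \<Rightarrow> nat set \<Rightarrow> nat set set \<Rightarrow> real" where
  "hom_sum r \<beta> B V E =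
     (\<Sum>\<phi>\<in>V \<rightarrow>\<^sub>E {..<r}. (\<Prod>v\<in>V. \<beta> (\<phi> v)) * (\<Prod>e\<in>E. B (\<phi> (Min e)) (\<phi> (Max e))))"

text \<open>A bridge between encodings: gadgets have their own vertex type and ordered pairs as
  edges, while \<open>hom_sum\<close> wants numbers and two-element sets. Asymmetry of
  \<open>E\<close> keeps two pairs from collapsing to one edge, and symmetry of \<open>B\<close>
  absorbs the orientation by \<open>Min\<close> and \<open>Max\<close>.\<close>

lemma hom_sum_relabel:
  fixes V :: "'v set"
  assumes f: "inj_on f V" and V: "finite V" and E: "E \<subseteq> V \<times> V"
    and asym: "\<And>u v. (u, v) \<in> E \<Longrightarrow> (v, u) \<notin> E"
    and sym: "\<And>i j. i < r \<Longrightarrow> j < r \<Longrightarrow> B i j = B j i"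
  shows "hom_sum r \<beta> B (f ` V) ((\<lambda>(u, v). {f u, f v}) ` E) =
    (\<Sum>\<phi>\<in>V \<rightarrow>\<^sub>E {..<r}. (\<Prod>v\<in>V. \<beta> (\<phi> v)) * (\<Prod>(u, v)\<in>E. B (\<phi> u) (\<phi> v)))"
proof -
  let ?g = "the_inv_into V f"
  have g: "?g (f v) = v" if "v \<in> V" for v using that f by (simp add: the_inv_into_f_f)
  have inj: "inj_on (\<lambda>(u, v). {f u, f v}) E"
  proof (rule inj_onI)
    fix a b assume ab: "a \<in> E" "b \<in> E" "(case a of (u, v) \<Rightarrow> {f u, f v}) = (case b of (u, v) \<Rightarrow> {f u, f v})"
    obtain u v u' v' where [simp]: "a = (u, v)" "b = (u', v')" by (cases a, cases b) auto
    have "u \<in> V" "v \<in> V" "u' \<in> V" "v' \<in> V" using ab E by auto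
    then have "u = u' \<and> v = v' \<or> u = v' \<and> v = u'"
      using ab(3) f by (auto simp: doubleton_eq_iff inj_on_eq_iff)
    then show "a = b" using ab asym by auto
  qed
  show ?thesis
    unfolding hom_sum_def
  proof (rule sum.reindex_bij_witness[where
        i = "\<lambda>\<phi>. restrict (\<lambda>n. \<phi> (?g n)) (f ` V)" and j = "\<lambda>\<psi>. restrict (\<lambda>v. \<psi> (f v)) V"])
    fix \<psi> assume \<psi>: "\<psi> \<in> f ` V \<rightarrow>\<^sub>E {..<r}"
    show "(\<lambda>n\<in>f ` V. (\<lambda>v\<in>V. \<psi> (f v)) (?g n)) = \<psi>"
      using \<psi> g by (auto simp: fun_eq_iff PiE_def extensional_def)
    show "(\<lambda>v\<in>V. \<psi> (f v)) \<in> V \<rightarrow>\<^sub>E {..<r}" using \<psi> by auto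
    have 1: "(\<Prod>v\<in>V. \<beta> ((\<lambda>v\<in>V. \<psi> (f v)) v)) = (\<Prod>v\<in>f ` V. \<beta> (\<psi> v))"
      using f by (simp add: prod.reindex)
    have 2: "(\<Prod>e\<in>(\<lambda>(u, v). {f u, f v}) ` E. B (\<psi> (Min e)) (\<psi> (Max e))) =
        (\<Prod>(u, v)\<in>E. B ((\<lambda>v\<in>V. \<psi> (f v)) u) ((\<lambda>v\<in>V. \<psi> (f v)) v))"
      unfolding prod.reindex[OF inj]
    proof (intro prod.cong refl)
      fix a assume a: "a \<in> E"
      obtain u v where [simp]: "a = (u, v)" by force
      have uv: "u \<in> V" "v \<in> V" using a E by auto
      then have "\<psi> (f u) < r" "\<psi> (f v) < r" using \<psi> by auto
      then show "((\<lambda>e. B (\<psi> (Min e)) (\<psi> (Max e))) \<circ> (\<lambda>(u, v). {f u, f v})) a =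
          (case a of (u, v) \<Rightarrow> B ((\<lambda>v\<in>V. \<psi> (f v)) u) ((\<lambda>v\<in>V. \<psi> (f v)) v))"
        using uv by (auto simp: min_def max_def sym)
    qed
    show "(\<Prod>v\<in>V. \<beta> ((\<lambda>v\<in>V. \<psi> (f v)) v)) *
        (\<Prod>(u, v)\<in>E. B ((\<lambda>v\<in>V. \<psi> (f v)) u) ((\<lambda>v\<in>V. \<psi> (f v)) v)) =
        (\<Prod>v\<in>f ` V. \<beta> (\<psi> v)) * (\<Prod>e\<in>(\<lambda>(u, v). {f u, f v}) ` E. B (\<psi> (Min e)) (\<psi> (Max e)))"
      using 1 2 by simp
  next
    fix \<phi> assume \<phi>: "\<phi> \<in> V \<rightarrow>\<^sub>E {..<r}"
    show "(\<lambda>v\<in>V. (\<lambda>n\<in>f ` V. \<phi> (?g n)) (f v)) = \<phi>"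
      using \<phi> g by (auto simp: fun_eq_iff PiE_def extensional_def)
    show "(\<lambda>n\<in>f ` V. \<phi> (?g n)) \<in> f ` V \<rightarrow>\<^sub>E {..<r}"
      using \<phi> g by auto
  qed
qed

text \<open>Each monomial of \<open>F\<close> is the edge set of a graph on all of \<open>V\<close>,
  so both sides are the same linear combination of homomorphism sums.\<close>

lemma multi_affine_sum_eq:
  fixes V :: "'v set"
  assumes eq: "\<And>V E. simple_graph V E \<Longrightarrow> card V \<le> n \<Longrightarrow> hom_sum q \<alpha> A V E = hom_sum r \<beta> B V E"
    and F: "multi_affine E F"
    and V: "finite V" "card V \<le> n" and E: "E \<subseteq> V \<times> V"
    and asym: "\<And>u v. (u, v) \<in> E \<Longrightarrow> (v, u) \<notin> E"
    and symA: "\<And>i j. i < q \<Longrightarrow> j < q \<Longrightarrow> A i j = A j i"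
    and symB: "\<And>i j. i < r \<Longrightarrow> j < r \<Longrightarrow> B i j = B j i"
  shows "(\<Sum>\<phi>\<in>V \<rightarrow>\<^sub>E {..<q}. (\<Prod>v\<in>V. \<alpha> (\<phi> v)) * F (\<lambda>(u, v). A (\<phi> u) (\<phi> v))) =
         (\<Sum>\<phi>\<in>V \<rightarrow>\<^sub>E {..<r}. (\<Prod>v\<in>V. \<beta> (\<phi> v)) * F (\<lambda>(u, v). B (\<phi> u) (\<phi> v)))"
proof -
  obtain c where c: "\<And>t. F t = (\<Sum>S\<in>Pow E. c S * (\<Prod>e\<in>S. t e))"
    using F by (auto simp: multi_affine_def)
  obtain f :: "'v \<Rightarrow> nat" where f: "inj_on f V"
    using finite_imp_inj_to_nat_seg[OF V(1)] by auto
  have expand: "(\<Sum>\<phi>\<in>V \<rightarrow>\<^sub>E {..<s}. (\<Prod>v\<in>V. \<gamma> (\<phi> v)) * F (\<lambda>(u, v). C (\<phi> u) (\<phi> v))) =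
      (\<Sum>S\<in>Pow E. c S * hom_sum s \<gamma> C (f ` V) ((\<lambda>(u, v). {f u, f v}) ` S))"
    if "\<And>i j. i < s \<Longrightarrow> j < s \<Longrightarrow> C i j = C j i" for s \<gamma> C
  proof -
    have "(\<Sum>\<phi>\<in>V \<rightarrow>\<^sub>E {..<s}. (\<Prod>v\<in>V. \<gamma> (\<phi> v)) * F (\<lambda>(u, v). C (\<phi> u) (\<phi> v))) =
        (\<Sum>\<phi>\<in>V \<rightarrow>\<^sub>E {..<s}. \<Sum>S\<in>Pow E. c S * ((\<Prod>v\<in>V. \<gamma> (\<phi> v)) * (\<Prod>(u, v)\<in>S. C (\<phi> u) (\<phi> v))))"
      unfolding c by (simp add: sum_distrib_left mult_ac)
    also have "\<dots> = (\<Sum>S\<in>Pow E. c S * (\<Sum>\<phi>\<in>V \<rightarrow>\<^sub>E {..<s}. (\<Prod>v\<in>V. \<gamma> (\<phi> v)) * (\<Prod>(u, v)\<in>S. C (\<phi> u) (\<phi> v))))"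
      by (subst sum.swap) (simp add: sum_distrib_left)
    also have "\<dots> = (\<Sum>S\<in>Pow E. c S * hom_sum s \<gamma> C (f ` V) ((\<lambda>(u, v). {f u, f v}) ` S))"
    proof (intro sum.cong refl)
      fix S assume S: "S \<in> Pow E"
      have "S \<subseteq> V \<times> V" using S E by auto
      moreover have "\<And>u v. (u, v) \<in> S \<Longrightarrow> (v, u) \<notin> S" using S asym by auto
      ultimately show "c S * (\<Sum>\<phi>\<in>V \<rightarrow>\<^sub>E {..<s}. (\<Prod>v\<in>V. \<gamma> (\<phi> v)) * (\<Prod>(u, v)\<in>S. C (\<phi> u) (\<phi> v))) =
          c S * hom_sum s \<gamma> C (f ` V) ((\<lambda>(u, v). {f u, f v}) ` S)"
        using hom_sum_relabel[OF f V(1), where E=S and r=s and B=C and \<beta>=\<gamma>] that by simp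
    qed
    finally show ?thesis .
  qed
  have "hom_sum q \<alpha> A (f ` V) ((\<lambda>(u, v). {f u, f v}) ` S) = hom_sum r \<beta> B (f ` V) ((\<lambda>(u, v). {f u, f v}) ` S)"
    if "S \<in> Pow E" for S
  proof (rule eq)
    have "card {f u, f v} = 2" if "(u, v) \<in> S" for u v
    proof -
      have "(u, v) \<in> E" using that \<open>S \<in> Pow E\<close> by auto
      then have "u \<in> V" "v \<in> V" "u \<noteq> v" using E asym[of u v] by auto
      then show ?thesis using f by (auto simp: inj_on_eq_iff)
    qed
    then show "simple_graph (f ` V) ((\<lambda>(u, v). {f u, f v}) ` S)"
      unfolding simple_graph_def using V(1) that E by auto
    show "card (f ` V) \<le> n" using V(2) f by (simp add: card_image)
  qed
  then show ?thesis using expand[of q A \<alpha>] expand[of r B \<beta>] symA symB by simp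
qed

section \<open>The test polynomial\<close>

text \<open>
  The intended map sends \<open>Core i s\<close> and \<open>Extra i s\<close> to part \<open>i\<close>, and \<open>Helper i j\<close> and \<open>Anchor i j\<close> to a part
  \<open>sep i j\<close> that distinguishes \<open>i\<close> from \<open>j\<close>. Every edge occurs in a single factor of the polynomial:
  \<open>F1\<close> makes the layer \<open>Core _ 0\<close> injective; \<open>F2\<close> lets each layer \<open>Core _ (s + 1)\<close> follow the layer
  \<open>Core _ s\<close>; \<open>F3\<close> has enough edges between any two blocks to exclude all values of the two matrices
  but the right one. Once the matrix is known, the constants in \<open>F4\<close> and \<open>F5\<close> fix the images of \<open>Anchor\<close>
  and \<open>Helper\<close>, so that no cancellation can occur. Finally, \<open>F6\<close> ties \<open>Extra i s\<close> to block \<open>i\<close> up to the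
  constant term \<open>\<kappa> i * v i s\<close>, and summing over its image gives \<open>\<kappa> i\<close> times the weight of the block
  minus \<open>v i s\<close>.
\<close>

datatype vertex = Core nat nat | Helper nat nat | Anchor nat nat | Extra nat nat

text \<open>The constants \<open>c\<close> avoid the correct entry, so that \<open>F3\<close> does
  not vanish at the intended map. Which wrong values they hit is stated in
  \<open>gadget_model\<close>, because the same \<open>c\<close> must serve two models.\<close>

locale gadget =
  fixes q :: nat and A :: "nat \<Rightarrow> nat \<Rightarrow> real"
    and sep :: "nat \<Rightarrow> nat \<Rightarrow> nat" and c :: "nat \<Rightarrow> nat \<Rightarrow> nat \<Rightarrow> nat \<Rightarrow> real"
  assumes A_sym: "\<And>i j. i < q \<Longrightarrow> j < q \<Longrightarrow> A i j = A j i"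
    and sep_less: "\<And>i j. i < q \<Longrightarrow> j < q \<Longrightarrow> i \<noteq> j \<Longrightarrow> sep i j < q"
    and sep: "\<And>i j. i < q \<Longrightarrow> j < q \<Longrightarrow> i \<noteq> j \<Longrightarrow> A i (sep i j) \<noteq> A j (sep i j)"
    and c: "\<And>i s j s'. i < q \<Longrightarrow> j < q \<Longrightarrow> c i s j s' \<noteq> A i j"
begin

definition P where "P = {(i, j). i < q \<and> j < q \<and> i \<noteq> j}"
definition Mv where "Mv = (\<lambda>(i, s). Core i s) ` ({..<q} \<times> {..q})"
definition Hv where "Hv = (\<lambda>(i, j). Helper i j) ` P"
definition Av where "Av = (\<lambda>(i, j). Anchor i j) ` P"
definition Xv where "Xv = (\<lambda>(i, s). Extra i s) ` ({..<q} \<times> {..<q - 1})"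
definition V0 where "V0 = Mv \<union> Hv \<union> Av"

fun block where
  "block (Core i s) = i" | "block (Helper i j) = sep i j" | "block (Anchor i j) = sep i j" | "block (Extra i s) = i"

definition E1 where "E1 = (\<lambda>i. Core i 0) ` {..<q} \<times> Av"
definition E2 where "E2 = Mv \<times> Hv"
definition E3 where "E3 = (\<lambda>((i, s), (j, s')). (Core i s, Core j s')) `
   {((i, s), (j, s')). i < q \<and> j < q \<and> s \<le> q \<and> s' \<le> q \<and> (i < j \<or> i = j \<and> s < s')}"
text \<open>Only layers of positive index, because the edges between anchors and layer 0 belong to
  \<open>F1\<close>.\<close>

definition E4 where "E4 = Av \<times> (\<lambda>(i, s). Core i (Suc s)) ` ({..<q} \<times> {..<q})"
definition E5 where "E5 = Hv \<times> Av"
definition E6 where "E6 = Xv \<times> Av"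
definition E0 where "E0 = E1 \<union> E2 \<union> E3 \<union> E4 \<union> E5"

definition I1 where "I1 = {(i, j). i < j \<and> j < q}"
definition I2 where "I2 = {(i, j, s). i < q \<and> j < q \<and> i \<noteq> j \<and> s < q}"
definition I3 where "I3 = {((i, s), (j, s')). i < q \<and> j < q \<and> s \<le> q \<and> s' \<le> q \<and> (i < j \<or> i = j \<and> s < s')}"
definition I4 where "I4 = {(i, j, l). i < q \<and> j < q \<and> i \<noteq> j \<and> l < q \<and> l \<noteq> sep i j}"

definition F1 where "F1 t = (\<Prod>(i, j)\<in>I1. t (Core i 0, Anchor i j) - t (Core j 0, Anchor i j))"
  for t :: "vertex \<times> vertex \<Rightarrow> real"
definition F2 where "F2 t = (\<Prod>(i, j, s)\<in>I2. t (Core i (Suc s), Helper i j) - t (Core j s, Helper i j))"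
  for t :: "vertex \<times> vertex \<Rightarrow> real"
definition F3 where "F3 t = (\<Prod>((i, s), (j, s'))\<in>I3. t (Core i s, Core j s') - c i s j s')"
text \<open>For \<open>l \<noteq> sep i j\<close> the column \<open>sep (sep i j) l\<close> tells
  block \<open>sep i j\<close> from block \<open>l\<close>, so the factor is 0 if the anchor goes to
  block \<open>l\<close> but not if it goes to block \<open>sep i j\<close>. The layer
  \<open>Suc l\<close> keeps the edges distinct even if several \<open>l\<close> share a
  column.\<close>

definition F4 where "F4 t = (\<Prod>(i, j, l)\<in>I4.
   t (Anchor i j, Core (sep (sep i j) l) (Suc l)) - A l (sep (sep i j) l))"
text \<open>Helpers cannot be pinned by cores, since \<open>F2\<close> may already use those edges;
  the anchors pinned by \<open>F4\<close> take over that role.\<close>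

definition F5 where "F5 t = (\<Prod>(i, j, l)\<in>I4. t (Helper i j, Anchor (sep i j) l) - A l (sep (sep i j) l))"
definition F0 where "F0 t = F1 t * F2 t * F3 t * F4 t * F5 t"

text \<open>The product in \<open>F6\<close> works like the numerator of a Lagrange polynomial: it
  is 0 if \<open>Extra i s\<close> goes to a block \<open>j \<noteq> i\<close>, and
  \<open>\<kappa> i\<close>, nonzero by the choice of \<open>sep\<close>, if it goes to block
  \<open>i\<close>.\<close>

definition \<kappa> where "\<kappa> i = (\<Prod>j\<in>{..<q} - {i}. A i (sep i j) - A j (sep i j))"

definition F6 where "F6 v t = (\<Prod>(i, s)\<in>{..<q} \<times> {..<q - 1}.
   (\<Prod>j\<in>{..<q} - {i}. t (Extra i s, Anchor i j) - A j (sep i j)) - \<kappa> i * v i s)"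

lemma finite_I: "finite I1" "finite I2" "finite I3" "finite I4" "finite P"
proof -
  show "finite I1" by (rule finite_subset[of _ "{..<q} \<times> {..<q}"]) (auto simp: I1_def)
  show "finite I2" by (rule finite_subset[of _ "{..<q} \<times> {..<q} \<times> {..<q}"]) (auto simp: I2_def)
  show "finite I3" by (rule finite_subset[of _ "({..<q} \<times> {..q}) \<times> ({..<q} \<times> {..q})"]) (auto simp: I3_def)
  show "finite I4" by (rule finite_subset[of _ "{..<q} \<times> {..<q} \<times> {..<q}"]) (auto simp: I4_def)
  show "finite P" by (rule finite_subset[of _ "{..<q} \<times> {..<q}"]) (auto simp: P_def)
qed

lemma finite_V: "finite Mv" "finite Hv" "finite Av" "finite Xv" "finite V0"
  using finite_I by (auto simp: Mv_def Hv_def Av_def Xv_def V0_def)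

lemma finite_E: "finite E1" "finite E2" "finite E3" "finite E4" "finite E5" "finite E6" "finite E0"
  using finite_V finite_I(3)
  by (auto simp: E1_def E2_def E3_def E4_def E5_def E6_def E0_def I3_def simp del: finite_insert)

lemma E0_subset: "E0 \<subseteq> V0 \<times> V0"
  by (auto simp: E0_def E1_def E2_def E3_def E4_def E5_def V0_def Mv_def)

lemma E6_subset: "E6 \<subseteq> Xv \<times> V0"
  by (auto simp: E6_def V0_def)

lemma E_asym: "(u, v) \<in> E0 \<union> E6 \<Longrightarrow> (v, u) \<notin> E0 \<union> E6"
  by (auto simp: E0_def E1_def E2_def E3_def E4_def E5_def E6_def V0_def Mv_def Hv_def Av_def Xv_def)

lemma V0_Xv_disjoint: "V0 \<inter> Xv = {}"
  by (auto simp: V0_def Mv_def Hv_def Av_def Xv_def)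

lemma card_P: "card P = q * q - q"
proof -
  have "P = {..<q} \<times> {..<q} - (\<lambda>i. (i, i)) ` {..<q}" by (auto simp: P_def)
  moreover have "card ({..<q} \<times> {..<q} - (\<lambda>i. (i, i)) ` {..<q}) = card ({..<q} \<times> {..<q}) - card ((\<lambda>i. (i, i)) ` {..<q})"
    by (rule card_Diff_subset) auto
  moreover have "card ((\<lambda>i. (i, i)) ` {..<q}) = q" by (simp add: card_image inj_on_def)
  ultimately show ?thesis by simp
qed

text \<open>There are \<open>q * (q + 1)\<close> cores and \<open>q * (q - 1)\<close> each of
  helpers, anchors and extras, in total \<open>4 * q\<^sup>2 - 2 * q\<close>.\<close>

lemma card_V: "card (V0 \<union> Xv) \<le> 4 * q\<^sup>2 - q"
proof -
  have "card Mv \<le> q * (q + 1)"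
    unfolding Mv_def using card_image_le[of "{..<q} \<times> {..q}" "\<lambda>(i, s). Core i s"] by simp
  moreover have "card Hv \<le> q * q - q" "card Av \<le> q * q - q"
    unfolding Hv_def Av_def using card_image_le[OF finite_I(5)] card_P by metis+
  moreover have "card Xv \<le> q * (q - 1)"
    unfolding Xv_def using card_image_le[of "{..<q} \<times> {..<q - 1}" "\<lambda>(i, s). Extra i s"] by simp
  moreover have "card (V0 \<union> Xv) \<le> card Mv + card Hv + card Av + card Xv"
    unfolding V0_def
    using card_Un_le[of Mv Hv] card_Un_le[of "Mv \<union> Hv" Av] card_Un_le[of "Mv \<union> Hv \<union> Av" Xv] by linarith
  moreover have "q * q \<ge> q" by simp
  moreover have "q * (q + 1) = q * q + q" "q * (q - 1) = q * q - q" "q\<^sup>2 = q * q"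
    by (simp_all add: power2_eq_square diff_mult_distrib2)
  ultimately show ?thesis
    by linarith
qed

text \<open>Each factor is first placed on the edges it really uses, where different indices use
  different edges. The enlarged sets \<open>E1\<close> to \<open>E5\<close> are then pairwise
  disjoint by the kinds and the order of the endpoints.\<close>

lemma multi_affine_F0: "multi_affine E0 F0"
proof -
  have "multi_affine (\<Union>(i, j)\<in>I1. {(Core i 0, Anchor i j), (Core j 0, Anchor i j)}) F1"
    unfolding F1_def[abs_def] case_prod_beta
    by (rule multi_affine_prod[OF finite_I(1) multi_affine_var_minus_var])
      (auto simp: disjoint_family_on_def I1_def)
  then have 1: "multi_affine E1 F1"
    by (rule multi_affine_mono[OF _ _ finite_E(1)]) (auto simp: E1_def I1_def Av_def P_def)
  have "multi_affine (\<Union>(i, j, s)\<in>I2. {(Core i (Suc s), Helper i j), (Core j s, Helper i j)}) F2"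
    unfolding F2_def[abs_def] case_prod_beta
    by (rule multi_affine_prod[OF finite_I(2) multi_affine_var_minus_var])
      (auto simp: disjoint_family_on_def I2_def)
  then have 2: "multi_affine E2 F2"
    by (rule multi_affine_mono[OF _ _ finite_E(2)]) (auto simp: E2_def I2_def Mv_def Hv_def P_def)
  have "multi_affine (\<Union>((i, s), (j, s'))\<in>I3. {(Core i s, Core j s')}) F3"
    unfolding F3_def[abs_def] case_prod_beta
    by (rule multi_affine_prod[OF finite_I(3) multi_affine_var_minus_const])
      (auto simp: disjoint_family_on_def I3_def)
  then have 3: "multi_affine E3 F3"
    by (rule multi_affine_mono[OF _ _ finite_E(3)]) (auto simp: E3_def I3_def image_iff)
  have "multi_affine (\<Union>(i, j, l)\<in>I4. {(Anchor i j, Core (sep (sep i j) l) (Suc l))}) F4"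
    unfolding F4_def[abs_def] case_prod_beta
    by (rule multi_affine_prod[OF finite_I(4) multi_affine_var_minus_const])
      (auto simp: disjoint_family_on_def I4_def)
  then have 4: "multi_affine E4 F4"
    by (rule multi_affine_mono[OF _ _ finite_E(4)]) (auto simp: E4_def I4_def Av_def P_def sep_less)
  have "multi_affine (\<Union>(i, j, l)\<in>I4. {(Helper i j, Anchor (sep i j) l)}) F5"
    unfolding F5_def[abs_def] case_prod_beta
    by (rule multi_affine_prod[OF finite_I(4) multi_affine_var_minus_const])
      (auto simp: disjoint_family_on_def I4_def)
  then have 5: "multi_affine E5 F5"
    by (rule multi_affine_mono[OF _ _ finite_E(5)]) (auto simp: E5_def I4_def Av_def Hv_def P_def sep_less)
  note defs = E1_def E2_def E3_def E4_def E5_def V0_def Mv_def Hv_def Av_def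
  show ?thesis
    unfolding F0_def[abs_def] E0_def
    by (intro multi_affine_mult 1 2 3 4 5) (auto simp: defs)
qed

lemma multi_affine_F6: "multi_affine E6 (F6 v)"
proof -
  have inner: "multi_affine (\<Union>j\<in>{..<q} - {i}. {(Extra i s, Anchor i j)})
      (\<lambda>t. (\<Prod>j\<in>{..<q} - {i}. t (Extra i s, Anchor i j) - A j (sep i j)) - \<kappa> i * v i s)" for i s
  proof (rule multi_affine_diff)
    show "multi_affine (\<Union>j\<in>{..<q} - {i}. {(Extra i s, Anchor i j)})
      (\<lambda>t. (\<Prod>j\<in>{..<q} - {i}. t (Extra i s, Anchor i j) - A j (sep i j)))"
      by (rule multi_affine_prod[OF _ multi_affine_var_minus_const]) (auto simp: disjoint_family_on_def)
    show "multi_affine (\<Union>j\<in>{..<q} - {i}. {(Extra i s, Anchor i j)}) (\<lambda>t. \<kappa> i * v i s)"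
      by (rule multi_affine_mono[OF multi_affine_const]) auto
  qed
  have "multi_affine (\<Union>(i, s)\<in>{..<q} \<times> {..<q - 1}. \<Union>j\<in>{..<q} - {i}. {(Extra i s, Anchor i j)}) (F6 v)"
    unfolding F6_def[abs_def] case_prod_beta
    by (rule multi_affine_prod[OF _ inner]) (auto simp: disjoint_family_on_def)
  then show ?thesis
    by (rule multi_affine_mono[OF _ _ finite_E(6)]) (auto simp: E6_def Xv_def Av_def P_def)
qed

lemma multi_affine_F: "multi_affine (E0 \<union> E6) (\<lambda>t. F0 t * F6 v t)"
proof (rule multi_affine_mult[OF multi_affine_F0 multi_affine_F6])
  show "E0 \<inter> E6 = {}"
    using E0_subset E6_subset V0_Xv_disjoint by blast
qed

text \<open>The values at the intended map. They refer to no model, so \<open>F0 t0\<close> can be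
  factored out of the sums of both models.\<close>

abbreviation \<open>t0 \<equiv> (\<lambda>(u, v). A (block u) (block v))\<close>

lemma F0_block: "F0 t0 \<noteq> 0"
  unfolding F0_def F1_def F2_def F3_def F4_def F5_def
  using c c[symmetric] sep finite_I sep_less
  by (auto simp: I1_def I2_def I3_def I4_def)

end

section \<open>Evaluation of the test polynomial in a weighted model\<close>

lemma sum_PiE_Un:
  assumes "V \<inter> X = {}"
  shows "(\<Sum>\<phi>\<in>V \<union> X \<rightarrow>\<^sub>E J. f \<phi>) = (\<Sum>\<phi>\<in>V \<rightarrow>\<^sub>E J. \<Sum>\<psi>\<in>X \<rightarrow>\<^sub>E J. f (merge V X (\<phi>, \<psi>)))"
  unfolding sum.cartesian_product
proof (rule sum.reindex_bij_witness[where
      i = "merge V X" and j = "\<lambda>\<phi>. (restrict \<phi> V, restrict \<phi> X)"])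
  fix \<phi> assume \<phi>: "\<phi> \<in> V \<union> X \<rightarrow>\<^sub>E J"
  show "merge V X (restrict \<phi> V, restrict \<phi> X) = \<phi>"
    using \<phi> by (auto simp: merge_def fun_eq_iff PiE_def extensional_def)
  then show "(case (restrict \<phi> V, restrict \<phi> X) of (\<phi>, \<psi>) \<Rightarrow> f (merge V X (\<phi>, \<psi>))) = f \<phi>" by simp
  show "(restrict \<phi> V, restrict \<phi> X) \<in> (V \<rightarrow>\<^sub>E J) \<times> (X \<rightarrow>\<^sub>E J)" using \<phi> by auto
next
  fix a assume a: "a \<in> (V \<rightarrow>\<^sub>E J) \<times> (X \<rightarrow>\<^sub>E J)"
  then show "(restrict (merge V X a) V, restrict (merge V X a) X) = a"
    using assms by (auto simp: merge_def fun_eq_iff PiE_def extensional_def)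
  show "merge V X a \<in> V \<union> X \<rightarrow>\<^sub>E J" using a by (auto simp: merge_def PiE_def extensional_def)
qed

text \<open>Instantiated with \<open>A\<close> itself and with the unknown model. A wrong value
  between two blocks may be excluded by any of the \<open>(q + 1)\<^sup>2\<close> edges joining
  them, a wrong diagonal value only by an edge between two layers of one block.\<close>

locale gadget_model = gadget +
  fixes r :: nat and \<beta> :: "nat \<Rightarrow> real" and B :: "nat \<Rightarrow> nat \<Rightarrow> real"
  assumes r: "r \<le> q"
    and B_sym: "\<And>i j. i < r \<Longrightarrow> j < r \<Longrightarrow> B i j = B j i"
    and \<beta>_nonneg: "\<And>i. i < r \<Longrightarrow> \<beta> i \<ge> 0"
    and \<beta>_sum: "(\<Sum>i<r. \<beta> i) = 1"
    and kill_off: "\<And>i j a b. i < j \<Longrightarrow> j < q \<Longrightarrow> a < r \<Longrightarrow> b < r \<Longrightarrow> a \<noteq> b \<Longrightarrow> B a b \<noteq> A i j \<Longrightarrow>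
        \<exists>s\<le>q. \<exists>s'\<le>q. c i s j s' = B a b"
    and kill_diag: "\<And>i a. i < q \<Longrightarrow> a < r \<Longrightarrow> B a a \<noteq> A i i \<Longrightarrow>
        \<exists>s s'. s < s' \<and> s' \<le> q \<and> c i s i s' = B a a"
begin

definition ev where "ev \<phi> = (\<lambda>(u, v). B (\<phi> u) (\<phi> v))" for \<phi> :: "vertex \<Rightarrow> nat"

lemma V0_I:
  "i < q \<Longrightarrow> s \<le> q \<Longrightarrow> Core i s \<in> V0"
  "i < q \<Longrightarrow> j < q \<Longrightarrow> i \<noteq> j \<Longrightarrow> Helper i j \<in> V0"
  "i < q \<Longrightarrow> j < q \<Longrightarrow> i \<noteq> j \<Longrightarrow> Anchor i j \<in> V0"
  by (auto simp: V0_def Mv_def Hv_def Av_def P_def)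

text \<open>Every single factor of \<open>F0\<close> is nonzero, and the factors are exploited from
  \<open>F1\<close> to \<open>F5\<close>, each with the help of the earlier conclusions. The last
  claim is what rules out cancellation later.\<close>

lemma aligned:
  assumes \<phi>: "\<phi> \<in> V0 \<rightarrow> {..<r}" and nz: "F0 (ev \<phi>) \<noteq> 0"
  shows "bij_betw (\<lambda>i. \<phi> (Core i 0)) {..<q} {..<r}" (is ?bij)
    and "\<And>v. v \<in> V0 \<Longrightarrow> \<phi> v = \<phi> (Core (block v) 0)"
    and "\<And>i j. i < q \<Longrightarrow> j < q \<Longrightarrow> B (\<phi> (Core i 0)) (\<phi> (Core j 0)) = A i j"
    and "F0 (ev \<phi>) = F0 t0"
proof -
  define \<tau> where "\<tau> i = \<phi> (Core i 0)" for i
  have nz1: "ev \<phi> (Core i 0, Anchor i j) \<noteq> ev \<phi> (Core j 0, Anchor i j)" if "(i, j) \<in> I1" for i j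
    using nz that finite_I(1) unfolding F0_def F1_def by auto
  have nz2: "ev \<phi> (Core i (Suc s), Helper i j) \<noteq> ev \<phi> (Core j s, Helper i j)" if "(i, j, s) \<in> I2" for i j s
    using nz that finite_I(2) unfolding F0_def F2_def by auto
  have nz3: "ev \<phi> (Core i s, Core j s') \<noteq> c i s j s'" if "((i, s), (j, s')) \<in> I3" for i j s s'
    using nz that finite_I(3) unfolding F0_def F3_def by auto
  have nz4: "ev \<phi> (Anchor i j, Core (sep (sep i j) l) (Suc l)) \<noteq> A l (sep (sep i j) l)" if "(i, j, l) \<in> I4" for i j l
    using nz that finite_I(4) unfolding F0_def F4_def by auto
  have nz5: "ev \<phi> (Helper i j, Anchor (sep i j) l) \<noteq> A l (sep (sep i j) l)" if "(i, j, l) \<in> I4" for i j l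
    using nz that finite_I(4) unfolding F0_def F5_def by auto
  have inV: "\<phi> v < r" if "v \<in> V0" for v using \<phi> that by auto
  have neq: "\<tau> i \<noteq> \<tau> j" if "i < j" "j < q" for i j
    using nz1[of i j] that by (auto simp: I1_def ev_def \<tau>_def)
  have inj: "inj_on \<tau> {..<q}"
    by (rule linorder_inj_onI) (use neq in auto)
  moreover have sub: "\<tau> ` {..<q} \<subseteq> {..<r}" using inV V0_I(1) by (auto simp: \<tau>_def)
  \<comment> \<open>An injection of \<open>q\<close> blocks into \<open>r \<le> q\<close> indices is
    onto; in particular \<open>r = q\<close>.\<close>
  ultimately have "\<tau> ` {..<q} = {..<r}"
    using r by (intro card_seteq) (auto simp: card_image)
  then have bij: "bij_betw \<tau> {..<q} {..<r}" using inj by (simp add: bij_betw_def)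
  then show ?bij by (simp add: \<tau>_def[abs_def])
  have ex: "\<exists>l<q. x = \<tau> l" if "x < r" for x
    using bij that by (auto simp: bij_betw_def image_iff set_eq_iff)
  have Core: "\<phi> (Core i s) = \<tau> i" if "i < q" "s \<le> q" for i s
    using that
  proof (induction s arbitrary: i)
    case (Suc s)
    obtain l where l: "l < q" "\<phi> (Core i (Suc s)) = \<tau> l"
      using ex inV V0_I(1) Suc.prems by meson
    \<comment> \<open>Otherwise \<open>Core l s\<close> also goes to \<open>\<tau> l\<close> by
      induction, and the factor of \<open>F2\<close> at \<open>Helper i l\<close> is a difference of
      equal values.\<close>
    have "l = i"
    proof (rule ccontr)
      assume "l \<noteq> i"
      then have "(i, l, s) \<in> I2" using Suc.prems l by (auto simp: I2_def)
      from nz2[OF this] show False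
        using l Suc by (simp add: ev_def)
    qed
    then show ?case using l by simp
  qed (simp add: \<tau>_def)
  have BA: "B (\<tau> i) (\<tau> j) = A i j" if ij: "i < q" "j < q" for i j
  proof -
    have \<tau>: "\<tau> i < r" "\<tau> j < r" using ij inV V0_I(1) by (auto simp: \<tau>_def)
    have off: "B (\<tau> i) (\<tau> j) = A i j" if ord: "i < j" "j < q" "\<tau> i < r" "\<tau> j < r" for i j
    proof (rule ccontr)
      assume "B (\<tau> i) (\<tau> j) \<noteq> A i j"
      from kill_off[OF ord neq[OF ord(1,2)] this]
      obtain s s' where s: "s \<le> q" "s' \<le> q" "c i s j s' = B (\<tau> i) (\<tau> j)"
        by auto
      have "((i, s), (j, s')) \<in> I3" using s ord by (auto simp: I3_def)
      from nz3[OF this] show False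
        using s ord Core by (simp add: ev_def)
    qed
    show ?thesis
    proof (cases i j rule: linorder_cases)
      case less then show ?thesis using off \<tau> ij by simp
    next
      case greater then show ?thesis using off[of j i] \<tau> ij A_sym[OF ij] B_sym[OF \<tau>] by simp
    next
      case equal
      show ?thesis
      proof (rule ccontr)
        assume "B (\<tau> i) (\<tau> j) \<noteq> A i j"
        then have "B (\<tau> i) (\<tau> i) \<noteq> A i i" using equal by simp
        from kill_diag[OF ij(1) \<tau>(1) this]
        obtain s s' where s: "s < s'" "s' \<le> q" "c i s i s' = B (\<tau> i) (\<tau> i)"
          by auto
        have "((i, s), (i, s')) \<in> I3" using s ij by (auto simp: I3_def)
        from nz3[OF this] show False
          using s ij Core by (simp add: ev_def)
      qed
    qed
  qed
  have Anchor: "\<phi> (Anchor i j) = \<tau> (sep i j)" if ij: "i < q" "j < q" "i \<noteq> j" for i j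
  proof -
    obtain l where l: "l < q" "\<phi> (Anchor i j) = \<tau> l"
      using ex inV V0_I(3) ij by meson
    \<comment> \<open>At \<open>\<tau> l\<close> the edge would have the value
      \<open>A l (sep (sep i j) l)\<close>, the very constant that \<open>F4\<close>
      subtracts.\<close>
    have "l = sep i j"
    proof (rule ccontr)
      assume "l \<noteq> sep i j"
      then have I4: "(i, j, l) \<in> I4" using l ij by (auto simp: I4_def)
      have "sep (sep i j) l < q" using sep_less ij l \<open>l \<noteq> sep i j\<close> by metis
      with nz4[OF I4] show False
        using l Core[of "sep (sep i j) l" "Suc l"] BA by (simp add: ev_def)
    qed
    then show ?thesis using l by simp
  qed
  have Helper: "\<phi> (Helper i j) = \<tau> (sep i j)" if ij: "i < q" "j < q" "i \<noteq> j" for i j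
  proof -
    obtain l where l: "l < q" "\<phi> (Helper i j) = \<tau> l"
      using ex inV V0_I(2) ij by meson
    have "l = sep i j"
    proof (rule ccontr)
      assume ne: "l \<noteq> sep i j"
      then have I4: "(i, j, l) \<in> I4" using l ij by (auto simp: I4_def)
      have "sep (sep i j) l < q" using sep_less ij l ne by metis
      with nz5[OF I4] show False
        using l Anchor[of "sep i j" l] BA sep_less ij ne by (simp add: ev_def)
    qed
    then show ?thesis using l by simp
  qed
  from BA show "\<And>i j. i < q \<Longrightarrow> j < q \<Longrightarrow> B (\<phi> (Core i 0)) (\<phi> (Core j 0)) = A i j"
    by (simp add: \<tau>_def)
  have block: "\<phi> v = \<tau> (block v)" if "v \<in> V0" for v
    using that Core Anchor Helper by (auto simp: V0_def Mv_def Hv_def Av_def P_def)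
  from block show "\<And>v. v \<in> V0 \<Longrightarrow> \<phi> v = \<phi> (Core (block v) 0)" by (simp add: \<tau>_def)
  have "block v < q" if "v \<in> V0" for v
    using that sep_less by (auto simp: V0_def Mv_def Hv_def Av_def P_def)
  then have "B (\<phi> u) (\<phi> v) = A (block u) (block v)" if "u \<in> V0" "v \<in> V0" for u v
    using block[OF that(1)] block[OF that(2)] BA that by simp
  then have "ev \<phi> e = t0 e" if "e \<in> E0" for e
    using that E0_subset by (cases e) (auto simp: ev_def)
  then show "F0 (ev \<phi>) = F0 t0" by (rule multi_affine_cong[OF multi_affine_F0])
qed

text \<open>Extras have neighbours only in \<open>V0\<close>, so for fixed \<open>\<phi>\<close> the
  sum over their images is a product of one-vertex sums. In each of these only block
  \<open>i\<close> survives, and the constant term is multiplied by the total weight 1.\<close>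

lemma gadget_sum:
  "(\<Sum>\<phi>\<in>V0 \<union> Xv \<rightarrow>\<^sub>E {..<r}. (\<Prod>v\<in>V0 \<union> Xv. \<beta> (\<phi> v)) * (F0 (ev \<phi>) * F6 w (ev \<phi>))) =
   F0 t0 * (\<Prod>(i, s)\<in>{..<q} \<times> {..<q - 1}. \<kappa> i) * (\<Sum>\<phi>\<in>{\<phi> \<in> V0 \<rightarrow>\<^sub>E {..<r}. F0 (ev \<phi>) \<noteq> 0}. (\<Prod>v\<in>V0. \<beta> (\<phi> v)) *
      (\<Prod>(i, s)\<in>{..<q} \<times> {..<q - 1}. \<beta> (\<phi> (Core i 0)) - w i s))"
proof -
  let ?Q = "{..<q} \<times> {..<q - 1}"
  define h where "h \<phi> i s y = (\<Prod>j\<in>{..<q} - {i}. B y (\<phi> (Anchor i j)) - A j (sep i j)) - \<kappa> i * w i s"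
    for \<phi> i s y
  \<comment> \<open>Collects what depends on the image of one extra; the default 1 is never met on
    \<open>Xv\<close>.\<close>
  define g where "g \<phi> x y = \<beta> y * (case x of Extra i s \<Rightarrow> h \<phi> i s y | _ \<Rightarrow> 1)" for \<phi> x y
  have inj: "inj_on (\<lambda>(i, s). Extra i s) ?Q" by (auto simp: inj_on_def)
  have split: "(\<Prod>v\<in>V0 \<union> Xv. \<beta> (merge V0 Xv (\<phi>, \<psi>) v)) *
      (F0 (ev (merge V0 Xv (\<phi>, \<psi>))) * F6 w (ev (merge V0 Xv (\<phi>, \<psi>)))) =
      (\<Prod>v\<in>V0. \<beta> (\<phi> v)) * F0 (ev \<phi>) * (\<Prod>x\<in>Xv. g \<phi> x (\<psi> x))" for \<phi> \<psi>
  proof -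
    let ?m = "merge V0 Xv (\<phi>, \<psi>)"
    have "(\<Prod>v\<in>V0 \<union> Xv. \<beta> (?m v)) = (\<Prod>v\<in>V0. \<beta> (?m v)) * (\<Prod>v\<in>Xv. \<beta> (?m v))"
      using finite_V V0_Xv_disjoint by (intro prod.union_disjoint) auto
    also have "\<dots> = (\<Prod>v\<in>V0. \<beta> (\<phi> v)) * (\<Prod>v\<in>Xv. \<beta> (\<psi> v))"
      using V0_Xv_disjoint by (intro arg_cong2[of _ _ _ _ "(*)"] prod.cong) (auto simp: merge_def)
    finally have 1: "(\<Prod>v\<in>V0 \<union> Xv. \<beta> (?m v)) = (\<Prod>v\<in>V0. \<beta> (\<phi> v)) * (\<Prod>v\<in>Xv. \<beta> (\<psi> v))" .
    have 2: "F0 (ev ?m) = F0 (ev \<phi>)"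
      using E0_subset by (intro multi_affine_cong[OF multi_affine_F0]) (auto simp: ev_def merge_def)
    have "F6 w (ev ?m) = (\<Prod>(i, s)\<in>?Q. h \<phi> i s (\<psi> (Extra i s)))"
      unfolding F6_def h_def
    proof (intro prod.cong refl, clarsimp)
      fix i s assume ii: "i < q" "s < q - Suc 0"
      have "Extra i s \<notin> V0" "Extra i s \<in> Xv" using ii by (auto simp: V0_def Mv_def Hv_def Av_def Xv_def)
      then show "(\<Prod>j\<in>{..<q} - {i}. ev ?m (Extra i s, Anchor i j) - A j (sep i j)) =
          (\<Prod>j\<in>{..<q} - {i}. B (\<psi> (Extra i s)) (\<phi> (Anchor i j)) - A j (sep i j))"
        using ii V0_I(3) by (intro prod.cong refl) (simp add: ev_def merge_def)
    qed
    also have "\<dots> = (\<Prod>x\<in>Xv. case x of Extra i s \<Rightarrow> h \<phi> i s (\<psi> x) | _ \<Rightarrow> 1)"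
      unfolding Xv_def prod.reindex[OF inj] by (intro prod.cong) auto
    finally show ?thesis
      unfolding 1 2 g_def prod.distrib by simp
  qed
  have inner: "(\<Sum>\<psi>\<in>Xv \<rightarrow>\<^sub>E {..<r}. \<Prod>x\<in>Xv. g \<phi> x (\<psi> x)) =
      (\<Prod>(i, s)\<in>?Q. \<kappa> i) * (\<Prod>(i, s)\<in>?Q. \<beta> (\<phi> (Core i 0)) - w i s)"
    if \<phi>: "\<phi> \<in> V0 \<rightarrow>\<^sub>E {..<r}" and nz: "F0 (ev \<phi>) \<noteq> 0" for \<phi>
  proof -
    have \<phi>': "\<phi> \<in> V0 \<rightarrow> {..<r}" using \<phi> by auto
    note al = aligned[OF \<phi>' nz]
    have vertex_sum: "(\<Sum>y<r. \<beta> y * h \<phi> i s y) = \<kappa> i * (\<beta> (\<phi> (Core i 0)) - w i s)" if i: "i < q" for i s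
    proof -
      have "(\<Sum>y<r. \<beta> y * (\<Prod>j\<in>{..<q} - {i}. B y (\<phi> (Anchor i j)) - A j (sep i j))) =
        (\<Sum>k<q. \<beta> (\<phi> (Core k 0)) * (\<Prod>j\<in>{..<q} - {i}. B (\<phi> (Core k 0)) (\<phi> (Anchor i j)) - A j (sep i j)))"
        by (rule sum.reindex_bij_betw[OF al(1), symmetric])
      also have "\<dots> = (\<Sum>k<q. if k = i then \<beta> (\<phi> (Core i 0)) * \<kappa> i else 0)"
      proof (intro sum.cong refl)
        fix k assume k: "k \<in> {..<q}"
        have "(\<Prod>j\<in>{..<q} - {i}. B (\<phi> (Core k 0)) (\<phi> (Anchor i j)) - A j (sep i j)) =
            (\<Prod>j\<in>{..<q} - {i}. A k (sep i j) - A j (sep i j))"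
        proof (intro prod.cong refl)
          fix j assume j: "j \<in> {..<q} - {i}"
          have "\<phi> (Anchor i j) = \<phi> (Core (sep i j) 0)" using al(2)[OF V0_I(3)[of i j]] i j by simp
          then show "B (\<phi> (Core k 0)) (\<phi> (Anchor i j)) - A j (sep i j) = A k (sep i j) - A j (sep i j)"
            using al(3)[of k "sep i j"] sep_less[of i j] i j k by simp
        qed
        also have "\<dots> = (if k = i then \<kappa> i else 0)"
          using k by (auto simp: \<kappa>_def)
        finally show "\<beta> (\<phi> (Core k 0)) * (\<Prod>j\<in>{..<q} - {i}. B (\<phi> (Core k 0)) (\<phi> (Anchor i j)) - A j (sep i j)) =
            (if k = i then \<beta> (\<phi> (Core i 0)) * \<kappa> i else 0)" by simp
      qed
      also have "\<dots> = \<beta> (\<phi> (Core i 0)) * \<kappa> i" using i by simp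
      finally have 1: "(\<Sum>y<r. \<beta> y * (\<Prod>j\<in>{..<q} - {i}. B y (\<phi> (Anchor i j)) - A j (sep i j))) =
          \<beta> (\<phi> (Core i 0)) * \<kappa> i" .
      have "(\<Sum>y<r. \<beta> y * h \<phi> i s y) =
          (\<Sum>y<r. \<beta> y * (\<Prod>j\<in>{..<q} - {i}. B y (\<phi> (Anchor i j)) - A j (sep i j))) - (\<Sum>y<r. \<beta> y) * (\<kappa> i * w i s)"
        unfolding h_def right_diff_distrib sum_subtractf sum_distrib_right ..
      then show ?thesis
        unfolding 1 \<beta>_sum by (simp add: right_diff_distrib)
    qed
    have "(\<Sum>\<psi>\<in>Xv \<rightarrow>\<^sub>E {..<r}. \<Prod>x\<in>Xv. g \<phi> x (\<psi> x)) = (\<Prod>x\<in>Xv. \<Sum>y<r. g \<phi> x y)"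
      using finite_V by (intro prod_sum_PiE[symmetric]) auto
    also have "\<dots> = (\<Prod>(i, s)\<in>?Q. \<Sum>y<r. g \<phi> (Extra i s) y)"
      unfolding Xv_def prod.reindex[OF inj] by (intro prod.cong) auto
    also have "\<dots> = (\<Prod>(i, s)\<in>?Q. \<kappa> i * (\<beta> (\<phi> (Core i 0)) - w i s))"
      using vertex_sum by (intro prod.cong refl) (auto simp: g_def)
    finally show ?thesis by (simp add: case_prod_beta prod.distrib)
  qed
  have "(\<Sum>\<phi>\<in>V0 \<union> Xv \<rightarrow>\<^sub>E {..<r}. (\<Prod>v\<in>V0 \<union> Xv. \<beta> (\<phi> v)) * (F0 (ev \<phi>) * F6 w (ev \<phi>))) =
      (\<Sum>\<phi>\<in>V0 \<rightarrow>\<^sub>E {..<r}. (\<Prod>v\<in>V0. \<beta> (\<phi> v)) * F0 (ev \<phi>) * (\<Sum>\<psi>\<in>Xv \<rightarrow>\<^sub>E {..<r}. \<Prod>x\<in>Xv. g \<phi> x (\<psi> x)))"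
    unfolding sum_PiE_Un[OF V0_Xv_disjoint] split sum_distrib_left ..
  also have "\<dots> = (\<Sum>\<phi>\<in>{\<phi> \<in> V0 \<rightarrow>\<^sub>E {..<r}. F0 (ev \<phi>) \<noteq> 0}. (\<Prod>v\<in>V0. \<beta> (\<phi> v)) * F0 (ev \<phi>) * (\<Sum>\<psi>\<in>Xv \<rightarrow>\<^sub>E {..<r}. \<Prod>x\<in>Xv. g \<phi> x (\<psi> x)))"
    using finite_V by (intro sum.mono_neutral_right finite_PiE) auto
  also have "\<dots> = (\<Sum>\<phi>\<in>{\<phi> \<in> V0 \<rightarrow>\<^sub>E {..<r}. F0 (ev \<phi>) \<noteq> 0}. F0 t0 * (\<Prod>(i, s)\<in>?Q. \<kappa> i) * ((\<Prod>v\<in>V0. \<beta> (\<phi> v)) *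
      (\<Prod>(i, s)\<in>?Q. \<beta> (\<phi> (Core i 0)) - w i s)))"
  proof (intro sum.cong refl, clarify)
    fix \<phi> assume \<phi>: "\<phi> \<in> V0 \<rightarrow>\<^sub>E {..<r}" "F0 (ev \<phi>) \<noteq> 0"
    have "F0 (ev \<phi>) = F0 t0" using \<phi> by (intro aligned(4)) auto
    then show "(\<Prod>v\<in>V0. \<beta> (\<phi> v)) * F0 (ev \<phi>) * (\<Sum>\<psi>\<in>Xv \<rightarrow>\<^sub>E {..<r}. \<Prod>x\<in>Xv. g \<phi> x (\<psi> x)) =
        F0 t0 * (\<Prod>(i, s)\<in>?Q. \<kappa> i) * ((\<Prod>v\<in>V0. \<beta> (\<phi> v)) *
      (\<Prod>(i, s)\<in>?Q. \<beta> (\<phi> (Core i 0)) - w i s))"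
      unfolding inner[OF \<phi>] by simp
  qed
  finally show ?thesis by (simp add: sum_distrib_left)
qed

end

section \<open>Constants that exclude all wrong matrix entries\<close>

text \<open>Each element of \<open>K\<close> gets a point of \<open>X\<close> of its own, and all
  other points get the filler \<open>d\<close>. Applied to lists of values to be excluded, with a
  filler that does no harm.\<close>

lemma ex_function_covering:
  assumes "finite X" "finite K" "card K \<le> card X"
  shows "\<exists>f. K \<subseteq> f ` X \<and> (\<forall>x. f x \<in> insert d K)"
proof -
  obtain g where g: "g ` K \<subseteq> X" "inj_on g K"
    using card_le_inj[OF assms(2,1,3)] by auto
  let ?f = "\<lambda>x. if x \<in> g ` K then the_inv_into K g x else d"
  have "y \<in> ?f ` X" if "y \<in> K" for y
    using g that by (intro image_eqI[of _ _ "g y"]) (auto simp: the_inv_into_f_f)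
  moreover have "?f x \<in> insert d K" for x
    using g by (auto simp: the_inv_into_f_f)
  ultimately show ?thesis by (intro exI[of _ ?f]) auto
qed

text \<open>The strictly ordered pairs, their mirror images and the diagonal are disjoint subsets of
  the square.\<close>

lemma card_less_pairs: "2 * card {(a, b). a < b \<and> b < (n::nat)} + n \<le> n * n"
proof -
  let ?T = "{(a, b). a < b \<and> b < n}" and ?d = "(\<lambda>a. (a, a)) ` {..<n}"
  have fin: "finite ?T" by (rule finite_subset[of _ "{..<n} \<times> {..<n}"]) auto
  then have 1: "card ?T + card (prod.swap ` ?T) = card (?T \<union> prod.swap ` ?T)"
    by (intro card_Un_disjoint[symmetric]) auto
  have 2: "card (?T \<union> prod.swap ` ?T) + card ?d = card (?T \<union> prod.swap ` ?T \<union> ?d)"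
    using fin by (intro card_Un_disjoint[symmetric]) auto
  have 3: "card (?T \<union> prod.swap ` ?T \<union> ?d) \<le> card ({..<n} \<times> {..<n})" by (intro card_mono) auto
  have "card (prod.swap ` ?T) = card ?T" "card ?d = n" by (simp_all add: card_image inj_on_def)
  then show ?thesis using 1 2 3 by simp
qed

text \<open>There are \<open>q\<close> pairs at distance 1 and \<open>q - 1\<close> at distance 2.
  The bound is the largest possible number of diagonal values of two matrices after the correct one
  is removed.\<close>

lemma card_le_pairs: "2 * q - 1 \<le> card {(s, s'). s < s' \<and> s' \<le> (q::nat)}" if "q \<ge> 1"
proof -
  let ?X = "{(s, s'). s < s' \<and> s' \<le> q}"
  let ?Y = "(\<lambda>s. (s, s + 1)) ` {..<q}" and ?Z = "(\<lambda>s. (s, s + 2)) ` {..<q - 1}"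
  have "finite ?X" by (rule finite_subset[of _ "{..q} \<times> {..q}"]) auto
  then have "card (?Y \<union> ?Z) \<le> card ?X" by (intro card_mono) auto
  moreover have "card (?Y \<union> ?Z) = card ?Y + card ?Z" by (intro card_Un_disjoint) auto
  moreover have "card ?Y = q" "card ?Z = q - 1" by (simp_all add: card_image inj_on_def)
  ultimately show ?thesis using that by linarith
qed

text \<open>By symmetry the two matrices have at most \<open>q * (q - 1)\<close> off-diagonal values
  together, fewer than the \<open>(q + 1)\<^sup>2\<close> edges between two blocks. On the diagonal
  there are at most \<open>q + r\<close> values, and leaving out the correct one makes the pairs of
  layers suffice.\<close>

lemma ex_killing_constants:
  fixes A B :: "nat \<Rightarrow> nat \<Rightarrow> real"
  assumes "q \<ge> 1" "r \<le> q"
    and symA: "\<And>i j. i < q \<Longrightarrow> j < q \<Longrightarrow> A i j = A j i"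
    and symB: "\<And>i j. i < r \<Longrightarrow> j < r \<Longrightarrow> B i j = B j i"
  obtains c :: "nat \<Rightarrow> nat \<Rightarrow> nat \<Rightarrow> nat \<Rightarrow> real" where
    "\<And>i s j s'. i < q \<Longrightarrow> j < q \<Longrightarrow> c i s j s' \<noteq> A i j"
    "\<And>i j a b. i < j \<Longrightarrow> j < q \<Longrightarrow> a < q \<Longrightarrow> b < q \<Longrightarrow> a \<noteq> b \<Longrightarrow> A a b \<noteq> A i j \<Longrightarrow>
        \<exists>s\<le>q. \<exists>s'\<le>q. c i s j s' = A a b"
    "\<And>i j a b. i < j \<Longrightarrow> j < q \<Longrightarrow> a < r \<Longrightarrow> b < r \<Longrightarrow> a \<noteq> b \<Longrightarrow> B a b \<noteq> A i j \<Longrightarrow>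
        \<exists>s\<le>q. \<exists>s'\<le>q. c i s j s' = B a b"
    "\<And>i a. i < q \<Longrightarrow> a < q \<Longrightarrow> A a a \<noteq> A i i \<Longrightarrow> \<exists>s s'. s < s' \<and> s' \<le> q \<and> c i s i s' = A a a"
    "\<And>i a. i < q \<Longrightarrow> a < r \<Longrightarrow> B a a \<noteq> A i i \<Longrightarrow> \<exists>s s'. s < s' \<and> s' \<le> q \<and> c i s i s' = B a a"
proof -
  define T where "T n = {(a, b). a < b \<and> b < (n::nat)}" for n
  define off where "off = (\<lambda>(a, b). A a b) ` T q \<union> (\<lambda>(a, b). B a b) ` T r"
  define diag where "diag = (\<lambda>a. A a a) ` {..<q} \<union> (\<lambda>a. B a a) ` {..<r}"
  have finT: "finite (T n)" for n
    by (rule finite_subset[of _ "{..<n} \<times> {..<n}"]) (auto simp: T_def)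
  have fin: "finite off" "finite diag" using finT by (auto simp: off_def diag_def)
  have "card off \<le> card (T q) + card (T r)"
    unfolding off_def by (rule order.trans[OF card_Un_le add_mono[OF card_image_le card_image_le]]) (auto simp: finT)
  also have "card (T r) \<le> card (T q)"
    using \<open>r \<le> q\<close> by (intro card_mono finT) (auto simp: T_def)
  finally have off: "card off \<le> card ({..q} \<times> {..q})"
    using card_less_pairs[of q] by (simp add: T_def)
  have diag': "card diag \<le> q + r"
    using card_image_le[of "{..<q}" "\<lambda>a. A a a"] card_image_le[of "{..<r}" "\<lambda>a. B a a"]
      card_Un_le[of "(\<lambda>a. A a a) ` {..<q}" "(\<lambda>a. B a a) ` {..<r}"] by (simp add: diag_def)
  have diag: "card (diag - {A i i}) \<le> card {(s, s'). s < s' \<and> s' \<le> q}" if "i < q" for i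
  proof -
    have "A i i \<in> diag" using that by (auto simp: diag_def)
    then have "card (diag - {A i i}) = card diag - 1" by (rule card_Diff_singleton)
    then show ?thesis
      using diag' card_le_pairs[OF assms(1)] assms(2) by linarith
  qed
  have off': "card (off - {A i j}) \<le> card ({..q} \<times> {..q})" for i j
    by (rule order.trans[OF card_mono[OF fin(1)] off]) auto
  \<comment> \<open>The filler \<open>A i j + 1\<close> differs from the correct entry
    \<open>A i j\<close>.\<close>
  have "\<exists>f. off - {A i j} \<subseteq> f ` ({..q} \<times> {..q}) \<and> (\<forall>x. f x \<in> insert (A i j + 1) (off - {A i j}))" for i j
    using fin off' by (intro ex_function_covering) auto
  then obtain fo where fo': "\<And>i j. off - {A i j} \<subseteq> fo i j ` ({..q} \<times> {..q}) \<and>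
      (\<forall>x. fo i j x \<in> insert (A i j + 1) (off - {A i j}))"
    by metis
  have fo: "off - {A i j} \<subseteq> fo i j ` ({..q} \<times> {..q})"
      "fo i j x \<in> insert (A i j + 1) (off - {A i j})" for i j x
    using fo'[of i j] by blast+
  have "finite {(s, s'). s < s' \<and> s' \<le> q}" by (rule finite_subset[of _ "{..q} \<times> {..q}"]) auto
  then have "\<forall>i\<in>{..<q}. (\<exists>f. diag - {A i i} \<subseteq> f ` {(s, s'). s < s' \<and> s' \<le> q} \<and> (\<forall>x. f x \<in> insert (A i i + 1) (diag - {A i i})))"
    using fin diag by (intro ballI ex_function_covering) auto
  from bchoice[OF this] obtain fd where fd': "\<forall>i\<in>{..<q}. diag - {A i i} \<subseteq> fd i ` {(s, s'). s < s' \<and> s' \<le> q} \<and>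
      (\<forall>x. fd i x \<in> insert (A i i + 1) (diag - {A i i}))" ..
  have fd: "diag - {A i i} \<subseteq> fd i ` {(s, s'). s < s' \<and> s' \<le> q}"
      "fd i x \<in> insert (A i i + 1) (diag - {A i i})" if "i < q" for i x
    using fd' that by blast+
  define c where "c i s j s' = (if i = j then fd i (s, s') else fo i j (s, s'))" for i s j s'
  have offI: "\<exists>s\<le>q. \<exists>s'\<le>q. c i s j s' = x" if "i < j" "x \<in> off" "x \<noteq> A i j" for i j x
  proof -
    have "x \<in> fo i j ` ({..q} \<times> {..q})" using fo(1) that by blast
    then show ?thesis using that by (auto simp: c_def)
  qed
  have diagI: "\<exists>s s'. s < s' \<and> s' \<le> q \<and> c i s i s' = x" if "i < q" "x \<in> diag" "x \<noteq> A i i" for i x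
  proof -
    have "x \<in> fd i ` {(s, s'). s < s' \<and> s' \<le> q}" using fd(1) that by blast
    then show ?thesis by (auto simp: c_def)
  qed
  have offA0: "A a b \<in> off" if "a < b" "b < q" for a b
    unfolding off_def using that by (intro UnI1 image_eqI[of _ _ "(a, b)"]) (auto simp: T_def)
  have offA: "A a b \<in> off" if "a < q" "b < q" "a \<noteq> b" for a b
    using that symA[of a b] offA0[of a b] offA0[of b a] by (metis nat_neq_iff)
  have offB0: "B a b \<in> off" if "a < b" "b < r" for a b
    unfolding off_def using that by (intro UnI2 image_eqI[of _ _ "(a, b)"]) (auto simp: T_def)
  have offB: "B a b \<in> off" if "a < r" "b < r" "a \<noteq> b" for a b
    using that symB[of a b] offB0[of a b] offB0[of b a] by (metis nat_neq_iff)
  show ?thesis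
  proof (rule that[of c])
    show "c i s j s' \<noteq> A i j" if "i < q" "j < q" for i s j s'
      using fo(2)[of i j "(s, s')"] fd(2)[of i "(s, s')"] that by (auto simp: c_def)
    show "\<exists>s\<le>q. \<exists>s'\<le>q. c i s j s' = A a b"
      if "i < j" "j < q" "a < q" "b < q" "a \<noteq> b" "A a b \<noteq> A i j" for i j a b
      by (rule offI[OF that(1) offA[OF that(3,4,5)] that(6)])
    show "\<exists>s\<le>q. \<exists>s'\<le>q. c i s j s' = B a b"
      if "i < j" "j < q" "a < r" "b < r" "a \<noteq> b" "B a b \<noteq> A i j" for i j a b
      by (rule offI[OF that(1) offB[OF that(3,4,5)] that(6)])
    show "\<exists>s s'. s < s' \<and> s' \<le> q \<and> c i s i s' = A a a" if "i < q" "a < q" "A a a \<noteq> A i i" for i a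
      by (rule diagI[OF that(1) _ that(3)]) (use that in \<open>auto simp: diag_def\<close>)
    show "\<exists>s s'. s < s' \<and> s' \<le> q \<and> c i s i s' = B a a" if "i < q" "a < r" "B a a \<noteq> A i i" for i a
      by (rule diagI[OF that(1) _ that(3)]) (use that in \<open>auto simp: diag_def\<close>)
  qed
qed

section \<open>Recovering the matrix and the weights of a model\<close>

text \<open>Everything follows from \<open>S w = S' w\<close> for all \<open>w\<close>. One choice
  of \<open>w\<close> shows that \<open>\<beta> j\<close> is among the weights
  \<open>\<alpha> i\<close>; another selects the maps that preserve weights. Strict positivity of
  \<open>\<alpha>\<close> prevents cancellation in \<open>S\<close>, while of \<open>S'\<close> it
  is enough to know that some term is nonzero.\<close>

lemma twin_free_model_determined:
  fixes A B :: "nat \<Rightarrow> nat \<Rightarrow> real" and \<alpha> \<beta> :: "nat \<Rightarrow> real"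
  assumes q: "q \<ge> 2" and r: "r \<le> q"
    and symA: "\<And>i j. i < q \<Longrightarrow> j < q \<Longrightarrow> A i j = A j i"
    and rows: "\<And>i j. i < q \<Longrightarrow> j < q \<Longrightarrow> i \<noteq> j \<Longrightarrow> \<exists>k<q. A i k \<noteq> A j k"
    and \<alpha>: "\<And>i. i < q \<Longrightarrow> \<alpha> i > 0" "(\<Sum>i<q. \<alpha> i) = 1"
    and symB: "\<And>i j. i < r \<Longrightarrow> j < r \<Longrightarrow> B i j = B j i"
    and \<beta>: "\<And>i. i < r \<Longrightarrow> \<beta> i \<ge> 0" "(\<Sum>i<r. \<beta> i) = 1"
    and eq: "\<And>V E. simple_graph V E \<Longrightarrow> card V \<le> 4 * q\<^sup>2 - q \<Longrightarrow>
      hom_sum q \<alpha> A V E = hom_sum r \<beta> B V E"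
  obtains \<tau> where "bij_betw \<tau> {..<q} {..<r}" "\<And>i. i < q \<Longrightarrow> \<beta> (\<tau> i) = \<alpha> i"
    "\<And>i j. i < q \<Longrightarrow> j < q \<Longrightarrow> B (\<tau> i) (\<tau> j) = A i j"
proof -
  have "q \<ge> 1" using q by simp
  obtain c :: "nat \<Rightarrow> nat \<Rightarrow> nat \<Rightarrow> nat \<Rightarrow> real" where kill:
    "\<And>i s j s'. i < q \<Longrightarrow> j < q \<Longrightarrow> c i s j s' \<noteq> A i j"
    "\<And>i j a b. i < j \<Longrightarrow> j < q \<Longrightarrow> a < q \<Longrightarrow> b < q \<Longrightarrow> a \<noteq> b \<Longrightarrow> A a b \<noteq> A i j \<Longrightarrow>
        \<exists>s\<le>q. \<exists>s'\<le>q. c i s j s' = A a b"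
    "\<And>i j a b. i < j \<Longrightarrow> j < q \<Longrightarrow> a < r \<Longrightarrow> b < r \<Longrightarrow> a \<noteq> b \<Longrightarrow> B a b \<noteq> A i j \<Longrightarrow>
        \<exists>s\<le>q. \<exists>s'\<le>q. c i s j s' = B a b"
    "\<And>i a. i < q \<Longrightarrow> a < q \<Longrightarrow> A a a \<noteq> A i i \<Longrightarrow> \<exists>s s'. s < s' \<and> s' \<le> q \<and> c i s i s' = A a a"
    "\<And>i a. i < q \<Longrightarrow> a < r \<Longrightarrow> B a a \<noteq> A i i \<Longrightarrow> \<exists>s s'. s < s' \<and> s' \<le> q \<and> c i s i s' = B a a"
    by (rule ex_killing_constants[of q r A B, OF \<open>q \<ge> 1\<close> r symA symB]) (assumption+, (rule that; assumption))
  define sep where "sep i j = (SOME k. k < q \<and> A i k \<noteq> A j k)" for i j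
  have sep: "sep i j < q \<and> A i (sep i j) \<noteq> A j (sep i j)" if "i < q" "j < q" "i \<noteq> j" for i j
    unfolding sep_def by (rule someI_ex) (use rows[OF that] in blast)
  interpret gadget q A sep c
    by unfold_locales (fact symA kill(1) | use sep in blast)+
  interpret W: gadget_model q A sep c q \<alpha> A
    by unfold_locales (fact order.refl symA \<alpha>(2) kill(2,4) | use \<alpha>(1) in \<open>force intro: less_imp_le\<close>)+
  interpret W': gadget_model q A sep c r \<beta> B
    by unfold_locales (fact r symB \<beta> kill(3,5))+
  let ?Q = "{..<q} \<times> {..<q - 1}"
  define \<Phi> where "\<Phi> = {\<phi> \<in> V0 \<rightarrow>\<^sub>E {..<q}. F0 (W.ev \<phi>) \<noteq> 0}"
  define \<Phi>' where "\<Phi>' = {\<phi> \<in> V0 \<rightarrow>\<^sub>E {..<r}. F0 (W'.ev \<phi>) \<noteq> 0}"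
  define S where "S w = (\<Sum>\<phi>\<in>\<Phi>. (\<Prod>v\<in>V0. \<alpha> (\<phi> v)) * (\<Prod>(i, s)\<in>?Q. \<alpha> (\<phi> (Core i 0)) - w i s))" for w
  define S' where "S' w = (\<Sum>\<phi>\<in>\<Phi>'. (\<Prod>v\<in>V0. \<beta> (\<phi> v)) * (\<Prod>(i, s)\<in>?Q. \<beta> (\<phi> (Core i 0)) - w i s))" for w
  define K where "K = (\<Prod>(i, s)\<in>?Q. \<kappa> i)"
  have "K \<noteq> 0"
    using sep by (auto simp: K_def \<kappa>_def)
  have sums: "(\<Sum>\<phi>\<in>V0 \<union> Xv \<rightarrow>\<^sub>E {..<q}. (\<Prod>v\<in>V0 \<union> Xv. \<alpha> (\<phi> v)) * (F0 (W.ev \<phi>) * F6 w (W.ev \<phi>))) =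
     (\<Sum>\<phi>\<in>V0 \<union> Xv \<rightarrow>\<^sub>E {..<r}. (\<Prod>v\<in>V0 \<union> Xv. \<beta> (\<phi> v)) * (F0 (W'.ev \<phi>) * F6 w (W'.ev \<phi>)))" for w
    unfolding W.ev_def W'.ev_def
  proof (rule multi_affine_sum_eq[where E = "E0 \<union> E6" and F = "\<lambda>t. F0 t * F6 w t"])
    show "finite (V0 \<union> Xv)" using finite_V by simp
    show "E0 \<union> E6 \<subseteq> (V0 \<union> Xv) \<times> (V0 \<union> Xv)" using E0_subset E6_subset by blast
  qed (fact eq multi_affine_F card_V E_asym symA symB)+
  have "F0 t0 * K * S w = F0 t0 * K * S' w" for w
    unfolding S_def S'_def \<Phi>_def \<Phi>'_def K_def
    using sums[of w] unfolding W.gadget_sum W'.gadget_sum .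
  then have SS': "S w = S' w" for w
    using F0_block \<open>K \<noteq> 0\<close> by simp
  have fin: "finite \<Phi>" "finite \<Phi>'"
    using finite_V by (auto simp: \<Phi>_def \<Phi>'_def finite_PiE)
  have al: "bij_betw (\<lambda>i. \<phi> (Core i 0)) {..<q} {..<q}" if "\<phi> \<in> \<Phi>" for \<phi>
    using that by (intro W.aligned(1)) (auto simp: \<Phi>_def)
  have al': "bij_betw (\<lambda>i. \<phi> (Core i 0)) {..<q} {..<r}"
     "\<And>i j. i < q \<Longrightarrow> j < q \<Longrightarrow> B (\<phi> (Core i 0)) (\<phi> (Core j 0)) = A i j" if "\<phi> \<in> \<Phi>'" for \<phi>
    using that by (auto simp: \<Phi>'_def intro!: W'.aligned(1) W'.aligned(3))
  have pos: "(\<Prod>v\<in>V0. \<alpha> (\<phi> v)) > 0" if "\<phi> \<in> \<Phi>" for \<phi>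
    using that \<alpha> by (intro prod_pos) (auto simp: \<Phi>_def)
  \<comment> \<open>The intended map shows that the sums over \<open>\<Phi>\<close> are not empty,
    as the positivity arguments require.\<close>
  define \<phi>0 where "\<phi>0 = restrict block V0"
  have "F0 (W.ev \<phi>0) = F0 t0"
    using E0_subset by (intro multi_affine_cong[OF multi_affine_F0]) (auto simp: W.ev_def \<phi>0_def)
  moreover have "block v < q" if "v \<in> V0" for v
    using that sep_less by (auto simp: V0_def Mv_def Hv_def Av_def P_def)
  ultimately have \<phi>0: "\<phi>0 \<in> \<Phi>"
    using F0_block by (auto simp: \<Phi>_def \<phi>0_def)
  have \<phi>0_Mn: "\<phi>0 (Core i 0) = i" if "i < q" for i
    using that W.V0_I(1) by (simp add: \<phi>0_def)
  \<comment> \<open>With \<open>w i 0 = \<beta> j\<close> every term on the side of \<open>\<beta>\<close> vanishes, and \<open>\<Prod>i<q. \<alpha> i - \<beta> j\<close> can be factored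
    out on the other side because every aligned map permutes the parts.\<close>
  have weights: "\<beta> j \<in> \<alpha> ` {..<q}" if j: "j < r" for j
  proof -
    define w where "w i s = (if s = 0 then \<beta> j else -1)" for i s :: nat
    \<comment> \<open>Here \<open>q \<ge> 2\<close> provides the extra that carries
      \<open>\<beta> j\<close>. The value -1 turns the factors of the other extras into weights plus
      1, which are positive in \<open>S\<close>.\<close>
    have "{..<q - 1} = insert 0 {1..<q - 1}" using q by auto
    then have prod_w: "(\<Prod>(i, s)\<in>?Q. f i - w i s) = (\<Prod>i<q. f i - \<beta> j) * (\<Prod>i<q. \<Prod>s\<in>{1..<q - 1}. f i + 1)"
      for f :: "nat \<Rightarrow> real"
      by (simp add: w_def prod.distrib flip: prod.cartesian_product)
    have "S' w = 0"
      unfolding S'_def prod_w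
    proof (intro sum.neutral ballI)
      fix \<phi> assume "\<phi> \<in> \<Phi>'"
      then have "\<exists>i<q. j = \<phi> (Core i 0)"
        using al'(1) j by (auto simp: bij_betw_def image_iff set_eq_iff)
      then show "(\<Prod>v\<in>V0. \<beta> (\<phi> v)) * ((\<Prod>i<q. \<beta> (\<phi> (Core i 0)) - \<beta> j) * (\<Prod>i<q. \<Prod>s\<in>{1..<q - 1}. \<beta> (\<phi> (Core i 0)) + 1)) = 0"
        by auto
    qed
    moreover have "S w = (\<Prod>i<q. \<alpha> i - \<beta> j) *
        (\<Sum>\<phi>\<in>\<Phi>. (\<Prod>v\<in>V0. \<alpha> (\<phi> v)) * (\<Prod>i<q. \<Prod>s\<in>{1..<q - 1}. \<alpha> (\<phi> (Core i 0)) + 1))"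
      unfolding S_def prod_w sum_distrib_left
    proof (intro sum.cong refl)
      fix \<phi> assume "\<phi> \<in> \<Phi>"
      then have "(\<Prod>i<q. \<alpha> (\<phi> (Core i 0)) - \<beta> j) = (\<Prod>i<q. \<alpha> i - \<beta> j)"
        by (intro prod.reindex_bij_betw[OF al])
      then show "(\<Prod>v\<in>V0. \<alpha> (\<phi> v)) * ((\<Prod>i<q. \<alpha> (\<phi> (Core i 0)) - \<beta> j) * (\<Prod>i<q. \<Prod>s\<in>{1..<q - 1}. \<alpha> (\<phi> (Core i 0)) + 1)) =
        (\<Prod>i<q. \<alpha> i - \<beta> j) * ((\<Prod>v\<in>V0. \<alpha> (\<phi> v)) * (\<Prod>i<q. \<Prod>s\<in>{1..<q - 1}. \<alpha> (\<phi> (Core i 0)) + 1))"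
        by simp
    qed
    moreover have "(\<Sum>\<phi>\<in>\<Phi>. (\<Prod>v\<in>V0. \<alpha> (\<phi> v)) * (\<Prod>i<q. \<Prod>s\<in>{1..<q - 1}. \<alpha> (\<phi> (Core i 0)) + 1)) > 0"
    proof (rule sum_pos)
      fix \<phi> assume \<phi>: "\<phi> \<in> \<Phi>"
      have "\<alpha> (\<phi> (Core i 0)) + 1 > 0" if "i < q" for i
        using al[OF \<phi>] \<alpha>(1)[of "\<phi> (Core i 0)"] that by (force simp: bij_betw_def)
      then show "(\<Prod>v\<in>V0. \<alpha> (\<phi> v)) * (\<Prod>i<q. \<Prod>s\<in>{1..<q - 1}. \<alpha> (\<phi> (Core i 0)) + 1) > 0"
        by (intro mult_pos_pos[OF pos[OF \<phi>]] prod_pos) auto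
    qed (use fin \<phi>0 in auto)
    ultimately have "(\<Prod>i<q. \<alpha> i - \<beta> j) = 0"
      unfolding SS'[of w] by (metis (lifting) mult_eq_0_iff less_irrefl)
    then show ?thesis by (auto simp: image_iff intro: sym)
  qed
  \<comment> \<open>Now let \<open>w i\<close> run through all weights other than \<open>\<alpha> i\<close>.\<close>
  have "\<forall>i\<in>{..<q}. \<exists>f. \<alpha> ` {..<q} - {\<alpha> i} \<subseteq> f ` {..<q - 1} \<and>
      (\<forall>x. f x \<in> insert (-1) (\<alpha> ` {..<q} - {\<alpha> i}))"
  proof (intro ballI ex_function_covering)
    fix i assume "i \<in> {..<q}"
    then have "card (\<alpha> ` {..<q} - {\<alpha> i}) = card (\<alpha> ` {..<q}) - 1" by (intro card_Diff_singleton) auto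
    then show "card (\<alpha> ` {..<q} - {\<alpha> i}) \<le> card {..<q - 1}"
      using card_image_le[of "{..<q}" \<alpha>] by simp
  qed auto
  from bchoice[OF this] obtain w where w': "\<forall>i\<in>{..<q}. \<alpha> ` {..<q} - {\<alpha> i} \<subseteq> w i ` {..<q - 1} \<and>
      (\<forall>x. w i x \<in> insert (-1) (\<alpha> ` {..<q} - {\<alpha> i}))" ..
  have w: "\<alpha> ` {..<q} - {\<alpha> i} \<subseteq> w i ` {..<q - 1}" "w i s \<in> insert (-1) (\<alpha> ` {..<q} - {\<alpha> i})"
    if "i < q" for i s
    using w' that by blast+
  have vanish: "(\<Prod>(i, s)\<in>?Q. f i - w i s) = 0"
    if "i < q" "f i \<in> \<alpha> ` {..<q}" "f i \<noteq> \<alpha> i" for i and f :: "nat \<Rightarrow> real"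
  proof -
    have "f i \<in> w i ` {..<q - 1}" using w(1)[OF that(1)] that(2,3) by blast
    then obtain s where "s < q - 1" "f i = w i s" by auto
    then have "\<exists>p\<in>?Q. (case p of (i, s) \<Rightarrow> f i - w i s) = 0" using that by (intro bexI[of _ "(i, s)"]) auto
    then show ?thesis by (intro prod_zero) auto
  qed
  define C where "C = (\<Prod>(i, s)\<in>?Q. \<alpha> i - w i s)"
  have "C \<noteq> 0"
  proof -
    \<comment> \<open>The values of \<open>w i\<close> are weights different from
      \<open>\<alpha> i\<close> or the filler -1, which is no weight because weights are
      positive.\<close>
    have "\<alpha> i \<noteq> w i s" if "i < q" for i s using w(2)[OF that, of s] \<alpha>(1)[OF that] by auto
    then show ?thesis by (auto simp: C_def)
  qed
  \<comment> \<open>Outside \<open>\<Psi>\<close> some block goes to a wrong weight, and the term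
    contains a zero factor. Inside, all terms share the factor \<open>C\<close>, so the sum is
    \<open>C\<close> times a positive number.\<close>
  define \<Psi> where "\<Psi> = {\<phi> \<in> \<Phi>. \<forall>i<q. \<alpha> (\<phi> (Core i 0)) = \<alpha> i}"
  have "S w = (\<Sum>\<phi>\<in>\<Psi>. (\<Prod>v\<in>V0. \<alpha> (\<phi> v)) * (\<Prod>(i, s)\<in>?Q. \<alpha> (\<phi> (Core i 0)) - w i s))"
    unfolding S_def
  proof (intro sum.mono_neutral_right fin ballI)
    fix \<phi> assume "\<phi> \<in> \<Phi> - \<Psi>"
    then obtain i where \<phi>: "\<phi> \<in> \<Phi>" and i: "i < q" "\<alpha> (\<phi> (Core i 0)) \<noteq> \<alpha> i" by (auto simp: \<Psi>_def)
    have "\<alpha> (\<phi> (Core i 0)) \<in> \<alpha> ` {..<q}" using al[OF \<phi>] i by (auto simp: bij_betw_def)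
    then show "(\<Prod>v\<in>V0. \<alpha> (\<phi> v)) * (\<Prod>(i, s)\<in>?Q. \<alpha> (\<phi> (Core i 0)) - w i s) = 0"
      using vanish[of i "\<lambda>i. \<alpha> (\<phi> (Core i 0))"] i by simp
  qed (auto simp: \<Psi>_def)
  also have "\<dots> = (\<Sum>\<phi>\<in>\<Psi>. (\<Prod>v\<in>V0. \<alpha> (\<phi> v))) * C"
    unfolding sum_distrib_right
  proof (intro sum.cong refl)
    fix \<phi> assume "\<phi> \<in> \<Psi>"
    then have "(\<Prod>(i, s)\<in>?Q. \<alpha> (\<phi> (Core i 0)) - w i s) = C"
      unfolding C_def by (intro prod.cong) (auto simp: \<Psi>_def)
    then show "(\<Prod>v\<in>V0. \<alpha> (\<phi> v)) * (\<Prod>(i, s)\<in>?Q. \<alpha> (\<phi> (Core i 0)) - w i s) = (\<Prod>v\<in>V0. \<alpha> (\<phi> v)) * C"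
      by simp
  qed
  finally have "S w = (\<Sum>\<phi>\<in>\<Psi>. (\<Prod>v\<in>V0. \<alpha> (\<phi> v))) * C" .
  moreover have "(\<Sum>\<phi>\<in>\<Psi>. (\<Prod>v\<in>V0. \<alpha> (\<phi> v))) > 0"
  proof (rule sum_pos)
    show "\<Psi> \<noteq> {}" using \<phi>0 \<phi>0_Mn by (auto simp: \<Psi>_def)
  qed (use fin pos in \<open>auto simp: \<Psi>_def\<close>)
  ultimately have "S w \<noteq> 0" using \<open>C \<noteq> 0\<close> by auto
  then have "S' w \<noteq> 0" using SS' by simp
  then obtain \<phi> where \<phi>: "\<phi> \<in> \<Phi>'" and nz: "(\<Prod>(i, s)\<in>?Q. \<beta> (\<phi> (Core i 0)) - w i s) \<noteq> 0"
    unfolding S'_def by (metis (no_types, lifting) mult_zero_right sum.neutral)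
  \<comment> \<open>By \<open>weights\<close> the left side is some weight of
    \<open>\<alpha>\<close>; any other than \<open>\<alpha> i\<close> would make the product in
    \<open>nz\<close> vanish.\<close>
  have "\<beta> (\<phi> (Core i 0)) = \<alpha> i" if "i < q" for i
  proof -
    have "\<phi> (Core i 0) < r" using al'(1)[OF \<phi>] that by (auto simp: bij_betw_def)
    then show ?thesis
      using vanish[of i "\<lambda>i. \<beta> (\<phi> (Core i 0))"] nz weights that by auto
  qed
  then show ?thesis
    using al'[OF \<phi>] that[of "\<lambda>i. \<phi> (Core i 0)"] by auto
qed

lemma hom_sum_reindex:
  assumes \<tau>: "bij_betw \<tau> {..<q} {..<r}" "\<And>i. i < q \<Longrightarrow> \<beta> (\<tau> i) = \<alpha> i"
    "\<And>i j. i < q \<Longrightarrow> j < q \<Longrightarrow> B (\<tau> i) (\<tau> j) = A i j"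
    and G: "simple_graph V E"
  shows "hom_sum q \<alpha> A V E = hom_sum r \<beta> B V E"
proof -
  have mm: "Min e \<in> V" "Max e \<in> V" if "e \<in> E" for e
  proof -
    have "finite e" "e \<noteq> {}" "e \<subseteq> V" using G that by (auto simp: simple_graph_def card_eq_0_iff intro: finite_subset)
    then show "Min e \<in> V" "Max e \<in> V" using Min_in Max_in by auto
  qed
  show ?thesis
    unfolding hom_sum_def
  proof (rule sum.reindex_bij_betw[symmetric, THEN trans, OF _ sum.cong[OF refl], symmetric])
    show "bij_betw (\<lambda>\<phi>. restrict (\<tau> \<circ> \<phi>) V) (V \<rightarrow>\<^sub>E {..<q}) (V \<rightarrow>\<^sub>E {..<r})"
    proof (rule bij_betw_byWitness[where f' = "\<lambda>\<phi>. restrict (the_inv_into {..<q} \<tau> \<circ> \<phi>) V"])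
      show "\<forall>a\<in>V \<rightarrow>\<^sub>E {..<q}. (\<lambda>x\<in>V. (the_inv_into {..<q} \<tau> \<circ> restrict (\<tau> \<circ> a) V) x) = a"
        using \<tau>(1) by (auto simp: fun_eq_iff bij_betw_def the_inv_into_f_f PiE_def extensional_def Pi_def)
      show "\<forall>a\<in>V \<rightarrow>\<^sub>E {..<r}. restrict (\<tau> \<circ> (\<lambda>x\<in>V. (the_inv_into {..<q} \<tau> \<circ> a) x)) V = a"
        using \<tau>(1) by (auto simp: fun_eq_iff bij_betw_def f_the_inv_into_f PiE_def extensional_def Pi_def)
      show "(\<lambda>\<phi>. restrict (\<tau> \<circ> \<phi>) V) ` (V \<rightarrow>\<^sub>E {..<q}) \<subseteq> V \<rightarrow>\<^sub>E {..<r}"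
        using bij_betw_apply[OF \<tau>(1)] by (auto simp: PiE_iff)
      have "the_inv_into {..<q} \<tau> x < q" if "x < r" for x
        using \<tau>(1) that the_inv_into_into[of \<tau> "{..<q}" x "{..<q}"] by (auto simp: bij_betw_def)
      then show "(\<lambda>\<phi>. restrict (the_inv_into {..<q} \<tau> \<circ> \<phi>) V) ` (V \<rightarrow>\<^sub>E {..<r}) \<subseteq> V \<rightarrow>\<^sub>E {..<q}"
        by (auto simp: PiE_iff)
    qed
    fix \<phi> assume \<phi>: "\<phi> \<in> V \<rightarrow>\<^sub>E {..<q}"
    show "(\<Prod>v\<in>V. \<beta> (restrict (\<tau> \<circ> \<phi>) V v)) * (\<Prod>e\<in>E. B (restrict (\<tau> \<circ> \<phi>) V (Min e)) (restrict (\<tau> \<circ> \<phi>) V (Max e))) =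
        (\<Prod>v\<in>V. \<alpha> (\<phi> v)) * (\<Prod>e\<in>E. A (\<phi> (Min e)) (\<phi> (Max e)))"
      using \<phi> mm \<tau>(2,3) by (intro arg_cong2[of _ _ _ _ "(*)"] prod.cong) (auto simp: PiE_def Pi_def)
  qed
qed

section \<open>Homomorphism densities of step functions\<close>

abbreviation unit_measure :: "real measure" where
  "unit_measure \<equiv> restrict_space lborel {0..1}"

abbreviation cube :: "nat set \<Rightarrow> (nat \<Rightarrow> real) measure" where
  "cube V \<equiv> Pi\<^sub>M V (\<lambda>_. unit_measure)"

lemma space_unit [simp]: "space unit_measure = {0..1}"
  by (simp add: space_restrict_space)

lemma finite_measure_unit: "finite_measure unit_measure"
  by (rule finite_measureI) (simp add: emeasure_restrict_space)

lemma measure_unit_space: "measure unit_measure {0..1} = 1"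
  by (simp add: measure_restrict_space)

interpretation unit: finite_measure unit_measure
  by (rule finite_measure_unit)

interpretation unit_pair: pair_sigma_finite unit_measure unit_measure
  by unfold_locales

interpretation unit_prod: product_sigma_finite "\<lambda>_. unit_measure"
  by unfold_locales

lemma measurable_unit_borel: "f \<in> borel_measurable borel \<Longrightarrow> f \<in> borel_measurable unit_measure"
  by (intro measurable_restrict_space1) simp

lemma unit_id [measurable]: "(\<lambda>x. x) \<in> unit_measure \<rightarrow>\<^sub>M borel"
  by (rule measurable_unit_borel) simp

lemma cube_coordinate [measurable (raw)]: "v \<in> V \<Longrightarrow> (\<lambda>x. x v) \<in> cube V \<rightarrow>\<^sub>M borel"
  by (rule measurable_compose[OF measurable_component_singleton[of v V "\<lambda>_. unit_measure"] unit_id])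

lemma emeasure_cube_space:
  assumes "finite V"
  shows "emeasure (cube V) (space (cube V)) = 1"
proof -
  have "{0..1} \<in> sets unit_measure" using sets.top[of unit_measure] by simp
  then show ?thesis
    using assms by (simp add: space_PiM unit_prod.emeasure_PiM emeasure_restrict_space)
qed

lemma finite_measure_cube: "finite V \<Longrightarrow> finite_measure (cube V)"
  by (rule finite_measureI) (simp add: emeasure_cube_space)

lemma measurable_pair_unit: "f \<in> borel_measurable borel \<Longrightarrow> f \<in> borel_measurable (unit_measure \<Otimes>\<^sub>M unit_measure)"
  for f :: "real \<times> real \<Rightarrow> real"
proof -
  assume f: "f \<in> borel_measurable borel"
  have "(\<lambda>p. (fst p, snd p)) \<in> unit_measure \<Otimes>\<^sub>M unit_measure \<rightarrow>\<^sub>M borel \<Otimes>\<^sub>M borel" by measurable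
  then have "(\<lambda>p. p) \<in> unit_measure \<Otimes>\<^sub>M unit_measure \<rightarrow>\<^sub>M (borel :: (real \<times> real) measure)"
    by (simp add: borel_prod)
  from measurable_compose[OF this f] show ?thesis .
qed

text \<open>Kernels are compared only almost everywhere on the square. Two distinct coordinates of
  the cube are jointly distributed like a point of the square, which carries such identities over to
  every edge.\<close>

lemma distr_cube_pair:
  assumes V: "finite V" "u \<in> V" "v \<in> V" "u \<noteq> v"
  shows "distr (cube V) (unit_measure \<Otimes>\<^sub>M unit_measure) (\<lambda>x. (x u, x v)) = unit_measure \<Otimes>\<^sub>M unit_measure"
    (is "?D = _")
proof (rule pair_measure_eqI[symmetric])
  have meas: "(\<lambda>x. (x u, x v)) \<in> cube V \<rightarrow>\<^sub>M unit_measure \<Otimes>\<^sub>M unit_measure"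
    using V by (intro measurable_Pair measurable_component_singleton)
  fix A B assume A: "A \<in> sets unit_measure" "B \<in> sets unit_measure"
  have sp: "A \<subseteq> {0..1}" "B \<subseteq> {0..1}" using A[THEN sets.sets_into_space] by auto
  let ?S = "\<lambda>i. if i = u then A else if i = v then B else {0..1}"
  have eq: "(\<lambda>x. (x u, x v)) -` (A \<times> B) \<inter> space (cube V) = Pi\<^sub>E V ?S"
  proof (intro set_eqI iffI)
    fix x assume x: "x \<in> Pi\<^sub>E V ?S"
    have "?S i \<subseteq> {0..1}" for i using sp by simp
    then have "x i \<in> {0..1}" if "i \<in> V" for i using PiE_mem[OF x that] by blast
    moreover have "x u \<in> A" "x v \<in> B" using V PiE_mem[OF x, of u] PiE_mem[OF x, of v] by auto
    ultimately show "x \<in> (\<lambda>x. (x u, x v)) -` (A \<times> B) \<inter> space (cube V)"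
      using x by (auto simp: space_PiM PiE_iff)
  qed (use V in \<open>auto simp: space_PiM PiE_iff\<close>)
  have S: "?S i \<in> sets unit_measure" for i
    using A sets.top[of unit_measure] by (simp del: sets.top)
  have V': "V = insert u (insert v (V - {u, v}))" using V by auto
  have "emeasure ?D (A \<times> B) = emeasure (cube V) (Pi\<^sub>E V ?S)"
    using meas A by (simp add: emeasure_distr eq)
  also have "\<dots> = (\<Prod>i\<in>V. emeasure unit_measure (?S i))"
    using S V(1) by (intro unit_prod.emeasure_PiM) auto
  also have "\<dots> = emeasure unit_measure A * emeasure unit_measure B"
    using V(1,4) by (subst V') (simp add: emeasure_restrict_space)
  finally show "emeasure unit_measure A * emeasure unit_measure B = emeasure ?D (A \<times> B)" by simp
qed (auto intro: unit.sigma_finite_measure_axioms)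

lemma simple_graph_edge:
  assumes "simple_graph V E" "e \<in> E"
  shows "Min e \<in> V" "Max e \<in> V" "Min e \<noteq> Max e"
proof -
  have e: "finite e" "card e = 2" "e \<subseteq> V"
    using assms by (auto simp: simple_graph_def intro: finite_subset)
  then obtain a b where "e = {a, b}" "a \<noteq> b" by (auto simp: card_2_iff)
  then show "Min e \<in> V" "Max e \<in> V" "Min e \<noteq> Max e" using e by (auto simp: min_def max_def)
qed

lemma simple_graph_finite: "simple_graph V E \<Longrightarrow> finite V" "simple_graph V E \<Longrightarrow> finite E"
  by (auto simp: simple_graph_def intro: finite_subset[of E "Pow V"])

lemma hom_density_eq_integral:
  assumes K: "K \<in> borel_measurable borel"
    and AE: "AE p in unit_measure \<Otimes>\<^sub>M unit_measure. U p = K p"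
    and G: "simple_graph V E"
  shows "hom_density V E U = (LINT x|cube V. (\<Prod>e\<in>E. K (x (Min e), x (Max e))))"
proof -
  let ?f = "\<lambda>x. \<Prod>e\<in>E. U (x (Min e), x (Max e))" and ?g = "\<lambda>x. \<Prod>e\<in>E. K (x (Min e), x (Max e))"
  note fin = simple_graph_finite[OF G]
  have "AE x in cube V. U (x (Min e), x (Max e)) = K (x (Min e), x (Max e))" if "e \<in> E" for e
  proof -
    note e = simple_graph_edge[OF G that]
    have 1: "(\<lambda>x. (x (Min e), x (Max e))) \<in> cube V \<rightarrow>\<^sub>M unit_measure \<Otimes>\<^sub>M unit_measure"
      using e by (intro measurable_Pair measurable_component_singleton)
    have 2: "AE p in distr (cube V) (unit_measure \<Otimes>\<^sub>M unit_measure) (\<lambda>x. (x (Min e), x (Max e))). U p = K p"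
      unfolding distr_cube_pair[OF fin(1) e] by (rule AE)
    show ?thesis using AE_distrD[OF 1 2] by simp
  qed
  then have "AE x in cube V. \<forall>e\<in>E. U (x (Min e), x (Max e)) = K (x (Min e), x (Max e))"
    using fin(2) by (simp add: AE_finite_all)
  then have ae: "AE x in cube V. ?f x = ?g x"
    by eventually_elim (auto intro: prod.cong)
  have g: "?g \<in> borel_measurable (cube V)"
  proof (rule borel_measurable_prod)
    fix e assume "e \<in> E"
    note e = simple_graph_edge[OF G this]
    have "(\<lambda>x. (x (Min e), x (Max e))) \<in> cube V \<rightarrow>\<^sub>M borel"
      unfolding borel_prod[symmetric] using e by measurable
    then show "(\<lambda>x. K (x (Min e), x (Max e))) \<in> borel_measurable (cube V)"
      by (rule measurable_compose[OF _ K])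
  qed
  have ae': "AE x in completion (cube V). ?g x = ?f x"
    using AE_completion[OF ae] by eventually_elim simp
  have g': "?g \<in> borel_measurable (completion (cube V))" using g by (rule measurable_completion)
  have f': "?f \<in> borel_measurable (completion (cube V))"
  proof (rule measurableI)
    fix A :: "real set" assume "A \<in> sets borel"
    then have "?g -` A \<inter> space (completion (cube V)) \<in> sets (completion (cube V))"
      using g' by (rule measurable_sets[rotated])
    moreover have "AE x in completion (cube V). x \<in> ?g -` A \<inter> space (completion (cube V)) \<longleftrightarrow> x \<in> ?f -` A \<inter> space (completion (cube V))"
      using ae' by eventually_elim simp
    ultimately show "?f -` A \<inter> space (completion (cube V)) \<in> sets (completion (cube V))"
      by (intro completion.in_sets_AE[where B = "?f -` A \<inter> space (completion (cube V))"]) auto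
  qed auto
  have "hom_density V E U = integral\<^sup>L (completion (cube V)) ?f"
    by (simp add: hom_density_def cube_measure_def)
  also have "\<dots> = integral\<^sup>L (completion (cube V)) ?g"
    using f' g' AE_completion[OF ae] by (rule integral_cong_AE)
  also have "\<dots> = integral\<^sup>L (cube V) ?g"
    using g by (rule integral_completion)
  finally show ?thesis .
qed

text \<open>Almost everywhere the integrand depends only on the parts that contain the coordinates.
  The cube is split accordingly, and independence of the coordinates turns each piece into a product
  of part measures.\<close>

lemma hom_density_step:
  assumes p: "p \<in> borel \<rightarrow>\<^sub>M count_space UNIV" "\<And>x. p x < r"
    and AE: "AE (x, y) in unit_measure \<Otimes>\<^sub>M unit_measure. U (x, y) = B (p x) (p y)"
    and G: "simple_graph V E"
  shows "hom_density V E U = hom_sum r (\<lambda>i. measure unit_measure {x \<in> {0..1}. p x = i}) B V E"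
proof -
  note fin = simple_graph_finite[OF G]
  let ?\<beta> = "\<lambda>i. measure unit_measure {x \<in> {0..1}. p x = i}"
  let ?ind = "\<lambda>i x. indicator {x \<in> {0..1}. p x = i} x :: real"
  have meas: "{x \<in> {0..1}. p x = i} \<in> sets unit_measure" for i
  proof -
    have "{x \<in> space unit_measure. p x = i} \<in> sets unit_measure"
      using p(1) measurable_compose[OF unit_id p(1)] by measurable
    then show ?thesis by simp
  qed
  have K: "(\<lambda>(x, y). B (p x) (p y)) \<in> borel_measurable borel"
  proof -
    have "(\<lambda>z. B i (p (snd z))) \<in> borel_measurable (borel \<Otimes>\<^sub>M borel)" for i
      by (rule measurable_compose[OF measurable_compose[OF measurable_snd p(1)], of "B i"]) simp
    from measurable_compose_countable[OF this measurable_compose[OF measurable_fst p(1)]]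
    have "(\<lambda>z. B (p (fst z)) (p (snd z))) \<in> borel_measurable (borel \<Otimes>\<^sub>M borel)" .
    then show ?thesis by (simp add: borel_prod case_prod_beta)
  qed
  have "AE z in unit_measure \<Otimes>\<^sub>M unit_measure. U z = (\<lambda>(x, y). B (p x) (p y)) z"
    using AE by eventually_elim auto
  from hom_density_eq_integral[OF K this G]
  have "hom_density V E U = (LINT x|cube V. (\<Prod>e\<in>E. B (p (x (Min e))) (p (x (Max e)))))"
    by simp
  also have "\<dots> = (LINT x|cube V. (\<Sum>\<phi>\<in>V \<rightarrow>\<^sub>E {..<r}.
      (\<Prod>v\<in>V. ?ind (\<phi> v) (x v)) * (\<Prod>e\<in>E. B (\<phi> (Min e)) (\<phi> (Max e)))))"
  proof (rule Bochner_Integration.integral_cong[OF refl])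
    fix x assume x: "x \<in> space (cube V)"
    \<comment> \<open>The only map all of whose indicators are 1 at \<open>x\<close>.\<close>
    let ?\<phi> = "restrict (\<lambda>v. p (x v)) V"
    have "(\<Sum>\<phi>\<in>V \<rightarrow>\<^sub>E {..<r}. (\<Prod>v\<in>V. ?ind (\<phi> v) (x v)) * (\<Prod>e\<in>E. B (\<phi> (Min e)) (\<phi> (Max e)))) =
        (\<Sum>\<phi>\<in>{?\<phi>}. (\<Prod>v\<in>V. ?ind (\<phi> v) (x v)) * (\<Prod>e\<in>E. B (\<phi> (Min e)) (\<phi> (Max e))))"
    proof (rule sum.mono_neutral_right)
      show "finite (V \<rightarrow>\<^sub>E {..<r})" using fin by (simp add: finite_PiE)
      show "{?\<phi>} \<subseteq> V \<rightarrow>\<^sub>E {..<r}" using p(2) by auto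
      show "\<forall>\<phi>\<in>(V \<rightarrow>\<^sub>E {..<r}) - {?\<phi>}. (\<Prod>v\<in>V. ?ind (\<phi> v) (x v)) * (\<Prod>e\<in>E. B (\<phi> (Min e)) (\<phi> (Max e))) = 0"
      proof
        fix \<phi> assume \<phi>: "\<phi> \<in> (V \<rightarrow>\<^sub>E {..<r}) - {?\<phi>}"
        have "\<exists>v\<in>V. p (x v) \<noteq> \<phi> v"
        proof (rule ccontr)
          assume "\<not> (\<exists>v\<in>V. p (x v) \<noteq> \<phi> v)"
          then have "\<phi> = ?\<phi>" using \<phi> by (auto simp: fun_eq_iff PiE_def extensional_def)
          then show False using \<phi> by simp
        qed
        then have "\<exists>v\<in>V. ?ind (\<phi> v) (x v) = 0" by (auto simp: indicator_def)
        then show "(\<Prod>v\<in>V. ?ind (\<phi> v) (x v)) * (\<Prod>e\<in>E. B (\<phi> (Min e)) (\<phi> (Max e))) = 0"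
          using fin by (auto intro: prod_zero)
      qed
    qed
    also have "\<dots> = (\<Prod>e\<in>E. B (p (x (Min e))) (p (x (Max e))))"
    proof -
      have "(\<Prod>v\<in>V. ?ind (?\<phi> v) (x v)) = 1"
        using x by (intro prod.neutral) (auto simp: space_PiM PiE_iff)
      then show ?thesis using simple_graph_edge[OF G] by (simp cong: prod.cong)
    qed
    finally show "(\<Prod>e\<in>E. B (p (x (Min e))) (p (x (Max e)))) = (\<Sum>\<phi>\<in>V \<rightarrow>\<^sub>E {..<r}.
        (\<Prod>v\<in>V. ?ind (\<phi> v) (x v)) * (\<Prod>e\<in>E. B (\<phi> (Min e)) (\<phi> (Max e))))" by simp
  qed
  also have "\<dots> = (\<Sum>\<phi>\<in>V \<rightarrow>\<^sub>E {..<r}. LINT x|cube V.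
      ((\<Prod>v\<in>V. ?ind (\<phi> v) (x v)) * (\<Prod>e\<in>E. B (\<phi> (Min e)) (\<phi> (Max e)))))"
    using meas fin
    by (intro Bochner_Integration.integral_sum integrable_mult_left unit_prod.product_integrable_prod)
       (auto simp: unit.emeasure_finite less_top[symmetric] intro!: integrable_real_indicator)
  also have "\<dots> = (\<Sum>\<phi>\<in>V \<rightarrow>\<^sub>E {..<r}. (\<Prod>v\<in>V. ?\<beta> (\<phi> v)) * (\<Prod>e\<in>E. B (\<phi> (Min e)) (\<phi> (Max e))))"
  proof (intro sum.cong refl)
    fix \<phi>
    have "(LINT x|cube V. (\<Prod>v\<in>V. ?ind (\<phi> v) (x v))) = (\<Prod>v\<in>V. LINT x|unit_measure. ?ind (\<phi> v) x)"
      using meas fin by (intro unit_prod.product_integral_prod)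
        (auto simp: unit.emeasure_finite less_top[symmetric] intro!: integrable_real_indicator)
    also have "\<dots> = (\<Prod>v\<in>V. ?\<beta> (\<phi> v))"
    proof (intro prod.cong refl)
      fix v
      have "{x \<in> {0..1}. p x = \<phi> v} \<inter> space unit_measure = {x \<in> {0..1}. p x = \<phi> v}" by auto
      then show "(LINT x|unit_measure. ?ind (\<phi> v) x) = ?\<beta> (\<phi> v)"
        by (simp only: Bochner_Integration.integral_indicator)
    qed
    finally show "(LINT x|cube V. ((\<Prod>v\<in>V. ?ind (\<phi> v) (x v)) * (\<Prod>e\<in>E. B (\<phi> (Min e)) (\<phi> (Max e))))) =
        (\<Prod>v\<in>V. ?\<beta> (\<phi> v)) * (\<Prod>e\<in>E. B (\<phi> (Min e)) (\<phi> (Max e)))"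
      by simp
  qed
  finally show ?thesis by (simp add: hom_sum_def)
qed

lemma sum_part_measures:
  fixes p :: "real \<Rightarrow> nat"
  assumes p: "p \<in> borel \<rightarrow>\<^sub>M count_space UNIV" "\<And>x. p x < r"
  shows "(\<Sum>i<r. measure unit_measure {x \<in> {0..1}. p x = i}) = 1"
proof -
  have meas: "{x \<in> {0..1}. p x = i} \<in> sets unit_measure" for i
  proof -
    have "{x \<in> space unit_measure. p x = i} \<in> sets unit_measure"
      using measurable_compose[OF unit_id p(1)] by measurable
    then show ?thesis by simp
  qed
  have "(\<Union>i<r. {x \<in> {0..1}. p x = i}) = {0..1}" using p(2) by auto
  moreover have "measure unit_measure (\<Union>i<r. {x \<in> {0..1}. p x = i}) =
      (\<Sum>i<r. measure unit_measure {x \<in> {0..1}. p x = i})"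
    by (intro unit.finite_measure_finite_Union[OF finite_lessThan]) (use meas in \<open>auto simp: disjoint_family_on_def\<close>)
  ultimately show ?thesis by (simp add: measure_unit_space)
qed

section \<open>Borel representatives and finite models of step graphons\<close>

lemma AE_unit_pair_if_AE_lborel:
  assumes "AE z in (lborel :: (real \<times> real) measure). P z"
  shows "AE z in unit_measure \<Otimes>\<^sub>M unit_measure. P z"
proof -
  obtain Z where Z: "Z \<in> null_sets (lborel :: (real \<times> real) measure)" "{z. \<not> P z} \<subseteq> Z"
    using assms by (auto simp: eventually_ae_filter)
  have "AE z in (lborel :: real measure) \<Otimes>\<^sub>M lborel. z \<notin> Z"
    unfolding lborel_prod using Z(1) by (rule AE_not_in)
  then have "AE x in lborel. AE y in lborel. (x, y) \<notin> Z"
    by (rule lborel_pair.AE_pair)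
  then have "AE x in unit_measure. AE y in unit_measure. (x, y) \<notin> Z"
    by (auto simp: AE_restrict_space_iff elim: eventually_mono)
  moreover have "{z \<in> space (unit_measure \<Otimes>\<^sub>M unit_measure). z \<notin> Z} \<in> sets (unit_measure \<Otimes>\<^sub>M unit_measure)"
  proof -
    have "Z \<in> sets borel" using Z(1) by (auto simp: null_sets_def)
    then have "(indicator Z :: _ \<Rightarrow> real) \<in> borel_measurable borel" by (rule borel_measurable_indicator)
    then have "(indicator Z :: _ \<Rightarrow> real) \<in> borel_measurable (unit_measure \<Otimes>\<^sub>M unit_measure)"
      by (rule measurable_pair_unit)
    then have "(indicator Z :: _ \<Rightarrow> real) -` {0} \<inter> space (unit_measure \<Otimes>\<^sub>M unit_measure) \<in> sets (unit_measure \<Otimes>\<^sub>M unit_measure)"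
      by (rule measurable_sets) auto
    also have "(indicator Z :: _ \<Rightarrow> real) -` {0} \<inter> space (unit_measure \<Otimes>\<^sub>M unit_measure) =
        {z \<in> space (unit_measure \<Otimes>\<^sub>M unit_measure). z \<notin> Z}"
      by (auto simp: indicator_def)
    finally show ?thesis .
  qed
  ultimately have "AE z in unit_measure \<Otimes>\<^sub>M unit_measure. z \<notin> Z"
    by (intro unit_pair.AE_pair_measure) auto
  then show ?thesis using Z(2) by (auto elim: eventually_mono)
qed

lemma borel_representative:
  assumes "graphon U"
  obtains k :: "real \<Rightarrow> real \<Rightarrow> real" where
    "(\<lambda>(x, y). k x y) \<in> borel_measurable borel" "\<And>x y. k x y = k y x"
    "\<And>x y. 0 \<le> k x y" "\<And>x y. k x y \<le> 1"
    "AE z in unit_measure \<Otimes>\<^sub>M unit_measure. U z = (\<lambda>(x, y). k x y) z"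
proof -
  let ?S = "{0..1} \<times> {0..1} :: (real \<times> real) set"
  have U: "U \<in> borel_measurable (lebesgue_on ?S)"
    and sym: "\<And>x y. x \<in> {0..1} \<Longrightarrow> y \<in> {0..1} \<Longrightarrow> U (x, y) = U (y, x)"
    and bnd: "\<And>p. p \<in> ?S \<Longrightarrow> U p \<in> {0..1}"
    using assms by (auto simp: graphon_def kernel_def)
  have S: "?S \<in> sets borel" by (intro borel_closed closed_Times) auto
  then have "?S \<in> sets lebesgue" by auto
  then have "(\<lambda>p. indicator ?S p *\<^sub>R U p) \<in> borel_measurable lebesgue"
    using U by (subst (asm) borel_measurable_restrict_space_iff) auto
  then obtain g where g: "g \<in> borel_measurable lborel"
      and ae: "AE p in lborel. indicator ?S p *\<^sub>R U p = g p"
    using completion_ex_borel_measurable_real by blast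
  have gb: "g \<in> borel_measurable borel" using g by simp
  \<comment> \<open>Averaging with the transpose and clipping make symmetry and bounds hold
    everywhere. \<open>U\<close> has both on the square, so \<open>k\<close> still agrees with it
    almost everywhere there.\<close>
  define k where "k x y = max 0 (min 1 ((g (x, y) + g (y, x)) / 2))" for x y
  have meas: "(\<lambda>(x, y). k x y) \<in> borel_measurable borel"
  proof -
    have "(\<lambda>z :: real \<times> real. (snd z, fst z)) \<in> borel \<Otimes>\<^sub>M borel \<rightarrow>\<^sub>M borel \<Otimes>\<^sub>M borel" by measurable
    then have "(\<lambda>z :: real \<times> real. (snd z, fst z)) \<in> borel \<rightarrow>\<^sub>M borel" by (simp add: borel_prod)
    from measurable_compose[OF this gb] have "(\<lambda>z. g (snd z, fst z)) \<in> borel_measurable borel" .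
    then have "(\<lambda>z. max 0 (min 1 ((g z + g (snd z, fst z)) / 2))) \<in> borel_measurable borel"
      using gb by measurable
    then show ?thesis by (simp add: k_def case_prod_beta')
  qed
  have ae1: "AE z in unit_measure \<Otimes>\<^sub>M unit_measure. indicator ?S z *\<^sub>R U z = g z"
    using ae by (rule AE_unit_pair_if_AE_lborel)
  have "AE z in lborel \<Otimes>\<^sub>M lborel. indicator ?S z *\<^sub>R U z = g z"
    unfolding lborel_prod by (rule ae)
  then have "AE z in distr (lborel \<Otimes>\<^sub>M lborel) (lborel \<Otimes>\<^sub>M lborel) (\<lambda>(x, y). (y, x)). indicator ?S z *\<^sub>R U z = g z"
    by (subst lborel_pair.distr_pair_swap[symmetric])
  from AE_distrD[OF measurable_pair_swap' this]
  have "AE z in lborel \<Otimes>\<^sub>M lborel. indicator ?S (snd z, fst z) *\<^sub>R U (snd z, fst z) = g (snd z, fst z)"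
    by (simp add: case_prod_beta)
  then have "AE z in (lborel :: (real \<times> real) measure). indicator ?S (snd z, fst z) *\<^sub>R U (snd z, fst z) = g (snd z, fst z)"
    unfolding lborel_prod .
  then have ae2: "AE z in unit_measure \<Otimes>\<^sub>M unit_measure. indicator ?S (snd z, fst z) *\<^sub>R U (snd z, fst z) = g (snd z, fst z)"
    by (rule AE_unit_pair_if_AE_lborel)
  have "AE z in unit_measure \<Otimes>\<^sub>M unit_measure. U z = (\<lambda>(x, y). k x y) z"
    using ae1 ae2 AE_space
  proof eventually_elim
    fix z assume z: "indicator ?S z *\<^sub>R U z = g z" "indicator ?S (snd z, fst z) *\<^sub>R U (snd z, fst z) = g (snd z, fst z)"
      "z \<in> space (unit_measure \<Otimes>\<^sub>M unit_measure)"
    obtain x y where xy: "z = (x, y)" by force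
    have xy': "x \<in> {0..1}" "y \<in> {0..1}" using z(3) xy by (auto simp: space_pair_measure)
    then have "g (x, y) = U (x, y)" "g (y, x) = U (x, y)"
      using z(1,2) sym[OF xy'] xy by (auto simp: indicator_def)
    moreover have "0 \<le> U (x, y)" "U (x, y) \<le> 1" using bnd[of "(x, y)"] xy' by auto
    ultimately show "U z = (\<lambda>(x, y). k x y) z" by (simp add: xy k_def)
  qed
  then show ?thesis
    using meas by (intro that[of k]) (auto simp: k_def add.commute)
qed

text \<open>Twin parts have equal rows and, by symmetry, equal columns, so their union can serve as
  one part. Against the minimality of \<open>q\<close> this yields distinct rows of the
  matrix.\<close>

lemma mergeable_parts:
  assumes part: "step_partition U q P" and sym: "\<And>x y. x \<in> {0..1} \<Longrightarrow> y \<in> {0..1} \<Longrightarrow> U (x, y) = U (y, x)"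
    and XY: "X \<in> P" "Y \<in> P" "X \<noteq> Y"
    and twins: "\<And>x y z. x \<in> X \<Longrightarrow> y \<in> Y \<Longrightarrow> z \<in> {0..1} \<Longrightarrow> U (x, z) = U (y, z)"
  shows "\<exists>P. step_partition U (q - 1) P"
proof -
  have P: "partition_on {0..1} P" "finite P" "card P = q"
    and meas: "\<And>A. A \<in> P \<Longrightarrow> A \<in> sets lebesgue \<and> emeasure lebesgue A > 0"
    and const: "\<And>A B. A \<in> P \<Longrightarrow> B \<in> P \<Longrightarrow> U constant_on A \<times> B"
    using part by (auto simp: step_partition_def)
  define P' where "P' = insert (X \<union> Y) (P - {X, Y})"
  have ne: "A \<noteq> {}" "A \<subseteq> {0..1}" if "A \<in> P" for A
    using P(1) that by (auto simp: partition_on_def)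
  have disj: "A \<inter> B = {}" if "A \<in> P" "B \<in> P" "A \<noteq> B" for A B
    using P(1) that by (auto simp: partition_on_def disjoint_def)
  have "X \<union> Y \<notin> P - {X, Y}"
    using disj[of "X \<union> Y" X] ne XY by auto
  moreover have "card (P - {X, Y}) = q - 2" "q \<ge> 2"
  proof -
    have "card {X, Y} = 2" "{X, Y} \<subseteq> P" using XY by auto
    then show "card (P - {X, Y}) = q - 2" "q \<ge> 2"
      using P card_mono[OF P(2), of "{X, Y}"] by (auto simp: card_Diff_subset)
  qed
  ultimately have card: "card P' = q - 1" using P(2) by (simp add: P'_def)
  have "partition_on {0..1} P'"
    using P(1) XY disj[OF XY] disj ne unfolding P'_def partition_on_def disjoint_def
    by (auto; blast)
  moreover have "A \<in> sets lebesgue \<and> emeasure lebesgue A > 0" if "A \<in> P'" for A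
  proof (cases "A = X \<union> Y")
    case True
    have "0 < emeasure lebesgue X" using meas XY by blast
    also have "emeasure lebesgue X \<le> emeasure lebesgue (X \<union> Y)" using meas XY by (intro emeasure_mono) auto
    finally show ?thesis using True meas XY by auto
  next
    case False
    then have "A \<in> P" using that by (simp add: P'_def)
    then show ?thesis by (rule meas)
  qed
  moreover have "U constant_on A \<times> B" if AB: "A \<in> P'" "B \<in> P'" for A B
  proof -
    have eq: "U (x, z) = U (x', z')" if "x \<in> S" "x' \<in> S" "z \<in> T" "z' \<in> T" "S \<in> P" "T \<in> P" for x x' z z' S T
      using const[OF that(5,6)] that(1-4) by (auto simp: constant_on_def)
    \<comment> \<open>Every new part contains an old part that already shows all its rows, which
      reduces constancy to the old parts.\<close>
    have rep: "\<exists>S\<in>P. S \<subseteq> A \<and> (\<forall>x\<in>A. \<exists>x'\<in>S. \<forall>z\<in>{0..1}. U (x, z) = U (x', z))" if "A \<in> P'" for A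
    proof (cases "A = X \<union> Y")
      case True
      obtain x0 where "x0 \<in> X" using ne(1)[OF XY(1)] by blast
      then have "\<forall>x\<in>A. \<exists>x'\<in>X. \<forall>z\<in>{0..1}. U (x, z) = U (x', z)"
        using True twins by (metis UnE)
      then show ?thesis using True XY by blast
    next
      case False
      then have "A \<in> P" using that by (auto simp: P'_def)
      then show ?thesis by blast
    qed
    obtain S where S: "S \<in> P" "S \<subseteq> A" "\<forall>x\<in>A. \<exists>x'\<in>S. \<forall>z\<in>{0..1}. U (x, z) = U (x', z)"
      using rep[OF AB(1)] by auto
    obtain T where T: "T \<in> P" "T \<subseteq> B" "\<forall>x\<in>B. \<exists>x'\<in>T. \<forall>z\<in>{0..1}. U (x, z) = U (x', z)"
      using rep[OF AB(2)] by auto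
    obtain s0 t0 where st: "s0 \<in> S" "t0 \<in> T" using ne(1)[OF S(1)] ne(1)[OF T(1)] by auto
    have sub: "A \<subseteq> {0..1}" "B \<subseteq> {0..1}" using AB ne XY by (auto simp: P'_def)
    have "U (x, y) = U (s0, t0)" if xy: "x \<in> A" "y \<in> B" for x y
    proof -
      obtain x' where x': "x' \<in> S" "\<forall>z\<in>{0..1}. U (x, z) = U (x', z)" using S(3) xy(1) by auto
      obtain y' where y': "y' \<in> T" "\<forall>z\<in>{0..1}. U (y, z) = U (y', z)" using T(3) xy(2) by auto
      have in01: "x \<in> {0..1}" "y \<in> {0..1}" "x' \<in> {0..1}" "y' \<in> {0..1}" 
        using xy x' y' sub S(2) T(2) by blast+
      have "U (x, y) = U (x', y)" using x' in01 by blast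
      also have "\<dots> = U (y, x')" using sym in01 by blast
      also have "\<dots> = U (y', x')" using y' in01 by blast
      also have "\<dots> = U (x', y')" using sym in01 by blast
      also have "\<dots> = U (s0, t0)" by (rule eq[OF x'(1) st(1) y'(1) st(2) S(1) T(1)])
      finally show ?thesis .
    qed
    then show ?thesis by (auto simp: constant_on_def)
  qed
  moreover have "finite P'" using P(2) by (simp add: P'_def)
  ultimately show ?thesis
    using card by (intro exI[of _ P']) (simp add: step_partition_def del: emeasure_completion)
qed

lemma step_graphon_model:
  assumes W: "step_graphon q W"
  obtains p :: "real \<Rightarrow> nat" and A :: "nat \<Rightarrow> nat \<Rightarrow> real" where
    "p \<in> borel \<rightarrow>\<^sub>M count_space UNIV" "\<And>x. p x < q"
    "AE (x, y) in unit_measure \<Otimes>\<^sub>M unit_measure. W (x, y) = A (p x) (p y)"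
    "\<And>i j. i < q \<Longrightarrow> j < q \<Longrightarrow> A i j = A j i"
    "\<And>i j. i < q \<Longrightarrow> j < q \<Longrightarrow> i \<noteq> j \<Longrightarrow> \<exists>k<q. A i k \<noteq> A j k"
    "\<And>i. i < q \<Longrightarrow> measure unit_measure {x \<in> {0..1}. p x = i} > 0"
proof -
  obtain P where part: "step_partition W q P" and no: "\<nexists>P. step_partition W (q - 1) P"
    and sym: "\<And>x y. x \<in> {0..1} \<Longrightarrow> y \<in> {0..1} \<Longrightarrow> W (x, y) = W (y, x)"
    using W by (auto simp: step_graphon_def step_kernel_def kernel_def)
  have P: "partition_on {0..1} P" "finite P" "card P = q"
    and meas: "\<And>A. A \<in> P \<Longrightarrow> A \<in> sets lebesgue \<and> emeasure lebesgue A > 0"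
    and const: "\<And>A B. A \<in> P \<Longrightarrow> B \<in> P \<Longrightarrow> W constant_on A \<times> B"
    using part by (auto simp: step_partition_def)
  obtain a where a: "bij_betw a {..<q} P"
    using ex_bij_betw_nat_finite[OF P(2)] P(3) by (auto simp: atLeast0LessThan)
  have aP: "a i \<in> P" if "i < q" for i using a that by (auto simp: bij_betw_def)
  have cover: "\<exists>i<q. x \<in> a i" if "x \<in> {0..1}" for x
  proof -
    have "x \<in> \<Union>P" using P(1) that by (simp add: partition_on_def)
    then obtain S where "S \<in> P" "x \<in> S" by blast
    then show ?thesis using a by (auto simp: bij_betw_def)
  qed
  have sub: "a i \<subseteq> {0..1}" "a i \<noteq> {}" if "i < q" for i
    using P(1) aP[OF that] by (auto simp: partition_on_def)
  have disj: "a i \<inter> a j = {}" if "i < q" "j < q" "i \<noteq> j" for i j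
  proof -
    have "a i \<noteq> a j" using a that by (auto simp: bij_betw_def inj_on_def)
    then show ?thesis using P(1) aP that by (auto simp: partition_on_def disjoint_def)
  qed
  define pt where "pt i = (SOME x. x \<in> a i)" for i
  have pt: "pt i \<in> a i" if "i < q" for i using sub(2)[OF that] by (simp add: pt_def some_in_eq)
  define A where "A i j = W (pt i, pt j)" for i j
  have WA: "W (x, y) = A i j" if "i < q" "j < q" "x \<in> a i" "y \<in> a j" for x y i j
    using const[OF aP aP, OF that(1,2)] pt that unfolding A_def constant_on_def by (metis mem_Sigma_iff)
  \<comment> \<open>The parts are only Lebesgue measurable; their Borel main parts lose a null set
    and make \<open>p\<close> Borel measurable.\<close>
  define b where "b i = main_part lborel (a i)" for i
  have ba: "b i \<subseteq> a i" "b i \<in> sets borel" "emeasure lborel (b i) > 0" if "i < q" for i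
  proof -
    have ai: "a i \<in> sets lebesgue" using meas aP that by auto
    then show "b i \<in> sets borel"
      using main_part_sets[of "a i" lborel] by (simp add: b_def)
    show "b i \<subseteq> a i"
      using main_part_null_part_Un[OF ai] unfolding b_def by blast
    show "emeasure lborel (b i) > 0"
      using meas[OF aP[OF that]] emeasure_completion[OF ai] unfolding b_def by metis
  qed
  \<comment> \<open>The sets \<open>b i\<close> are disjoint, so the sum picks out one index; the
    null set of points of the interval outside all of them goes to index 0.\<close>
  define p where "p x = (\<Sum>i<q. i * (if x \<in> b i then 1 else 0))" for x
  have p_eq: "p x = i" if "i < q" "x \<in> b i" for x i
  proof -
    have "p x = (\<Sum>j<q. if j = i then i else 0)"
      unfolding p_def
    proof (intro sum.cong refl)
      fix j assume "j \<in> {..<q}"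
      then show "j * (if x \<in> b j then 1 else 0) = (if j = i then i else 0)"
        using disj[of i j] ba(1)[of i] ba(1)[of j] that by auto
    qed
    then show ?thesis using that by simp
  qed
  have p_less: "p x < q" for x
  proof (cases "\<exists>i<q. x \<in> b i")
    case True then show ?thesis using p_eq by auto
  next
    case False
    then have "p x = 0" by (auto simp: p_def)
    then show ?thesis using cover[of 0] by auto
  qed
  have p_meas: "p \<in> borel \<rightarrow>\<^sub>M count_space UNIV"
    unfolding p_def[abs_def] using ba(2) by measurable
  have "AE x in lborel. x \<notin> null_part lborel (a i)" if "i < q" for i
    using meas aP that by (intro AE_notin_null_part) auto
  then have "AE x in lborel. \<forall>i\<in>{..<q}. x \<notin> null_part lborel (a i)"
    by (intro AE_finite_allI) auto
  then have "AE x in lborel. x \<in> {0..1} \<longrightarrow> (\<exists>i<q. x \<in> b i)"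
  proof eventually_elim
    case (elim x)
    show ?case
    proof
      assume "x \<in> {0..1}"
      then obtain i where i: "i < q" "x \<in> a i" using cover by blast
      then have "x \<in> b i"
        using elim main_part_null_part_Un[of "a i" lborel] meas[OF aP] unfolding b_def by blast
      then show "\<exists>i<q. x \<in> b i" using i by blast
    qed
  qed
  then have ae: "AE x in unit_measure. \<exists>i<q. x \<in> b i"
    by (simp add: AE_restrict_space_iff)
  define Q where "Q x \<longleftrightarrow> (\<exists>i<q. x \<in> b i)" for x
  have "{x. Q x} = (\<Union>i\<in>{..<q}. b i)" by (auto simp: Q_def)
  also have "\<dots> \<in> sets borel" using ba(2) by (intro sets.finite_UN) auto
  finally have "Measurable.pred borel Q" by (simp add: pred_def)
  then have Q: "Measurable.pred unit_measure Q" by (rule measurable_compose[OF unit_id])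
  have "AE z in unit_measure \<Otimes>\<^sub>M unit_measure. Q (fst z) \<and> Q (snd z)"
  proof (rule unit_pair.AE_pair_measure)
    show "{z \<in> space (unit_measure \<Otimes>\<^sub>M unit_measure). Q (fst z) \<and> Q (snd z)}
        \<in> sets (unit_measure \<Otimes>\<^sub>M unit_measure)"
      using measurable_compose[OF measurable_fst Q, of unit_measure]
        measurable_compose[OF measurable_snd Q, of unit_measure]
      unfolding pred_def[symmetric] by (rule pred_intros_logic)
    have ae': "AE x in unit_measure. Q x" using ae by (simp add: Q_def)
    show "AE x in unit_measure. AE y in unit_measure. Q (fst (x, y)) \<and> Q (snd (x, y))"
      using ae' by eventually_elim (use ae' in simp)
  qed
  then have W_eq: "AE (x, y) in unit_measure \<Otimes>\<^sub>M unit_measure. W (x, y) = A (p x) (p y)"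
  proof eventually_elim
    case (elim z)
    then obtain i j where ij: "i < q" "fst z \<in> b i" "j < q" "snd z \<in> b j" by (auto simp: Q_def)
    then have "W (fst z, snd z) = A i j" using ba(1) by (intro WA) auto
    then show ?case using ij p_eq by (simp add: case_prod_beta)
  qed
  show ?thesis
  proof (rule that[OF p_meas p_less W_eq])
    show "A i j = A j i" if "i < q" "j < q" for i j
      using sym[of "pt i" "pt j"] pt[OF that(1)] pt[OF that(2)] sub that unfolding A_def by blast
    show "\<exists>k<q. A i k \<noteq> A j k" if "i < q" "j < q" "i \<noteq> j" for i j
    proof (rule ccontr)
      assume eq: "\<not> (\<exists>k<q. A i k \<noteq> A j k)"
      have "\<exists>P. step_partition W (q - 1) P"
      proof (rule mergeable_parts[OF part sym aP[OF that(1)] aP[OF that(2)]])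
        show "a i \<noteq> a j" using disj[OF that] sub(2)[OF that(1)] by auto
        show "W (x, z) = W (y, z)" if xyz: "x \<in> a i" "y \<in> a j" "z \<in> {0..1}" for x y z
        proof -
          obtain k where "k < q" "z \<in> a k" using cover[OF xyz(3)] by blast
          then show ?thesis using WA[of i k x z] WA[of j k y z] xyz eq \<open>i < q\<close> \<open>j < q\<close> by simp
        qed
      qed
      then show False using no by blast
    qed
    show "measure unit_measure {x \<in> {0..1}. p x = i} > 0" if "i < q" for i
    proof -
      have b01: "b i \<subseteq> {0..1}" using ba(1) sub(1) that by blast
      have "emeasure unit_measure (b i) > 0"
        using ba(3)[OF that] b01 by (simp add: emeasure_restrict_space)
      then have "measure unit_measure (b i) > 0"
        by (simp add: unit.emeasure_eq_measure)
      also have "measure unit_measure (b i) \<le> measure unit_measure {x \<in> {0..1}. p x = i}"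
      proof (rule unit.finite_measure_mono)
        show "b i \<subseteq> {x \<in> {0..1}. p x = i}" using b01 p_eq that by auto
        have "{x \<in> space unit_measure. p x = i} \<in> sets unit_measure"
          using measurable_compose[OF unit_id p_meas] by measurable
        then show "{x \<in> {0..1}. p x = i} \<in> sets unit_measure" by simp
      qed
      finally show ?thesis .
    qed
  qed
qed

section \<open>Graphons with few codegree classes\<close>

lemma abs_integral_unit_le:
  assumes "\<And>x. \<bar>f x\<bar> \<le> (C::real)"
  shows "\<bar>LINT x|unit_measure. f x\<bar> \<le> C"
proof (cases "integrable unit_measure f")
  case True
  have "\<bar>LINT x|unit_measure. f x\<bar> \<le> (LINT x|unit_measure. \<bar>f x\<bar>)" by (rule integral_abs_bound)
  also have "\<dots> \<le> (LINT x|unit_measure. C)"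
    using True assms by (intro integral_mono integrable_abs) auto
  also have "\<dots> = C" by (simp add: measure_unit_space)
  finally show ?thesis .
next
  case False
  have "0 \<le> C" using assms[of 0] by linarith
  then show ?thesis using False by (simp add: not_integrable_integral_eq)
qed

lemma integrable_unit_bounded:
  assumes "f \<in> borel_measurable unit_measure" "\<And>x. \<bar>f x\<bar> \<le> (C::real)"
  shows "integrable unit_measure f"
  using assms by (intro unit.integrable_const_bound[where B = C]) auto

lemma integrable_cube_bounded:
  assumes "finite V" "f \<in> borel_measurable (cube V)" "\<And>x. \<bar>f x\<bar> \<le> (C::real)"
  shows "integrable (cube V) f"
  using assms by (intro finite_measure.integrable_const_bound[OF finite_measure_cube, where B = C]) auto

lemma measurable_cube_insert:
  assumes "f \<in> borel_measurable (cube (insert i V))"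
  shows "(\<lambda>x. LINT y|unit_measure. f (x(i := y)) :: real) \<in> borel_measurable (cube V)"
proof (rule unit.borel_measurable_lebesgue_integral)
  show "(\<lambda>(x, y). f (x(i := y))) \<in> borel_measurable (cube V \<Otimes>\<^sub>M unit_measure)"
    using measurable_compose[OF measurable_add_dim assms] by (simp add: case_prod_beta')
qed

lemma integral_cube_insert:
  assumes "finite V" "i \<notin> V" "f \<in> borel_measurable (cube (insert i V))" "\<And>x. \<bar>f x\<bar> \<le> (C::real)"
  shows "(LINT x|cube (insert i V). f x) = (LINT x|cube V. (LINT y|unit_measure. f (x(i := y))))"
  using assms by (intro unit_prod.product_integral_insert integrable_cube_bounded) auto

lemma integral_cube_insert3:
  assumes "finite V" "a \<notin> V" "b \<notin> V" "c \<notin> V" "a \<noteq> b" "a \<noteq> c" "b \<noteq> c"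
    and f: "f \<in> borel_measurable (cube (insert c (insert b (insert a V))))" "\<And>x. \<bar>f x\<bar> \<le> (C::real)"
  shows "(LINT x|cube (insert c (insert b (insert a V))). f x) =
    (LINT x|cube V. (LINT u|unit_measure. (LINT z|unit_measure. (LINT z'|unit_measure. f (x(a := u, b := z, c := z'))))))"
proof -
  note m1 = measurable_cube_insert[OF f(1)]
  note m2 = measurable_cube_insert[OF m1]
  have b1: "\<bar>LINT y|unit_measure. f (x(c := y))\<bar> \<le> C" for x
    using f(2) by (intro abs_integral_unit_le) auto
  have b2: "\<bar>LINT z|unit_measure. (LINT y|unit_measure. f (x(b := z, c := y)))\<bar> \<le> C" for x
    by (rule abs_integral_unit_le, rule b1)
  show ?thesis
    using assms
    by (simp add: integral_cube_insert[OF _ _ f] integral_cube_insert[OF _ _ m1 b1] integral_cube_insert[OF _ _ m2 b2])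
qed

section \<open>Codegrees and their distances as integrals over simple graphs\<close>

locale unit_kernel =
  fixes k :: "real \<Rightarrow> real \<Rightarrow> real"
  assumes k_measurable: "(\<lambda>(x, y). k x y) \<in> borel_measurable borel"
    and k_sym: "\<And>x y. k x y = k y x"
    and k_nonneg: "\<And>x y. 0 \<le> k x y" and k_le_1: "\<And>x y. k x y \<le> 1"
begin

lemma k_meas [measurable (raw)]:
  assumes "f \<in> borel_measurable M" "g \<in> borel_measurable M"
  shows "(\<lambda>x. k (f x) (g x)) \<in> borel_measurable M"
  using measurable_compose[OF borel_measurable_Pair[OF assms] k_measurable] by simp

lemma abs_k_le_1: "\<bar>k x y\<bar> \<le> 1" and abs_k_diff_le_1: "\<bar>k x y - k x' y'\<bar> \<le> 1"
  using k_nonneg[of x y] k_le_1[of x y] k_nonneg[of x' y'] k_le_1[of x' y'] by linarith+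

text \<open>The kernel of the square of the integral operator \<open>T\<close>, as
  \<open>T_T\<close> shows.\<close>

definition codeg where "codeg x y = (LINT z|unit_measure. k x z * k z y)"

lemma codeg_meas [measurable (raw)]:
  assumes [measurable]: "f \<in> borel_measurable M" "g \<in> borel_measurable M"
  shows "(\<lambda>x. codeg (f x) (g x)) \<in> borel_measurable M"
  unfolding codeg_def by (rule unit.borel_measurable_lebesgue_integral) measurable

lemma codeg_bounds: "0 \<le> codeg x y" "codeg x y \<le> 1"
proof -
  show "0 \<le> codeg x y" unfolding codeg_def using k_nonneg by (intro Bochner_Integration.integral_nonneg) auto
  have "\<bar>codeg x y\<bar> \<le> 1"
    unfolding codeg_def using abs_k_le_1
    by (intro abs_integral_unit_le) (simp add: abs_mult mult_le_one)
  then show "codeg x y \<le> 1" by simp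
qed

lemma codeg_diff: "codeg u x - codeg u y = (LINT z|unit_measure. k u z * (k z x - k z y))"
proof -
  have "integrable unit_measure (\<lambda>z. k u z * k z x)" for x
    using abs_k_le_1 by (intro integrable_unit_bounded[where C = 1]) (auto simp: abs_mult mult_le_one)
  then show ?thesis by (simp add: codeg_def right_diff_distrib)
qed

definition D where "D x y = (LINT u|unit_measure. (codeg u x - codeg u y)\<^sup>2)"

lemma D_meas [measurable (raw)]:
  assumes [measurable]: "f \<in> borel_measurable M" "g \<in> borel_measurable M"
  shows "(\<lambda>x. D (f x) (g x)) \<in> borel_measurable M"
  unfolding D_def by (rule unit.borel_measurable_lebesgue_integral) measurable

lemma sq_codeg_diff_le: "\<bar>(codeg u x - codeg u y)\<^sup>2\<bar> \<le> 1"
proof -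
  have "\<bar>codeg u x - codeg u y\<bar> \<le> 1" using codeg_bounds[of u x] codeg_bounds[of u y] by linarith
  then show ?thesis by (simp add: abs_square_le_1)
qed

lemma D_nonneg: "0 \<le> D x y"
  unfolding D_def by (intro Bochner_Integration.integral_nonneg) auto

lemma abs_D_le_1: "\<bar>D x y\<bar> \<le> 1"
  unfolding D_def by (intro abs_integral_unit_le sq_codeg_diff_le)

lemma D_eq_0: "D x y = 0 \<Longrightarrow> AE u in unit_measure. codeg u x = codeg u y"
proof -
  assume "D x y = 0"
  moreover have "integrable unit_measure (\<lambda>u. (codeg u x - codeg u y)\<^sup>2)"
    using sq_codeg_diff_le by (intro integrable_unit_bounded[where C = 1]) auto
  ultimately have "AE u in unit_measure. (codeg u x - codeg u y)\<^sup>2 = 0"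
    unfolding D_def by (subst (asm) integral_nonneg_eq_0_iff_AE) auto
  then show ?thesis by eventually_elim simp
qed

text \<open>
  Squares of \<open>k\<close> would need multiple edges, so points are compared through codegrees; expanding the
  square in \<open>D\<close> then takes three new vertices and only simple edges.
\<close>

definition twin_gadget where "twin_gadget u z z' x y = k u z * (k z x - k z y) * (k u z' * (k z' x - k z' y))"

lemma abs_twin_gadget_le_1: "\<bar>twin_gadget u z z' x y\<bar> \<le> 1"
  unfolding twin_gadget_def abs_mult
  by (intro mult_le_one mult_nonneg_nonneg abs_k_le_1 abs_k_diff_le_1 abs_ge_zero)

lemma twin_gadget_integral:
  "(LINT u|unit_measure. (LINT z|unit_measure. (LINT z'|unit_measure. twin_gadget u z z' x y))) = D x y"
  by (simp add: twin_gadget_def codeg_diff[symmetric] D_def power2_eq_square)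

lemma abs_prod_le_1: "(\<And>i. i \<in> I \<Longrightarrow> \<bar>f i\<bar> \<le> (1::real)) \<Longrightarrow> \<bar>prod f I\<bar> \<le> 1"
  by (simp add: abs_prod prod_le_1)

text \<open>For \<open>n = K\<close> the integrand is a polynomial in edge values, for
  \<open>n = 0\<close> a product of values of \<open>D\<close>. The three new coordinates of a
  gadget occur in no other factor, so each induction step integrates out one gadget.\<close>

lemma integrate_out_gadgets:
  fixes R :: nat and pr :: "nat \<Rightarrow> nat \<times> nat"
  assumes pr: "\<And>m. m < K \<Longrightarrow> fst (pr m) < R \<and> snd (pr m) < R" and n: "n \<le> K"
  shows "(LINT x|cube {..<R + 3 * n}.
      ((\<Prod>m<n. twin_gadget (x (R + 3 * m)) (x (R + 3 * m + 1)) (x (R + 3 * m + 2)) (x (fst (pr m))) (x (snd (pr m)))) *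
       (\<Prod>m\<in>{n..<K}. D (x (fst (pr m))) (x (snd (pr m)))))) =
    (LINT x|cube {..<R}. (\<Prod>m<K. D (x (fst (pr m))) (x (snd (pr m)))))"
  using n
proof (induction n)
  case 0
  then show ?case by (simp add: atLeast0LessThan)
next
  case (Suc n)
  let ?G = "\<lambda>m x. twin_gadget (x (R + 3 * m)) (x (R + 3 * m + 1)) (x (R + 3 * m + 2)) (x (fst (pr m))) (x (snd (pr m)))"
  let ?D = "\<lambda>m x. D (x (fst (pr m))) (x (snd (pr m)))"
  let ?a = "R + 3 * n"
  let ?f = "\<lambda>x. (\<Prod>m<Suc n. ?G m x) * (\<Prod>m\<in>{Suc n..<K}. ?D m x)"
  have V: "{..<R + 3 * Suc n} = insert (?a + 2) (insert (?a + 1) (insert ?a {..<R + 3 * n}))" by auto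
  have bound: "\<bar>?f x\<bar> \<le> 1" for x
    unfolding abs_mult by (intro mult_le_one abs_prod_le_1 abs_twin_gadget_le_1 abs_D_le_1 abs_ge_zero)
  have prV: "fst (pr m) \<in> {..<R + 3 * Suc n}" "snd (pr m) \<in> {..<R + 3 * Suc n}"
    if "m \<in> {..<Suc n} \<or> m \<in> {Suc n..<K}" for m
    using pr[of m] that Suc.prems by auto
  have meas: "?f \<in> borel_measurable (cube {..<R + 3 * Suc n})"
    unfolding twin_gadget_def
    by (intro borel_measurable_times borel_measurable_prod borel_measurable_diff k_meas D_meas cube_coordinate prV)
      auto
  have upd: "?f (x(?a := u, ?a + 1 := z, ?a + 2 := z')) =
      (\<Prod>m<n. ?G m x) * (\<Prod>m\<in>{Suc n..<K}. ?D m x) * twin_gadget u z z' (x (fst (pr n))) (x (snd (pr n)))" for x u z z'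
  proof -
    let ?x = "x(?a := u, ?a + 1 := z, ?a + 2 := z')"
    have lt: "?x i = x i" if "i < ?a" for i using that by simp
    have prl: "fst (pr m) < ?a" "snd (pr m) < ?a" if "m < K" for m using pr[OF that] by auto
    have "(\<Prod>m<n. ?G m ?x) = (\<Prod>m<n. ?G m x)"
    proof (intro prod.cong refl)
      fix m assume "m \<in> {..<n}"
      then have "m < K" "R + 3 * m < ?a" "R + 3 * m + 1 < ?a" "R + 3 * m + 2 < ?a" using Suc.prems by auto
      then show "?G m ?x = ?G m x" using prl[of m] by (simp only: lt)
    qed
    moreover have "(\<Prod>m\<in>{Suc n..<K}. ?D m ?x) = (\<Prod>m\<in>{Suc n..<K}. ?D m x)"
      by (intro prod.cong refl) (simp only: lt prl atLeastLessThan_iff)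
    moreover have "?G n ?x = twin_gadget u z z' (x (fst (pr n))) (x (snd (pr n)))"
      using lt[OF prl(1)[of n]] lt[OF prl(2)[of n]] Suc.prems by simp
    ultimately show ?thesis unfolding prod.lessThan_Suc by (simp only: mult_ac)
  qed
  have "(LINT x|cube {..<R + 3 * Suc n}. ?f x) = (LINT x|cube {..<R + 3 * n}.
      (LINT u|unit_measure. (LINT z|unit_measure. (LINT z'|unit_measure. ?f (x(?a := u, ?a + 1 := z, ?a + 2 := z'))))))"
    unfolding V using meas bound unfolding V by (intro integral_cube_insert3) auto
  also have "\<dots> = (LINT x|cube {..<R + 3 * n}. (\<Prod>m<n. ?G m x) * (\<Prod>m\<in>{Suc n..<K}. ?D m x) * ?D n x)"
    unfolding upd by (simp add: twin_gadget_integral)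
  also have "\<dots> = (LINT x|cube {..<R + 3 * n}. (\<Prod>m<n. ?G m x) * (\<Prod>m\<in>{n..<K}. ?D m x))"
    using Suc.prems by (simp add: prod.atLeast_Suc_lessThan mult_ac)
  also have "\<dots> = (LINT x|cube {..<R}. (\<Prod>m<K. ?D m x))"
    using Suc by simp
  finally show ?case .
qed

end

context unit_kernel
begin

text \<open>The counterpart of \<open>multi_affine_sum_eq\<close> while one side is not yet known to
  be a step function: an integral is compared with a finite sum, monomial by monomial.\<close>

lemma integral_multi_affine:
  assumes AE: "AE z in unit_measure \<Otimes>\<^sub>M unit_measure. U z = (\<lambda>(x, y). k x y) z"
    and G: "simple_graph V E" and F: "multi_affine E F"
    and dens: "\<And>S. S \<subseteq> E \<Longrightarrow> hom_density V S U = hom_sum q \<alpha> A V S"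
  shows "(LINT x|cube V. F (\<lambda>e. k (x (Min e)) (x (Max e)))) =
    (\<Sum>\<phi>\<in>V \<rightarrow>\<^sub>E {..<q}. (\<Prod>v\<in>V. \<alpha> (\<phi> v)) * F (\<lambda>e. A (\<phi> (Min e)) (\<phi> (Max e))))"
proof -
  obtain c where c: "\<And>t. F t = (\<Sum>S\<in>Pow E. c S * (\<Prod>e\<in>S. t e))"
    using F by (auto simp: multi_affine_def)
  note fin = simple_graph_finite[OF G]
  have int: "integrable (cube V) (\<lambda>x. \<Prod>e\<in>S. k (x (Min e)) (x (Max e)))" if "S \<subseteq> E" for S
  proof (rule integrable_cube_bounded[OF fin(1)])
    have "Min e \<in> V" "Max e \<in> V" if "e \<in> S" for e
      using simple_graph_edge[OF G] that \<open>S \<subseteq> E\<close> by auto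
    then show "(\<lambda>x. \<Prod>e\<in>S. k (x (Min e)) (x (Max e))) \<in> borel_measurable (cube V)"
      by (intro borel_measurable_prod k_meas cube_coordinate)
    show "\<bar>\<Prod>e\<in>S. k (x (Min e)) (x (Max e))\<bar> \<le> 1" for x
      by (intro abs_prod_le_1 abs_k_le_1)
  qed
  have "(LINT x|cube V. F (\<lambda>e. k (x (Min e)) (x (Max e)))) =
      (\<Sum>S\<in>Pow E. c S * (LINT x|cube V. (\<Prod>e\<in>S. k (x (Min e)) (x (Max e)))))"
    unfolding c using int by (subst Bochner_Integration.integral_sum) auto
  also have "\<dots> = (\<Sum>S\<in>Pow E. c S * hom_sum q \<alpha> A V S)"
  proof (intro sum.cong refl)
    fix S assume S: "S \<in> Pow E"
    then have "simple_graph V S" using G by (auto simp: simple_graph_def)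
    from hom_density_eq_integral[OF k_measurable AE this]
    show "c S * (LINT x|cube V. (\<Prod>e\<in>S. k (x (Min e)) (x (Max e)))) = c S * hom_sum q \<alpha> A V S"
      using dens S by simp
  qed
  also have "\<dots> = (\<Sum>\<phi>\<in>V \<rightarrow>\<^sub>E {..<q}. (\<Prod>v\<in>V. \<alpha> (\<phi> v)) * F (\<lambda>e. A (\<phi> (Min e)) (\<phi> (Max e))))"
    unfolding c hom_sum_def sum_distrib_left by (subst sum.swap) (simp add: mult_ac)
  finally show ?thesis .
qed

text \<open>Besides the \<open>q + 1\<close> points, each of their \<open>q * (q + 1) div 2\<close>
  pairs takes three vertices. From \<open>q = 2\<close> on, this total is within
  \<open>4 * q\<^sup>2 - q\<close>.\<close>

lemma AE_D_eq_0:
  assumes AE: "AE z in unit_measure \<Otimes>\<^sub>M unit_measure. U z = (\<lambda>(x, y). k x y) z"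
    and q: "q \<ge> 2"
    and symA: "\<And>i j. i < q \<Longrightarrow> j < q \<Longrightarrow> A i j = A j i"
    and dens: "\<And>V E. simple_graph V E \<Longrightarrow> card V \<le> 4 * q\<^sup>2 - q \<Longrightarrow> hom_density V E U = hom_sum q \<alpha> A V E"
  shows "AE x in cube {..<Suc q}. \<exists>i j. i < j \<and> j < Suc q \<and> D (x i) (x j) = 0"
proof -
  let ?R = "Suc q" and ?T = "{(i, j). i < j \<and> j < Suc q}"
  define K where "K = card ?T"
  have finT: "finite ?T" by (rule finite_subset[of _ "{..<Suc q} \<times> {..<Suc q}"]) auto
  obtain pr where pr: "bij_betw pr {..<K} ?T"
    using ex_bij_betw_nat_finite[OF finT] by (auto simp: K_def atLeast0LessThan)
  have prT: "fst (pr m) < snd (pr m)" "snd (pr m) < ?R" if "m < K" for m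
    using bij_betw_apply[OF pr, of m] that by (auto simp: case_prod_beta)
  define V where "V = {..<?R + 3 * K}"
  define a where "a m = ?R + 3 * m" for m
  define Em where "Em m = {{a m, a m + 1}} \<union> {{a m + 1, fst (pr m)}, {a m + 1, snd (pr m)}} \<union>
      ({{a m, a m + 2}} \<union> {{a m + 2, fst (pr m)}, {a m + 2, snd (pr m)}})" for m
  define Gt where "Gt m t = t {a m, a m + 1} * (t {a m + 1, fst (pr m)} - t {a m + 1, snd (pr m)}) *
      (t {a m, a m + 2} * (t {a m + 2, fst (pr m)} - t {a m + 2, snd (pr m)}))" for m and t :: "nat set \<Rightarrow> real"
  let ?E = "\<Union>m<K. Em m"
  have "multi_affine (Em m) (Gt m)" if "m < K" for m
  proof -
    have lt: "fst (pr m) < a m" "snd (pr m) < a m" using prT[OF that] by (auto simp: a_def)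
    then show ?thesis
      unfolding Em_def Gt_def
      by (intro multi_affine_mult multi_affine_var multi_affine_var_minus_var)
        (auto simp: doubleton_eq_iff)
  qed
  moreover have "disjoint_family_on Em {..<K}"
  proof -
    \<comment> \<open>The larger endpoint of an edge of gadget \<open>m\<close> is
      \<open>a m + 1\<close> or \<open>a m + 2\<close>, so the edge determines
      \<open>m\<close>.\<close>
    have "(Max e - ?R) div 3 = m" if "m < K" "e \<in> Em m" for e m
      using that(2) prT[OF that(1)] unfolding Em_def a_def by (auto simp: max_def)
    then show ?thesis unfolding disjoint_family_on_def by (metis disjoint_iff lessThan_iff)
  qed
  ultimately have F: "multi_affine ?E (\<lambda>t. \<Prod>m<K. Gt m t)"
    by (intro multi_affine_prod) auto
  have "e \<subseteq> V \<and> card e = 2" if "m < K" "e \<in> Em m" for m e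
    using that prT[OF that(1)] unfolding Em_def a_def V_def by auto
  then have G: "simple_graph V ?E" by (auto simp: simple_graph_def V_def)
  have "2 * K + (q + 1) \<le> (q + 1) * (q + 1)"
    using card_less_pairs[of "Suc q"] by (simp add: K_def)
  moreover have "(q + 1) * (q + 1) = q * q + 2 * q + 1" by (simp add: algebra_simps)
  moreover have "q * q \<ge> 2 * q" using q by simp
  moreover have "card V = q + 1 + 3 * K" by (simp add: V_def)
  ultimately have card: "card V \<le> 4 * q\<^sup>2 - q"
    using q unfolding power2_eq_square by linarith
  have "(LINT x|cube V. (\<Prod>m<K. Gt m (\<lambda>e. k (x (Min e)) (x (Max e))))) =
    (\<Sum>\<phi>\<in>V \<rightarrow>\<^sub>E {..<q}. (\<Prod>v\<in>V. \<alpha> (\<phi> v)) * (\<Prod>m<K. Gt m (\<lambda>e. A (\<phi> (Min e)) (\<phi> (Max e)))))"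
  proof (rule integral_multi_affine[OF AE G F])
    fix S assume "S \<subseteq> ?E"
    then have "simple_graph V S" using G unfolding simple_graph_def by blast
    then show "hom_density V S U = hom_sum q \<alpha> A V S" using dens card by blast
  qed
  also have "\<dots> = 0"
  proof (intro sum.neutral ballI)
    fix \<phi> assume \<phi>: "\<phi> \<in> V \<rightarrow>\<^sub>E {..<q}"
    have \<phi>q: "\<phi> v < q" if "v \<in> V" for v using \<phi> that by auto
    have "\<not> inj_on \<phi> {..<?R}"
    proof
      assume "inj_on \<phi> {..<?R}"
      moreover have "\<phi> ` {..<?R} \<subseteq> {..<q}" using \<phi>q by (auto simp: V_def)
      ultimately have "card {..<?R} \<le> card {..<q}" by (intro card_inj_on_le) auto
      then show False by simp
    qed
    then obtain i j where ij: "i < j" "j < ?R" "\<phi> i = \<phi> j"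
      unfolding inj_on_def by (metis lessThan_iff linorder_neqE_nat)
    then have "(i, j) \<in> pr ` {..<K}" using pr by (simp add: bij_betw_def)
    then obtain m where m: "m < K" "pr m = (i, j)" by auto
    \<comment> \<open>Applied to \<open>b = a m + 1\<close>, this annihilates the first difference
      in the gadget of the colliding pair.\<close>
    have "A (\<phi> (Min {b, i})) (\<phi> (Max {b, i})) = A (\<phi> (Min {b, j})) (\<phi> (Max {b, j}))" if "b \<in> V" for b
    proof -
      have "i \<in> V" "j \<in> V" using ij by (auto simp: V_def)
      then have "\<phi> i < q" "\<phi> j < q" "\<phi> b < q" using \<phi>q that by auto
      then show ?thesis using ij(3) symA[of "\<phi> b" "\<phi> j"] by (simp add: min_def max_def)
    qed
    moreover have "a m + 1 \<in> V" using m by (auto simp: a_def V_def)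
    ultimately have "Gt m (\<lambda>e. A (\<phi> (Min e)) (\<phi> (Max e))) = 0" using m by (simp add: Gt_def)
    then have "(\<Prod>m<K. Gt m (\<lambda>e. A (\<phi> (Min e)) (\<phi> (Max e)))) = 0" using m by (auto intro!: prod_zero)
    then show "(\<Prod>v\<in>V. \<alpha> (\<phi> v)) * (\<Prod>m<K. Gt m (\<lambda>e. A (\<phi> (Min e)) (\<phi> (Max e)))) = 0" by simp
  qed
  also have "(LINT x|cube V. (\<Prod>m<K. Gt m (\<lambda>e. k (x (Min e)) (x (Max e))))) =
      (LINT x|cube {..<?R}. (\<Prod>m<K. D (x (fst (pr m))) (x (snd (pr m)))))"
  proof -
    have kk: "k (x (Min {u, v})) (x (Max {u, v})) = k (x u) (x v)" for x :: "nat \<Rightarrow> real" and u v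
      using k_sym by (simp add: min_def max_def)
    have "Gt m (\<lambda>e. k (x (Min e)) (x (Max e))) =
        twin_gadget (x (?R + 3 * m)) (x (?R + 3 * m + 1)) (x (?R + 3 * m + 2)) (x (fst (pr m))) (x (snd (pr m)))" for x m
      unfolding Gt_def kk twin_gadget_def a_def by simp
    then show ?thesis
      using integrate_out_gadgets[of K pr ?R K] prT unfolding V_def by (force dest: less_trans)
  qed
  finally have int0: "(LINT x|cube {..<?R}. (\<Prod>m<K. D (x (fst (pr m))) (x (snd (pr m))))) = 0" .
  have mem: "fst (pr m) \<in> {..<?R}" "snd (pr m) \<in> {..<?R}" if "m \<in> {..<K}" for m
    using prT[of m] that by auto
  have "integrable (cube {..<?R}) (\<lambda>x. \<Prod>m<K. D (x (fst (pr m))) (x (snd (pr m))))"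
    by (rule integrable_cube_bounded[where C = 1])
      (auto intro!: borel_measurable_prod D_meas cube_coordinate mem abs_prod_le_1 abs_D_le_1)
  then have "AE x in cube {..<?R}. (\<Prod>m<K. D (x (fst (pr m))) (x (snd (pr m)))) = 0"
    using int0 by (subst (asm) integral_nonneg_eq_0_iff_AE) (auto intro!: AE_I2 prod_nonneg D_nonneg)
  then show ?thesis
  proof eventually_elim
    case (elim x)
    then obtain m where "m < K" "D (x (fst (pr m))) (x (snd (pr m))) = 0" by auto
    then show ?case using prT[of m] by blast
  qed
qed

section \<open>Finitely many representatives of the codegree functions\<close>

lemma AE_cube_insert:
  assumes V: "finite V" "i \<notin> V" and P: "Measurable.pred (cube (insert i V)) P"
    and AE: "AE x in cube (insert i V). P x"
  shows "AE x in cube V. AE y in unit_measure. P (x(i := y))"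
proof -
  let ?f = "\<lambda>x. indicator {x \<in> space (cube (insert i V)). \<not> P x} x :: ennreal"
  have S: "{x \<in> space (cube (insert i V)). \<not> P x} \<in> sets (cube (insert i V))" using P by measurable
  then have f: "?f \<in> borel_measurable (cube (insert i V))" by simp
  have f2: "(\<lambda>(x, y). ?f (x(i := y))) \<in> borel_measurable (cube V \<Otimes>\<^sub>M unit_measure)"
    using measurable_compose[OF measurable_add_dim f] by (simp add: case_prod_beta')
  have "(\<integral>\<^sup>+x. (\<integral>\<^sup>+y. ?f (x(i := y)) \<partial>unit_measure) \<partial>cube V) = (\<integral>\<^sup>+x. ?f x \<partial>cube (insert i V))"
    by (rule unit_prod.product_nn_integral_insert[symmetric]) (use V f in auto)
  also have "\<dots> = (\<integral>\<^sup>+x. 0 \<partial>cube (insert i V))"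
    using AE by (intro nn_integral_cong_AE) (auto simp: indicator_def elim: eventually_mono)
  finally have "(\<integral>\<^sup>+x. (\<integral>\<^sup>+y. ?f (x(i := y)) \<partial>unit_measure) \<partial>cube V) = 0" by simp
  then have "AE x in cube V. (\<integral>\<^sup>+y. ?f (x(i := y)) \<partial>unit_measure) = 0"
    by (subst (asm) nn_integral_0_iff_AE) (auto intro!: unit.borel_measurable_nn_integral f2)
  then show ?thesis
    using AE_space
  proof eventually_elim
    case (elim x)
    have xy: "x(i := y) \<in> space (cube (insert i V))" if "y \<in> {0..1}" for y
      using elim(2) that by (auto simp: space_PiM PiE_iff extensional_def)
    have "(\<lambda>y. ?f (x(i := y))) \<in> borel_measurable unit_measure"
      using measurable_Pair2[OF f2 elim(2)] by simp
    with elim(1) have "AE y in unit_measure. ?f (x(i := y)) = 0"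
      by (subst (asm) nn_integral_0_iff_AE) auto
    then show ?case
      using AE_space by eventually_elim (use xy in \<open>auto simp: indicator_def split: if_splits\<close>)
  qed
qed

text \<open>Let \<open>r + 1\<close> be the least length for which almost every tuple contains two
  points at distance 0. By minimality some tuple of length \<open>r\<close> has no such pair
  although almost every further point creates one, so almost every point is at distance 0 from a
  member of that tuple.\<close>

lemma ex_representatives:
  assumes "AE x in cube {..<Suc q}. \<exists>i j. i < j \<and> j < Suc q \<and> D (x i) (x j) = 0"
  obtains r xs where "0 < r" "r \<le> q" "AE y in unit_measure. \<exists>i<r. D (xs i) y = 0"
proof -
  define Z where "Z n \<longleftrightarrow> (AE x in cube {..<n}. \<exists>i j. i < j \<and> j < n \<and> D (x i) (x j) = 0)" for n
  define r where "r = (LEAST n. Z n) - 1"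
  have Zq: "Z (Suc q)" using assms by (simp add: Z_def)
  have "\<not> Z 0"
  proof
    assume "Z 0"
    then have "AE x in cube {..<0}. False" by (simp add: Z_def)
    then have "emeasure (cube {..<0}) (space (cube {..<0})) = 0"
      unfolding eventually_False ae_filter_eq_bot_iff .
    then show False using emeasure_cube_space[of "{..<0}"] by simp
  qed
  then have "(LEAST n. Z n) \<noteq> 0" using LeastI[of Z, OF Zq] by metis
  then have Sr: "Suc r = (LEAST n. Z n)" by (simp add: r_def)
  have "Z (Suc r)" unfolding Sr by (rule LeastI[of Z, OF Zq])
  have "\<not> Z r" using not_less_Least[of r Z] Sr by simp
  have "r \<le> q" using Least_le[of Z, OF Zq] Sr by simp
  let ?P = "\<lambda>x. \<exists>i j. i < j \<and> j < Suc r \<and> D (x i) (x j) = 0"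
  have ins: "{..<Suc r} = insert r {..<r}" by auto
  have "Measurable.pred (cube {..<Suc r}) (\<lambda>x. D (x i) (x j) = 0)" if "i \<in> {..<Suc r}" "j \<in> {..<Suc r}" for i j
  proof -
    have [measurable]: "(\<lambda>x. D (x i) (x j)) \<in> borel_measurable (cube {..<Suc r})"
      using that by (intro D_meas cube_coordinate)
    show ?thesis by measurable
  qed
  then have "Measurable.pred (cube {..<Suc r}) (\<lambda>x. \<exists>i\<in>{..<Suc r}. \<exists>j\<in>{..<Suc r}. i < j \<and> D (x i) (x j) = 0)"
    by (intro pred_intros_finite pred_intros_logic finite_lessThan; simp)
  moreover have "?P = (\<lambda>x. \<exists>i\<in>{..<Suc r}. \<exists>j\<in>{..<Suc r}. i < j \<and> D (x i) (x j) = 0)"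
    by (auto simp: fun_eq_iff)
  ultimately have meas: "Measurable.pred (cube {..<Suc r}) ?P" by simp
  have "AE x in cube (insert r {..<r}). ?P x"
    using \<open>Z (Suc r)\<close> unfolding Z_def ins .
  from AE_cube_insert[OF finite_lessThan _ meas[unfolded ins] this]
  have ae: "AE x in cube {..<r}. AE y in unit_measure. ?P (x(r := y))" by blast
  have "\<exists>x. (AE y in unit_measure. ?P (x(r := y))) \<and> \<not> (\<exists>i j. i < j \<and> j < r \<and> D (x i) (x j) = 0)"
  proof (rule ccontr)
    assume "\<not> ?thesis"
    then have "AE x in cube {..<r}. \<exists>i j. i < j \<and> j < r \<and> D (x i) (x j) = 0"
      by (intro eventually_mono[OF ae]) blast
    then show False using \<open>\<not> Z r\<close> unfolding Z_def by contradiction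
  qed
  then obtain x where x: "AE y in unit_measure. ?P (x(r := y))"
      and nz: "\<not> (\<exists>i j. i < j \<and> j < r \<and> D (x i) (x j) = 0)"
    by blast
  have AE: "AE y in unit_measure. \<exists>i<r. D (x i) y = 0"
    using x
  proof eventually_elim
    case (elim y)
    then obtain i j where ij: "i < j" "j < Suc r" "D ((x(r := y)) i) ((x(r := y)) j) = 0" by blast
    then have "j = r" using nz by (cases "j = r") auto
    then show ?case using ij by auto
  qed
  have "0 < r"
  proof (rule ccontr)
    assume "\<not> 0 < r"
    then have "AE y in unit_measure. False" using AE by simp
    then have "emeasure unit_measure (space unit_measure) = 0"
      unfolding eventually_False ae_filter_eq_bot_iff .
    then show False by (simp add: emeasure_restrict_space)
  qed
  then show ?thesis using that \<open>r \<le> q\<close> AE by blast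
qed

end

section \<open>From codegree classes to a step function\<close>

lemma integrable_pair_unit_bounded:
  assumes "(\<lambda>(x, y). f x y) \<in> borel_measurable (unit_measure \<Otimes>\<^sub>M unit_measure)" "\<And>x y. \<bar>f x y\<bar> \<le> (C::real)"
  shows "integrable (unit_measure \<Otimes>\<^sub>M unit_measure) (\<lambda>(x, y). f x y)"
proof -
  interpret P: finite_measure "unit_measure \<Otimes>\<^sub>M unit_measure"
    by (intro finite_measure_pair_measure finite_measure_unit)
  show ?thesis using assms by (intro P.integrable_const_bound[where B = C]) auto
qed

lemma integral_swap:
  assumes "(\<lambda>(x, y). f x y) \<in> borel_measurable (unit_measure \<Otimes>\<^sub>M unit_measure)" "\<And>x y. \<bar>f x y\<bar> \<le> (C::real)"
  shows "(LINT x|unit_measure. (LINT y|unit_measure. f x y)) = (LINT y|unit_measure. (LINT x|unit_measure. f x y))"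
  using unit_pair.Fubini_integral[OF integrable_pair_unit_bounded[OF assms]] by simp

text \<open>Both functions are densities of finite measures that agree on rectangles, an
  intersection-stable generator; a density is determined almost everywhere by its measure.\<close>

lemma AE_eq_if_rectangles_eq:
  fixes f g :: "real \<Rightarrow> real \<Rightarrow> real"
  assumes f: "(\<lambda>(x, y). f x y) \<in> borel_measurable (unit_measure \<Otimes>\<^sub>M unit_measure)" "\<And>x y. 0 \<le> f x y" "\<And>x y. f x y \<le> C"
    and g: "(\<lambda>(x, y). g x y) \<in> borel_measurable (unit_measure \<Otimes>\<^sub>M unit_measure)" "\<And>x y. 0 \<le> g x y" "\<And>x y. g x y \<le> C'"
    and eq: "\<And>X Y. X \<in> sets unit_measure \<Longrightarrow> Y \<in> sets unit_measure \<Longrightarrow>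
      (LINT x|unit_measure. indicator X x * (LINT y|unit_measure. f x y * indicator Y y)) =
      (LINT x|unit_measure. indicator X x * (LINT y|unit_measure. g x y * indicator Y y))"
  shows "AE z in unit_measure \<Otimes>\<^sub>M unit_measure. (\<lambda>(x, y). f x y) z = (\<lambda>(x, y). g x y) z"
proof -
  let ?P = "unit_measure \<Otimes>\<^sub>M unit_measure"
  let ?E = "{a \<times> b |a b. a \<in> sets unit_measure \<and> b \<in> sets unit_measure}"
  interpret P: finite_measure ?P by (intro finite_measure_pair_measure finite_measure_unit)
  have rect: "emeasure (density ?P (\<lambda>(x, y). ennreal (h x y))) (X \<times> Y) =
      ennreal (LINT x|unit_measure. indicator X x * (LINT y|unit_measure. h x y * indicator Y y))"
    if h: "(\<lambda>(x, y). h x y) \<in> borel_measurable ?P" "\<And>x y. 0 \<le> h x y" "\<And>x y. h x y \<le> c"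
      and XY: "X \<in> sets unit_measure" "Y \<in> sets unit_measure" for h :: "real \<Rightarrow> real \<Rightarrow> real" and c X Y
  proof -
    let ?h = "\<lambda>x y. indicator X x * (h x y * indicator Y y)"
    have hm: "(\<lambda>z. h (fst z) (snd z)) \<in> borel_measurable ?P" using h(1) by (simp add: case_prod_beta')
    have m: "(\<lambda>(x, y). ?h x y) \<in> borel_measurable ?P"
      unfolding case_prod_beta' using XY
      by (intro borel_measurable_times hm measurable_compose[OF measurable_fst] measurable_compose[OF measurable_snd])
        auto
    have b: "\<bar>?h x y\<bar> \<le> c" for x y
      using h(2,3)[of x y] by (auto simp: indicator_def)
    have "emeasure (density ?P (\<lambda>(x, y). ennreal (h x y))) (X \<times> Y) =
        (\<integral>\<^sup>+z. (\<lambda>(x, y). ennreal (h x y)) z * indicator (X \<times> Y) z \<partial>?P)"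
      using XY hm by (intro emeasure_density) (auto simp: case_prod_beta')
    also have "\<dots> = (\<integral>\<^sup>+z. ennreal ((\<lambda>(x, y). ?h x y) z) \<partial>?P)"
    proof (intro nn_integral_cong, clarify)
      fix x y
      show "ennreal (h x y) * indicator (X \<times> Y) (x, y) = ennreal (?h x y)"
        by (cases "x \<in> X"; cases "y \<in> Y") simp_all
    qed
    also have "\<dots> = ennreal (LINT z|?P. (\<lambda>(x, y). ?h x y) z)"
      using integrable_pair_unit_bounded[OF m b] h(2) by (intro nn_integral_eq_integral) auto
    also have "(LINT z|?P. (\<lambda>(x, y). ?h x y) z) = (LINT x|unit_measure. (LINT y|unit_measure. ?h x y))"
      by (rule unit_pair.integral_fst[OF integrable_pair_unit_bounded[OF m b], symmetric])
    finally show ?thesis by simp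
  qed
  have "density ?P (\<lambda>(x, y). ennreal (f x y)) = density ?P (\<lambda>(x, y). ennreal (g x y))" (is "?F = ?G")
  proof (rule measure_eqI_generator_eq[OF Int_stable_pair_measure_generator[of unit_measure unit_measure]])
    show "?E \<subseteq> Pow (space ?P)"
      using sets.space_closed[of unit_measure] by (auto simp: space_pair_measure)
    show "sets ?F = sigma_sets (space ?P) ?E" "sets ?G = sigma_sets (space ?P) ?E"
      by (simp_all add: sets_pair_measure space_pair_measure)
    show "emeasure ?F X = emeasure ?G X" if "X \<in> ?E" for X
      using that rect[OF f] rect[OF g] eq by auto
    show "range (\<lambda>_::nat. space unit_measure \<times> space unit_measure) \<subseteq> ?E" by blast
    show "(\<Union>i::nat. space unit_measure \<times> space unit_measure) = space ?P" by (simp add: space_pair_measure)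
    show "emeasure ?F (space unit_measure \<times> space unit_measure) \<noteq> \<infinity>"
      unfolding rect[OF f sets.top sets.top] by simp
  qed
  moreover have "(\<lambda>(x, y). ennreal (f x y)) \<in> borel_measurable ?P" "(\<lambda>(x, y). ennreal (g x y)) \<in> borel_measurable ?P"
    using f(1) g(1) by (simp_all add: case_prod_beta')
  ultimately have "AE z in ?P. (\<lambda>(x, y). ennreal (f x y)) z = (\<lambda>(x, y). ennreal (g x y)) z"
    using unit_pair.P.density_unique_iff by blast
  then show ?thesis
    by eventually_elim (use f(2) g(2) in \<open>auto\<close>)
qed

definition bounded_mble :: "(real \<Rightarrow> real) \<Rightarrow> bool" where
  "bounded_mble f \<longleftrightarrow> f \<in> borel_measurable unit_measure \<and> (\<exists>C. \<forall>x. \<bar>f x\<bar> \<le> C)"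

lemma bounded_mbleI: "f \<in> borel_measurable unit_measure \<Longrightarrow> (\<And>x. \<bar>f x\<bar> \<le> C) \<Longrightarrow> bounded_mble f"
  by (auto simp: bounded_mble_def)

lemma bounded_mble_mult: "bounded_mble f \<Longrightarrow> bounded_mble g \<Longrightarrow> bounded_mble (\<lambda>x. f x * g x)"
  unfolding bounded_mble_def by (auto simp: abs_mult) (meson abs_ge_zero mult_mono' order_trans)

lemma bounded_mble_diff: "bounded_mble f \<Longrightarrow> bounded_mble g \<Longrightarrow> bounded_mble (\<lambda>x. f x - g x)"
  unfolding bounded_mble_def by auto (meson abs_triangle_ineq4 add_mono order_trans)

lemma bounded_mble_integrable: "bounded_mble f \<Longrightarrow> integrable unit_measure f"
  unfolding bounded_mble_def using integrable_unit_bounded by blast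

lemma bounded_mble_indicator: "X \<in> sets unit_measure \<Longrightarrow> bounded_mble (indicator X)"
  by (rule bounded_mbleI[where C = 1]) (auto simp: indicator_def)

context unit_kernel
begin

definition T where "T f u = (LINT y|unit_measure. k u y * f y)"

lemma bounded_mble_k: "bounded_mble (\<lambda>y. k u y)"
  by (rule bounded_mbleI[where C = 1]) (auto intro: abs_k_le_1)

lemma T_meas: "bounded_mble f \<Longrightarrow> (\<lambda>u. T f u) \<in> borel_measurable unit_measure"
proof -
  assume "bounded_mble f"
  then have [measurable]: "f \<in> borel_measurable unit_measure" by (simp add: bounded_mble_def)
  show ?thesis unfolding T_def by (rule unit.borel_measurable_lebesgue_integral) measurable
qed

lemma bounded_mble_T: "bounded_mble f \<Longrightarrow> bounded_mble (T f)"
proof -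
  assume f: "bounded_mble f"
  then obtain C where C: "\<And>x. \<bar>f x\<bar> \<le> C" by (auto simp: bounded_mble_def)
  have "\<bar>k u y * f y\<bar> \<le> C" for u y
    using mult_mono[OF abs_k_le_1[of u y] C[of y]] by (simp add: abs_mult)
  then have "\<bar>T f u\<bar> \<le> C" for u unfolding T_def by (intro abs_integral_unit_le)
  then show ?thesis using T_meas[OF f] by (rule bounded_mbleI[rotated])
qed

lemma T_diff: "bounded_mble f \<Longrightarrow> bounded_mble g \<Longrightarrow> T (\<lambda>y. f y - g y) u = T f u - T g u"
  unfolding T_def
  by (simp add: right_diff_distrib bounded_mble_integrable bounded_mble_mult bounded_mble_k)

text \<open>\<open>T\<close> is self-adjoint because \<open>k\<close> is symmetric.\<close>

lemma integral_T_swap: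
  assumes f: "bounded_mble f" and h: "bounded_mble h"
  shows "(LINT u|unit_measure. h u * T f u) = (LINT y|unit_measure. f y * T h y)"
proof -
  obtain C where C: "\<And>x. \<bar>f x\<bar> \<le> C" using f by (auto simp: bounded_mble_def)
  obtain C' where C': "\<And>x. \<bar>h x\<bar> \<le> C'" using h by (auto simp: bounded_mble_def)
  have [measurable]: "f \<in> borel_measurable unit_measure" "h \<in> borel_measurable unit_measure"
    using f h by (auto simp: bounded_mble_def)
  have "(LINT u|unit_measure. h u * T f u) = (LINT u|unit_measure. (LINT y|unit_measure. h u * (k u y * f y)))"
    by (simp add: T_def)
  also have "\<dots> = (LINT y|unit_measure. (LINT u|unit_measure. h u * (k u y * f y)))"
  proof (rule integral_swap)
    show "(\<lambda>(u, y). h u * (k u y * f y)) \<in> borel_measurable (unit_measure \<Otimes>\<^sub>M unit_measure)" by measurable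
    show "\<bar>h u * (k u y * f y)\<bar> \<le> C' * (1 * C)" for u y
      unfolding abs_mult using C[of y] C'[of u] abs_k_le_1[of u y] by (intro mult_mono) auto
  qed
  also have "\<dots> = (LINT y|unit_measure. (LINT u|unit_measure. f y * (k y u * h u)))"
    by (simp add: k_sym mult_ac)
  finally show ?thesis by (simp add: T_def)
qed

lemma T_T: "bounded_mble f \<Longrightarrow> T (T f) y = (LINT x|unit_measure. f x * codeg x y)"
proof -
  assume f: "bounded_mble f"
  have "T (T f) y = (LINT u|unit_measure. k y u * T f u)" by (simp add: T_def[of "T f"])
  also have "\<dots> = (LINT x|unit_measure. f x * T (k y) x)"
    using integral_T_swap[OF f bounded_mble_k[of y]] by simp
  also have "T (k y) = (\<lambda>x. codeg x y)" by (simp add: T_def[abs_def] codeg_def k_sym)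
  finally show ?thesis .
qed

text \<open>A point and its representative have almost everywhere the same codegrees, so
  \<open>T (T f) y\<close> depends almost everywhere only on \<open>p y\<close> and
  \<open>orth\<close> applies. Self-adjointness turns the vanishing integral into the squared norm
  of \<open>T f\<close>.\<close>

lemma T_eq_0:
  assumes f: "bounded_mble f" and p: "p \<in> borel \<rightarrow>\<^sub>M count_space UNIV"
    and r: "AE y in unit_measure. D (xs (p y)) y = 0"
    and orth: "\<And>g :: nat \<Rightarrow> real. (LINT y|unit_measure. f y * g (p y)) = 0"
  shows "AE u in unit_measure. T f u = 0"
proof -
  have [measurable]: "f \<in> borel_measurable unit_measure" using f by (auto simp: bounded_mble_def)
  have Tf: "bounded_mble (T f)" by (rule bounded_mble_T[OF f])
  let ?g = "\<lambda>i. LINT x|unit_measure. f x * codeg x (xs i)"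
  have "AE y in unit_measure. f y * T (T f) y = f y * ?g (p y)"
    using r
  proof eventually_elim
    case (elim y)
    have "AE x in unit_measure. f x * codeg x y = f x * codeg x (xs (p y))"
      using D_eq_0[OF elim] by eventually_elim simp
    then have "(LINT x|unit_measure. f x * codeg x y) = ?g (p y)"
      by (intro integral_cong_AE) measurable
    then show ?case by (simp add: T_T[OF f])
  qed
  then have "(LINT y|unit_measure. f y * T (T f) y) = (LINT y|unit_measure. f y * ?g (p y))"
  proof (rule integral_cong_AE[rotated 2])
    show "(\<lambda>y. f y * T (T f) y) \<in> borel_measurable unit_measure"
      using T_meas[OF Tf] by measurable
    show "(\<lambda>y. f y * ?g (p y)) \<in> borel_measurable unit_measure"
      by (intro borel_measurable_times measurable_compose[OF measurable_compose[OF unit_id p], of ?g]) simp_all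
  qed
  also have "\<dots> = 0" by (rule orth)
  finally have "(LINT u|unit_measure. T f u * T f u) = 0"
    using integral_T_swap[OF f Tf] by simp
  moreover have "integrable unit_measure (\<lambda>u. T f u * T f u)"
    by (intro bounded_mble_integrable bounded_mble_mult Tf)
  ultimately have "AE u in unit_measure. T f u * T f u = 0"
    by (subst (asm) integral_nonneg_eq_0_iff_AE) auto
  then show ?thesis by eventually_elim simp
qed

text \<open>By \<open>T_eq_0\<close>, \<open>T\<close> does not distinguish an indicator from its
  class averages. Using this in both arguments of the form \<open>b\<close> shows that
  \<open>k\<close> and its class averages \<open>B\<close> have the same integrals over all
  rectangles.\<close>

lemma step_from_representatives:
  assumes r: "0 < r" and AE: "AE y in unit_measure. \<exists>i<r. D (xs i) y = 0"
  obtains p :: "real \<Rightarrow> nat" and B :: "nat \<Rightarrow> nat \<Rightarrow> real" where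
    "p \<in> borel \<rightarrow>\<^sub>M count_space UNIV" "\<And>x. p x < r" "\<And>i j. B i j = B j i"
    "AE z in unit_measure \<Otimes>\<^sub>M unit_measure. (\<lambda>(x, y). k x y) z = (\<lambda>(x, y). B (p x) (p y)) z"
proof -
  define Q where "Q y \<longleftrightarrow> (\<exists>i<r. D (xs i) y = 0)" for y
  \<comment> \<open>Taking the least index makes the classes disjoint and measurable; exceptional
    points go to class 0, which exists as \<open>r > 0\<close>.\<close>
  define p where "p y = (if Q y then LEAST i. i < r \<and> D (xs i) y = 0 else 0)" for y
  have [measurable]: "Measurable.pred borel (\<lambda>y. D (xs i) y = 0)" for i
  proof -
    have [measurable]: "(\<lambda>y. D (xs i) y) \<in> borel_measurable borel" by (intro D_meas) auto
    show ?thesis by measurable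
  qed
  have [measurable]: "Measurable.pred borel Q"
  proof -
    have "Q = (\<lambda>y. \<exists>i\<in>{..<r}. D (xs i) y = 0)" by (auto simp: fun_eq_iff Q_def)
    then show ?thesis by simp
  qed
  have p: "p \<in> borel \<rightarrow>\<^sub>M count_space UNIV" unfolding p_def[abs_def] by measurable
  have pQ: "p y < r \<and> D (xs (p y)) y = 0" if "Q y" for y
    using LeastI_ex[of "\<lambda>i. i < r \<and> D (xs i) y = 0"] that by (auto simp: p_def Q_def)
  then have p_less: "p y < r" for y using r by (cases "Q y") (auto simp: p_def)
  have AE_p: "AE y in unit_measure. D (xs (p y)) y = 0"
    using AE by eventually_elim (use pQ in \<open>auto simp: Q_def\<close>)
  define \<delta> where "\<delta> i y = (if p y = i then 1 else 0 :: real)" for i y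
  have bm_p: "bounded_mble (\<lambda>y. g (p y))" for g :: "nat \<Rightarrow> real"
  proof (rule bounded_mbleI)
    show "(\<lambda>y. g (p y)) \<in> borel_measurable unit_measure"
      by (rule measurable_compose[OF measurable_compose[OF unit_id p]]) simp
    show "\<bar>g (p y)\<bar> \<le> Max ((\<lambda>i. \<bar>g i\<bar>) ` {..<r})" for y using p_less[of y] by (intro Max_ge) auto
  qed
  have bm_\<delta>: "bounded_mble (\<delta> i)" for i
    using bm_p[of "\<lambda>j. if j = i then 1 else 0"] by (simp add: \<delta>_def[abs_def])
  have expand: "g (p y) = (\<Sum>i<r. g i * \<delta> i y)" for g :: "nat \<Rightarrow> real" and y
    using p_less[of y] by (simp add: \<delta>_def if_distrib cong: if_cong)
  have int_expand: "(LINT y|unit_measure. f y * g (p y)) = (\<Sum>i<r. g i * (LINT y|unit_measure. f y * \<delta> i y))"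
    if f: "bounded_mble f" for f and g :: "nat \<Rightarrow> real"
  proof -
    have "(LINT y|unit_measure. f y * g (p y)) = (LINT y|unit_measure. (\<Sum>i<r. g i * (f y * \<delta> i y)))"
      unfolding expand[of g] by (simp add: sum_distrib_left mult_ac)
    also have "\<dots> = (\<Sum>i<r. g i * (LINT y|unit_measure. f y * \<delta> i y))"
      using bounded_mble_integrable[OF bounded_mble_mult[OF f bm_\<delta>]] by (subst Bochner_Integration.integral_sum) auto
    finally show ?thesis .
  qed
  define m where "m Y i = (LINT y|unit_measure. indicator Y y * \<delta> i y)" for Y i
  define n where "n i = (LINT y|unit_measure. \<delta> i y)" for i
  \<comment> \<open>For a null class, \<open>n i\<close> and \<open>m Y i\<close> are both 0, and
    the convention for division by 0 makes \<open>avg Y i * n i = m Y i\<close> true there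
    too.\<close>
  define avg where "avg Y i = m Y i / n i" for Y i
  have m_bounds: "0 \<le> m Y i" "m Y i \<le> n i" if "Y \<in> sets unit_measure" for Y i
  proof -
    show "0 \<le> m Y i" unfolding m_def by (intro Bochner_Integration.integral_nonneg) (simp add: \<delta>_def)
    show "m Y i \<le> n i" unfolding m_def n_def
    proof (rule integral_mono)
      show "indicator Y x * \<delta> i x \<le> \<delta> i x" for x by (simp add: \<delta>_def indicator_def)
    qed (intro bounded_mble_integrable bounded_mble_mult bounded_mble_indicator bm_\<delta> that)+
  qed
  have n_nonneg: "0 \<le> n i" for i unfolding n_def by (intro Bochner_Integration.integral_nonneg) (auto simp: \<delta>_def)
  have avg: "avg Y i * n i = m Y i" if "Y \<in> sets unit_measure" for Y i
    using m_bounds[OF that, of i] by (auto simp: avg_def)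
  have T_avg: "AE u in unit_measure. T (indicator Y) u = T (\<lambda>y. avg Y (p y)) u"
    if Y: "Y \<in> sets unit_measure" for Y
  proof -
    let ?f = "\<lambda>y. indicator Y y - avg Y (p y)"
    have bf: "bounded_mble ?f" by (intro bounded_mble_diff bounded_mble_indicator bm_p Y)
    have "(LINT y|unit_measure. ?f y * \<delta> i y) = 0" if "i < r" for i
    proof -
      have "(LINT y|unit_measure. ?f y * \<delta> i y) = (LINT y|unit_measure. indicator Y y * \<delta> i y - avg Y i * \<delta> i y)"
        by (intro Bochner_Integration.integral_cong) (auto simp: \<delta>_def)
      also have "\<dots> = m Y i - avg Y i * n i"
        unfolding m_def n_def
        using bounded_mble_integrable[OF bounded_mble_mult[OF bounded_mble_indicator[OF Y] bm_\<delta>]]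
          bounded_mble_integrable[OF bm_\<delta>]
        by (subst Bochner_Integration.integral_diff) auto
      finally show ?thesis using avg[OF Y] by simp
    qed
    then have "AE u in unit_measure. T ?f u = 0"
      by (intro T_eq_0[OF bf p AE_p]) (simp add: int_expand[OF bf])
    then show ?thesis
      by eventually_elim (simp add: T_diff bounded_mble_indicator[OF Y] bm_p)
  qed
  define b where "b f g = (LINT u|unit_measure. f u * T g u)" for f g
  have b_sym: "b f g = b g f" if "bounded_mble f" "bounded_mble g" for f g
    unfolding b_def using integral_T_swap[OF that(2,1)] .
  have b_avg: "b f (indicator Y) = b f (\<lambda>y. avg Y (p y))" if f: "bounded_mble f" and Y: "Y \<in> sets unit_measure" for f Y
    unfolding b_def
  proof (rule integral_cong_AE)
    have [measurable]: "f \<in> borel_measurable unit_measure" using f by (simp add: bounded_mble_def)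
    show "(\<lambda>u. f u * T (indicator Y) u) \<in> borel_measurable unit_measure"
      "(\<lambda>u. f u * T (\<lambda>y. avg Y (p y)) u) \<in> borel_measurable unit_measure"
      using T_meas[OF bounded_mble_indicator[OF Y]] T_meas[OF bm_p[of "avg Y"]] by simp_all
    show "AE u in unit_measure. f u * T (indicator Y) u = f u * T (\<lambda>y. avg Y (p y)) u"
      using T_avg[OF Y] by eventually_elim simp
  qed
  have b_expand: "b f (\<lambda>y. g (p y)) = (\<Sum>j<r. g j * b f (\<delta> j))" if f: "bounded_mble f" for f and g :: "nat \<Rightarrow> real"
  proof -
    have "b f (\<lambda>y. g (p y)) = (LINT y|unit_measure. T f y * g (p y))"
      unfolding b_def using integral_T_swap[OF bm_p f, of g] by (simp add: mult.commute)
    also have "\<dots> = (\<Sum>j<r. g j * (LINT y|unit_measure. T f y * \<delta> j y))"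
      by (rule int_expand[OF bounded_mble_T[OF f]])
    also have "\<dots> = (\<Sum>j<r. g j * b f (\<delta> j))"
      unfolding b_def using integral_T_swap[OF bm_\<delta> f] by (simp add: mult.commute)
    finally show ?thesis .
  qed
  \<comment> \<open>The mean of \<open>k\<close> over a product of two classes, and 0 if one of them
    is null.\<close>
  define B where "B i j = b (\<delta> i) (\<delta> j) / (n i * n j)" for i j
  have B_sym: "B i j = B j i" for i j
    unfolding B_def using b_sym[OF bm_\<delta> bm_\<delta>, of i j] by (simp add: mult.commute)
  have B_nonneg: "0 \<le> B i j" for i j
    unfolding B_def b_def T_def using k_nonneg n_nonneg
    by (intro divide_nonneg_nonneg mult_nonneg_nonneg Bochner_Integration.integral_nonneg) (auto simp: \<delta>_def)
  have rect: "b (indicator X) (indicator Y) = (\<Sum>i<r. \<Sum>j<r. avg X i * avg Y j * b (\<delta> i) (\<delta> j))"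
    if X: "X \<in> sets unit_measure" and Y: "Y \<in> sets unit_measure" for X Y
  proof -
    note bX = bounded_mble_indicator[OF X]
    have "b (indicator X) (indicator Y) = (\<Sum>j<r. avg Y j * b (indicator X) (\<delta> j))"
      by (simp add: b_avg[OF bX Y] b_expand[OF bX])
    moreover have "b (indicator X) (\<delta> j) = (\<Sum>i<r. avg X i * b (\<delta> i) (\<delta> j))" for j
    proof -
      have "b (indicator X) (\<delta> j) = b (\<delta> j) (indicator X)" by (rule b_sym[OF bX bm_\<delta>])
      also have "\<dots> = (\<Sum>i<r. avg X i * b (\<delta> j) (\<delta> i))" by (simp add: b_avg[OF bm_\<delta> X] b_expand[OF bm_\<delta>])
      finally show ?thesis using b_sym[OF bm_\<delta> bm_\<delta>] by simp
    qed
    ultimately have "b (indicator X) (indicator Y) = (\<Sum>j<r. avg Y j * (\<Sum>i<r. avg X i * b (\<delta> i) (\<delta> j)))"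
      by simp
    also have "\<dots> = (\<Sum>j<r. \<Sum>i<r. avg X i * avg Y j * b (\<delta> i) (\<delta> j))"
      by (simp add: sum_distrib_left mult_ac)
    finally show ?thesis by (subst sum.swap)
  qed
  have step_rect: "(LINT x|unit_measure. indicator X x * (LINT y|unit_measure. B (p x) (p y) * indicator Y y)) =
      (\<Sum>i<r. \<Sum>j<r. avg X i * avg Y j * b (\<delta> i) (\<delta> j))"
    if X: "X \<in> sets unit_measure" and Y: "Y \<in> sets unit_measure" for X Y
  proof -
    have "(LINT y|unit_measure. B (p x) (p y) * indicator Y y) = (\<Sum>j<r. B (p x) j * m Y j)" for x
      using int_expand[OF bounded_mble_indicator[OF Y], of "B (p x)"] by (simp add: m_def mult.commute)
    then have "(LINT x|unit_measure. indicator X x * (LINT y|unit_measure. B (p x) (p y) * indicator Y y)) =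
        (\<Sum>i<r. (\<Sum>j<r. B i j * m Y j) * m X i)"
      using int_expand[OF bounded_mble_indicator[OF X], of "\<lambda>i. \<Sum>j<r. B i j * m Y j"] by (simp add: m_def)
    also have "\<dots> = (\<Sum>i<r. \<Sum>j<r. avg X i * avg Y j * b (\<delta> i) (\<delta> j))"
      unfolding sum_distrib_right by (intro sum.cong refl) (simp add: B_def avg_def)
    finally show ?thesis .
  qed
  have "AE z in unit_measure \<Otimes>\<^sub>M unit_measure. (\<lambda>(x, y). k x y) z = (\<lambda>(x, y). B (p x) (p y)) z"
  proof (rule AE_eq_if_rectangles_eq)
    show "(\<lambda>(x, y). k x y) \<in> borel_measurable (unit_measure \<Otimes>\<^sub>M unit_measure)"
      by (rule measurable_pair_unit[OF k_measurable])
    have "(\<lambda>z. B i (p (snd z))) \<in> borel_measurable (unit_measure \<Otimes>\<^sub>M unit_measure)" for i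
      by (rule measurable_compose[OF measurable_compose[OF measurable_compose[OF measurable_snd unit_id] p], of "B i"]) simp
    from measurable_compose_countable[OF this measurable_compose[OF measurable_compose[OF measurable_fst unit_id] p]]
    show "(\<lambda>(x, y). B (p x) (p y)) \<in> borel_measurable (unit_measure \<Otimes>\<^sub>M unit_measure)"
      by (simp add: case_prod_beta')
    show "B (p x) (p y) \<le> Max ((\<lambda>(i, j). B i j) ` ({..<r} \<times> {..<r}))" for x y
      using p_less by (intro Max_ge) auto
    show "(LINT x|unit_measure. indicator X x * (LINT y|unit_measure. k x y * indicator Y y)) =
      (LINT x|unit_measure. indicator X x * (LINT y|unit_measure. B (p x) (p y) * indicator Y y))"
      if "X \<in> sets unit_measure" "Y \<in> sets unit_measure" for X Y
      using rect[OF that] unfolding step_rect[OF that] b_def T_def .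
  qed (use k_nonneg k_le_1 B_nonneg in auto)
  then show ?thesis using that[of p B, OF p p_less B_sym] by blast
qed

end

theorem theorem1:
  fixes q :: nat and W W' :: "real \<times> real \<Rightarrow> real"
  assumes "q \<ge> 2"
    and "step_graphon q W"
    and "graphon W'"
    and "\<And>V E. simple_graph V E \<Longrightarrow> card V \<le> 4 * q\<^sup>2 - q \<Longrightarrow>
           hom_density V E W' = hom_density V E W"
  shows "weakly_isomorphic W W'"
proof -
  obtain p A where p: "p \<in> borel \<rightarrow>\<^sub>M count_space UNIV" "\<And>x. p x < q"
    and WA: "AE (x, y) in unit_measure \<Otimes>\<^sub>M unit_measure. W (x, y) = A (p x) (p y)"
    and symA: "\<And>i j. i < q \<Longrightarrow> j < q \<Longrightarrow> A i j = A j i"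
    and rows: "\<And>i j. i < q \<Longrightarrow> j < q \<Longrightarrow> i \<noteq> j \<Longrightarrow> \<exists>k<q. A i k \<noteq> A j k"
    and pos: "\<And>i. i < q \<Longrightarrow> measure unit_measure {x \<in> {0..1}. p x = i} > 0"
    by (rule step_graphon_model[OF assms(2)]) (rule that; assumption)
  define \<alpha> where "\<alpha> i = measure unit_measure {x \<in> {0..1}. p x = i}" for i
  have dens_W: "hom_density V E W = hom_sum q \<alpha> A V E" if "simple_graph V E" for V E
    unfolding \<alpha>_def[abs_def] by (rule hom_density_step[OF p WA that])
  obtain k where k: "(\<lambda>(x, y). k x y) \<in> borel_measurable borel" "\<And>x y. k x y = k y x"
      "\<And>x y. 0 \<le> k x y" "\<And>x y. k x y \<le> 1"
    and W'k: "AE z in unit_measure \<Otimes>\<^sub>M unit_measure. W' z = (\<lambda>(x, y). k x y) z"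
    by (rule borel_representative[OF assms(3)]) (rule that; assumption)
  interpret unit_kernel k using k by unfold_locales
  have "AE x in cube {..<Suc q}. \<exists>i j. i < j \<and> j < Suc q \<and> D (x i) (x j) = 0"
    using assms(4) dens_W by (intro AE_D_eq_0[OF W'k assms(1) symA, where \<alpha> = \<alpha>]) simp_all
  then obtain r xs where r: "0 < r" "r \<le> q" and AE: "AE y in unit_measure. \<exists>i<r. D (xs i) y = 0"
    by (rule ex_representatives)
  obtain p' B where p': "p' \<in> borel \<rightarrow>\<^sub>M count_space UNIV" "\<And>x. p' x < r"
    and symB: "\<And>i j. B i j = B j i"
    and kB: "AE z in unit_measure \<Otimes>\<^sub>M unit_measure. (\<lambda>(x, y). k x y) z = (\<lambda>(x, y). B (p' x) (p' y)) z"
    by (rule step_from_representatives[OF r(1) AE]) (rule that; assumption)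
  have W'B: "AE (x, y) in unit_measure \<Otimes>\<^sub>M unit_measure. W' (x, y) = B (p' x) (p' y)"
    using W'k kB by eventually_elim auto
  define \<beta> where "\<beta> i = measure unit_measure {x \<in> {0..1}. p' x = i}" for i
  have dens_W': "hom_density V E W' = hom_sum r \<beta> B V E" if "simple_graph V E" for V E
    unfolding \<beta>_def[abs_def] by (rule hom_density_step[OF p' W'B that])
  obtain \<tau> where \<tau>: "bij_betw \<tau> {..<q} {..<r}" "\<And>i. i < q \<Longrightarrow> \<beta> (\<tau> i) = \<alpha> i"
    "\<And>i j. i < q \<Longrightarrow> j < q \<Longrightarrow> B (\<tau> i) (\<tau> j) = A i j"
  proof (rule twin_free_model_determined[of q r A \<alpha> B \<beta>, OF assms(1) r(2) symA rows])
    show "\<alpha> i > 0" if "i < q" for i using pos[OF that] by (simp add: \<alpha>_def)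
    show "(\<Sum>i<q. \<alpha> i) = 1" unfolding \<alpha>_def by (rule sum_part_measures[OF p])
    \<comment> \<open>A class may still be null here; positivity follows only afterwards from
      \<open>\<beta> (\<tau> i) = \<alpha> i\<close>.\<close>
    show "\<beta> i \<ge> 0" for i by (simp add: \<beta>_def)
    show "(\<Sum>i<r. \<beta> i) = 1" unfolding \<beta>_def by (rule sum_part_measures[OF p'])
    show "B i j = B j i" for i j by (rule symB)
    show "hom_sum q \<alpha> A V E = hom_sum r \<beta> B V E" if "simple_graph V E" "card V \<le> 4 * q\<^sup>2 - q" for V E
      using assms(4)[OF that] dens_W dens_W' that(1) by simp
  qed (assumption+, (rule that; assumption))
  \<comment> \<open>An isomorphism of the weighted models preserves homomorphism sums of graphs of
    any size.\<close>
  show ?thesis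
    unfolding weakly_isomorphic_def
    using dens_W dens_W' hom_sum_reindex[of \<tau> q r \<beta> \<alpha> B A, OF \<tau>] by simp
qed

end
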